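(* Let $T\in(0,\infty]$ be fixed, let $\Delta=(0,T]$ if $T<\infty$ and $\Delta=(0,\infty)$ if $T=\infty$. Consider the following risk model: the claim number process $\{N(t),t\ge0\}$ is a counting process with finite mean function $\lambda(t)=EN(t)\to\infty$ as $t\to\infty$; the premium income process $\{Y(t),t\ge0\}$ is a nondecreasing and nonnegative stochastic process with finite mean function $b(t)=EY(t)\to\infty$ as $t\to\infty$; the claim sizes $\{X,X_k,k\ge1\}$ are i.i.d. nonnegative random variables with common distribution $F$ and finite mean $\mu$; and $\{Y(t),t\ge 0\}$, $\{N(t),t\ge 0\}$, $\{X_k,k\ge 1\}$ are mutually independent. Let $S(t)=\sum_{i=1}^{N(t)}X_i-Y(t)$ be the claim surplus process, and put $F_\Delta(x)=F(x+\Delta)$. Suppose that $E(X^+)^r<\infty$ for some $r>1$ and that $F_\Delta$ is almost decreasing. Assume that there exists a positive number $\nu$ such that $$\limsup_{t\to\infty}\frac{b(t)}{\lambda(t)}=\nu<\infty,$$ that $$\frac{Y(t)}{b(t)}\to1\ \text{ in probability as } t\to\infty,$$ and that there is some $p>|\beta(F_\Delta)|$ such that for all $\delta>0$ $$E\big[N^p(t)\,I(N(t)>(1+\delta)\lambda(t))\big]=O(\lambda(t)),\qquad t\to\infty.$$ If $F_\Delta\in\mathcal{OR}$, then for any fixed $\gamma>\nu$ the relation $$l_{F_\Delta}^3\,\lambda(t)F(x+\mu+\Delta)\ \lesssim\ P\big(S(t)-ES(t)\in x+\Delta\big)\ \lesssim\ L_{F_\Delta}^3\,\lambda(t)F(x+\mu+\Delta)$$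 holds uniformly for all $x\ge\gamma\lambda(t)$ as $t\to\infty$. In particular, if $F_\Delta\in\mathcal{IR}$, then for every fixed $\gamma>\nu$ the relation $$P\big(S(t)-ES(t)\in x+\Delta\big)\sim\lambda(t)F(x+\mu+\Delta)$$ holds uniformly for all $x\ge\gamma\lambda(t)$ as $t\to\infty$.
   Context: Notation. $x+\Delta=\{x+y:y\in\Delta\}$, and $F(x+\Delta)=P(X\in x+\Delta)$, i.e. $F((x,x+T])$ if $T<\infty$ and $F((x,\infty))$ if $T=\infty$. $I(A)$ is the indicator of $A$, $X^+=X\,I(X\ge0)$, and an empty sum is $0$. A function $f$ is eventually positive if $f(x)>0$ for all sufficiently large $x$. For an eventually positive function $f$: - $f\in\mathcal{OR}$ ($\mathcal{O}$-regularly varying) if $0<\liminf_{x\to\infty}\frac{f(xy)}{f(x)}\le\limsup_{x\to\infty}\frac{f(xy)}{f(x)}<\infty$ for each fixed $y\ge 1$. - $f\in\mathcal{IR}$ (intermediate regularly varying) if $\lim_{y\downarrow1}\liminf_{x\to\infty}\frac{f(xy)}{f(x)}=\lim_{y\downarrow1}\limsup_{x\to\infty}\frac{f(xy)}{f(x)}=1$. - $f$ is almost decreasing if $\limsup_{x\to\infty}\frac{\sup_{u\ge x}f(u)}{f(x)}<\infty$. - The lower Matuszewska index is $\beta(f)=\lim_{y\to\infty}\frac{\log\left(\liminf_{x\to\infty}f(xy)/f(x)\right)}{\log y}$. - $l_f=\lim_{\epsilon\downarrow0}\liminf_{x\to\infty}\frac{\inf_{(1-\epsilon)x\le z\le(1+\epsilon)x}f(z)}{f(x)}$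 and $L_f=\lim_{\epsilon\downarrow0}\limsup_{x\to\infty}\frac{\sup_{(1-\epsilon)x\le z\le(1+\epsilon)x}f(z)}{f(x)}$. Uniform asymptotics: for nonnegative $a(t,x),b(t,x)$ and nonempty $x$-regions $\mathcal{D}_t$, "$a(t,x)\lesssim b(t,x)$ holds uniformly for all $x\in\mathcal{D}_t$ as $t\to\infty$" means $\limsup_{t\to\infty}\sup_{x\in\mathcal{D}_t}\frac{a(t,x)}{b(t,x)}\le1$; "$a(t,x)\sim b(t,x)$ uniformly" means that both $a\lesssim b$ and $b\lesssim a$ hold uniformly. *)

theory Defs
  imports "HOL-Probability.Probability" "HOL-Library.Landau_Symbols"
begin

text \<open>Classes and indices of eventually positive functions. Ratios whose lower or upper limit
  may be infinite are taken in \<^typ>\<open>ereal\<close>.\<close>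

definition eventually_positive :: "(real \<Rightarrow> real) \<Rightarrow> bool" where
  "eventually_positive f \<longleftrightarrow> (\<forall>\<^sub>F x in at_top. f x > 0)"

definition lower_ratio :: "(real \<Rightarrow> real) \<Rightarrow> real \<Rightarrow> ereal" where
  "lower_ratio f y = Liminf at_top (\<lambda>x. ereal (f (x * y) / f x))"

definition upper_ratio :: "(real \<Rightarrow> real) \<Rightarrow> real \<Rightarrow> ereal" where
  "upper_ratio f y = Limsup at_top (\<lambda>x. ereal (f (x * y) / f x))"

definition O_regularly_varying :: "(real \<Rightarrow> real) \<Rightarrow> bool" where
  "O_regularly_varying f \<longleftrightarrow> eventually_positive f \<and>
     (\<forall>y\<ge>1. 0 < lower_ratio f y \<and> lower_ratio f y \<le> upper_ratio f y \<and> upper_ratio f y < \<infinity>)"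

definition intermediate_regularly_varying :: "(real \<Rightarrow> real) \<Rightarrow> bool" where
  "intermediate_regularly_varying f \<longleftrightarrow> eventually_positive f \<and>
     (lower_ratio f \<longlongrightarrow> 1) (at_right 1) \<and> (upper_ratio f \<longlongrightarrow> 1) (at_right 1)"

definition almost_decreasing :: "(real \<Rightarrow> real) \<Rightarrow> bool" where
  "almost_decreasing f \<longleftrightarrow> eventually_positive f \<and>
     Limsup at_top (\<lambda>x. (SUP u\<in>{x..}. ereal (f u)) / ereal (f x)) < \<infinity>"

definition ext_ln :: "ereal \<Rightarrow> ereal" where
  "ext_ln x = (if x \<le> 0 then -\<infinity> else if x = \<infinity> then \<infinity> else ereal (ln (real_of_ereal x)))"

definition lower_Matuszewska_index :: "(real \<Rightarrow> real) \<Rightarrow> ereal" where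
  "lower_Matuszewska_index f = Lim at_top (\<lambda>y. ext_ln (lower_ratio f y) / ereal (ln y))"

definition l_const :: "(real \<Rightarrow> real) \<Rightarrow> ereal" where
  "l_const f = Lim (at_right 0) (\<lambda>\<epsilon>. Liminf at_top
     (\<lambda>x. (INF z\<in>{(1 - \<epsilon>) * x..(1 + \<epsilon>) * x}. ereal (f z)) / ereal (f x)))"

definition L_const :: "(real \<Rightarrow> real) \<Rightarrow> ereal" where
  "L_const f = Lim (at_right 0) (\<lambda>\<epsilon>. Limsup at_top
     (\<lambda>x. (SUP z\<in>{(1 - \<epsilon>) * x..(1 + \<epsilon>) * x}. ereal (f z)) / ereal (f x)))"

text \<open>Uniform asymptotics. Division in \<^typ>\<open>ereal\<close> gives \<open>a / 0 = \<infinity>\<close> for \<open>a > 0\<close>, so a vanishing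
  denominator cannot make the relation hold by accident, as it could with \<open>a / 0 = 0\<close> on the reals.\<close>

definition uniformly_lesssim ::
  "(real \<Rightarrow> real set) \<Rightarrow> (real \<Rightarrow> real \<Rightarrow> ereal) \<Rightarrow> (real \<Rightarrow> real \<Rightarrow> ereal) \<Rightarrow> bool" where
  "uniformly_lesssim D a b \<longleftrightarrow> Limsup at_top (\<lambda>t. SUP x\<in>D t. a t x / b t x) \<le> 1"

definition uniformly_sim ::
  "(real \<Rightarrow> real set) \<Rightarrow> (real \<Rightarrow> real \<Rightarrow> ereal) \<Rightarrow> (real \<Rightarrow> real \<Rightarrow> ereal) \<Rightarrow> bool" where
  "uniformly_sim D a b \<longleftrightarrow> uniformly_lesssim D a b \<and> uniformly_lesssim D b a"

definition Delta :: "ereal \<Rightarrow> real set" where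
  "Delta T = (if T = \<infinity> then {0<..} else {0<..real_of_ereal T})"

definition F_Delta :: "real measure \<Rightarrow> ereal \<Rightarrow> real \<Rightarrow> real" where
  "F_Delta F T x = measure F ((+) x ` Delta T)"

text \<open>Processes are indexed by \<^typ>\<open>real\<close>; only their values at times \<open>t \<ge> 0\<close> are constrained.\<close>

definition counting_process :: "'a measure \<Rightarrow> (real \<Rightarrow> 'a \<Rightarrow> nat) \<Rightarrow> bool" where
  "counting_process M N \<longleftrightarrow> (\<forall>t\<ge>0. N t \<in> measurable M (count_space UNIV)) \<and>
     (AE \<omega> in M. \<forall>s t. 0 \<le> s \<and> s \<le> t \<longrightarrow> N s \<omega> \<le> N t \<omega>)"

definition nonneg_nondecreasing_process :: "'a measure \<Rightarrow> (real \<Rightarrow> 'a \<Rightarrow> real) \<Rightarrow> bool" where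
  "nonneg_nondecreasing_process M Y \<longleftrightarrow> (\<forall>t\<ge>0. Y t \<in> borel_measurable M) \<and>
     (AE \<omega> in M. \<forall>t\<ge>0. 0 \<le> Y t \<omega>) \<and>
     (AE \<omega> in M. \<forall>s t. 0 \<le> s \<and> s \<le> t \<longrightarrow> Y s \<omega> \<le> Y t \<omega>)"

text \<open>The \<open>\<sigma>\<close>-algebra on the sample space generated by a family of random variables.\<close>

definition generated_sigma ::
  "'a measure \<Rightarrow> 'b measure \<Rightarrow> 'i set \<Rightarrow> ('i \<Rightarrow> 'a \<Rightarrow> 'b) \<Rightarrow> 'a set set" where
  "generated_sigma M B I Z =
     sigma_sets (space M) {Z i -` A \<inter> space M | i A. i \<in> I \<and> A \<in> sets B}"

definition tendsto_in_prob :: "'a measure \<Rightarrow> (real \<Rightarrow> 'a \<Rightarrow> real) \<Rightarrow> real \<Rightarrow> bool" where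
  "tendsto_in_prob M Z c \<longleftrightarrow>
     (\<forall>\<epsilon>>0. ((\<lambda>t. measure M {\<omega>\<in>space M. \<bar>Z t \<omega> - c\<bar> > \<epsilon>}) \<longlongrightarrow> 0) at_top)"

definition claim_surplus ::
  "(real \<Rightarrow> 'a \<Rightarrow> nat) \<Rightarrow> (real \<Rightarrow> 'a \<Rightarrow> real) \<Rightarrow> (nat \<Rightarrow> 'a \<Rightarrow> real) \<Rightarrow> real \<Rightarrow> 'a \<Rightarrow> real" where
  "claim_surplus N Y X t \<omega> = (\<Sum>i=1..N t \<omega>. X i \<omega>) - Y t \<omega>"

definition centered_surplus_prob ::
  "'a measure \<Rightarrow> (real \<Rightarrow> 'a \<Rightarrow> real) \<Rightarrow> ereal \<Rightarrow> real \<Rightarrow> real \<Rightarrow> real" where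
  "centered_surplus_prob M S T t x =
     measure M {\<omega>\<in>space M. S t \<omega> - (\<integral>\<omega>'. S t \<omega>' \<partial>M) \<in> (+) x ` Delta T}"

end

theory Submission
  imports Defs "HOL-Real_Asymp.Real_Asymp"
begin

text \<open>
  Write \<open>f = F_Delta F T\<close>. A sum of \<open>n\<close> claims exceeds its mean by \<open>x \<ge> \<gamma> n\<close> essentially only
  through one claim of size comparable to \<open>x\<close>: by a truncated exponential Markov inequality, the
  event that all claims stay below \<open>\<alpha> x\<close> has probability below any prescribed power of \<open>x\<close>, hence
  is negligible against \<open>f x\<close>, which the Matuszewska index bounds below by a power. Conditioning on
  the other claims, which obey the weak law of large numbers, the big claim has to hit a translate
  of \<open>Delta T\<close> by \<open>x (1 + o(1))\<close>, so the probability in question is between \<open>n\<close> times the infimum and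
  \<open>n\<close> times the supremum of \<open>f\<close> over \<open>[(1 - eps) x, (1 + eps) x]\<close>.

  Given \<open>N t = n\<close> and \<open>Y t = y\<close>, the surplus event is such an event with \<open>x\<close> replaced by
  \<open>x + mu (lam t - n) + y - b t\<close>. When \<open>N t\<close> and \<open>Y t\<close> are close to their means this is close to \<open>x\<close>.
  Since \<open>Y t \<ge> 0\<close> and \<open>\<gamma> > nu\<close>, it stays above a multiple of \<open>x\<close> unless \<open>N t\<close> is large, and then the
  moment condition on \<open>N t\<close> takes over. This yields the bounds with the first powers of the
  constants, and \<open>l_const f ^ 3 \<le> l_const f \<le> 1 \<le> L_const f \<le> L_const f ^ 3\<close>.
\<close>

section \<open>O-regular and intermediate regular variation\<close>

text \<open>The difficulty is one of scale: an event of small probability, such as a deviation in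
  the weak law, need not be small against \<open>f x\<close>. Unlikely configurations are therefore
  estimated jointly with a big claim. Given the other claims, a claim above
  \<open>\<alpha> * x\<close> completes the sum to a point of the target window with probability at
  most a constant times \<open>f x\<close>, wherever the window lies. So the factor
  \<open>f x\<close> survives, and the rare configuration supplies a second, small factor. The
  exponent \<open>q\<close>, strictly between the absolute value of the index and \<open>p\<close>,
  serves twice. The bound \<open>c * x powr (- q) \<le> f x\<close> turns powers of \<open>x\<close>
  into multiples of \<open>f x\<close>, and the gap between \<open>q\<close> and \<open>p\<close>
  improves the order of the tail moment of \<open>N t\<close> from \<open>O(lam t)\<close> to
  \<open>o(lam t)\<close>. The estimates use regular variation only in the form
  \<open>0 < lower_ratio f y\<close> for \<open>1 \<le> y\<close>, which both classes in the theorem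
  provide, so its two halves share one proof.\<close>

lemma almost_decreasingE:
  assumes "almost_decreasing f"
  obtains C x0 where "1 \<le> C" "0 < x0" "\<And>x. x0 \<le> x \<Longrightarrow> 0 < f x"
    "\<And>x u. x0 \<le> x \<Longrightarrow> x \<le> u \<Longrightarrow> f u \<le> C * f x"
proof -
  obtain C where C: "Limsup at_top (\<lambda>x. (SUP u\<in>{x..}. ereal (f u)) / ereal (f x)) < ereal C"
    using assms ereal_dense2 unfolding almost_decreasing_def by blast
  have "\<forall>\<^sub>F x in at_top. (SUP u\<in>{x..}. ereal (f u)) / ereal (f x) < ereal C"
    by (rule Limsup_lessD[OF C])
  moreover have "\<forall>\<^sub>F x in at_top. f x > 0"
    using assms by (simp add: almost_decreasing_def eventually_positive_def)
  ultimately have "\<forall>\<^sub>F x in at_top. 0 < f x \<and> (\<forall>u\<ge>x. f u \<le> max 1 C * f x)"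
  proof eventually_elim
    case (elim x)
    have "f u \<le> max 1 C * f x" if "x \<le> u" for u
    proof -
      have "ereal (f u) / ereal (f x) \<le> (SUP u\<in>{x..}. ereal (f u)) / ereal (f x)"
        using elim(2) that by (intro ereal_divide_right_mono SUP_upper) auto
      with elim(1) have "ereal (f u) / ereal (f x) < ereal C" by order
      then have "f u / f x < C" using elim(2) by simp
      then have "f u < C * f x" using elim(2) by (simp add: field_simps)
      also have "\<dots> \<le> max 1 C * f x" using elim(2) by (intro mult_right_mono) auto
      finally show ?thesis by simp
    qed
    with elim(2) show ?case by blast
  qed
  then obtain x0 where x0: "\<And>x. x0 \<le> x \<Longrightarrow> 0 < f x \<and> (\<forall>u\<ge>x. f u \<le> max 1 C * f x)"
    by (auto simp: eventually_at_top_linorder)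
  show ?thesis
    by (rule that[of "max 1 C" "max 1 x0"]) (use x0 in auto)
qed

lemma lower_ratio_gtD:
  assumes "ereal a < lower_ratio f y" and "\<forall>\<^sub>F x in at_top. 0 < f x"
  shows "\<forall>\<^sub>F x in at_top. a * f x < f (x * y)"
proof -
  have "\<forall>\<^sub>F x in at_top. ereal a < ereal (f (x * y) / f x)"
    by (rule less_LiminfD) (use assms(1) in \<open>simp add: lower_ratio_def\<close>)
  then show ?thesis using assms(2)
    by eventually_elim (simp add: field_simps)
qed

lemma lower_ratio_geI:
  assumes "\<forall>\<^sub>F x in at_top. a * f x \<le> f (x * y)" and "\<forall>\<^sub>F x in at_top. 0 < f x"
  shows "ereal a \<le> lower_ratio f y"
  unfolding lower_ratio_def
  by (rule Liminf_bounded) (use assms in \<open>eventually_elim, simp add: field_simps\<close>)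

text \<open>Almost decrease bounds \<open>f u\<close> only by values at points left of
  \<open>u\<close>. The point \<open>x / y\<close> lies left of every \<open>u \<ge> c * x\<close>,
  and the positive lower ratio at \<open>y\<close> brings \<open>f (x / y)\<close> back to a
  multiple of \<open>f x\<close>.\<close>

lemma dominated_variation:
  assumes ad: "almost_decreasing f" and lr: "\<And>y. 1 \<le> y \<Longrightarrow> 0 < lower_ratio f y" and "0 < c"
  obtains K where "0 < K" "\<forall>\<^sub>F x in at_top. \<forall>u\<ge>c * x. f u \<le> K * f x"
proof -
  obtain C x0 where C: "1 \<le> C" "0 < x0" and pos: "\<And>x. x0 \<le> x \<Longrightarrow> 0 < f x"
    and dec: "\<And>x u. x0 \<le> x \<Longrightarrow> x \<le> u \<Longrightarrow> f u \<le> C * f x"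
    using almost_decreasingE[OF ad] by blast
  define y where "y = max 1 (1 / c)"
  have y: "1 \<le> y" "1 \<le> c * y" using \<open>0 < c\<close> by (auto simp: y_def max_def field_simps)
  obtain a where a: "0 < a" "ereal a < lower_ratio f y"
    using ereal_dense2[OF lr[OF y(1)]] by auto
  have evp: "\<forall>\<^sub>F x in at_top. 0 < f x"
    using eventually_ge_at_top[of x0] by eventually_elim (rule pos)
  obtain x1 where x1: "\<And>x. x1 \<le> x \<Longrightarrow> a * f x < f (x * y)"
    using lower_ratio_gtD[OF a(2) evp] by (auto simp: eventually_at_top_linorder)
  show ?thesis
  proof (rule that[of "C * C / a"])
    show "0 < C * C / a" using C a by simp
    show "\<forall>\<^sub>F x in at_top. \<forall>u\<ge>c * x. f u \<le> C * C / a * f x"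
      using eventually_ge_at_top[of "max x0 (max x0 x1 * y)"]
    proof eventually_elim
      case (elim x)
      show ?case
      proof (intro allI impI)
        fix u assume u: "c * x \<le> u"
        define w where "w = x / y"
        have "max x0 x1 * y \<le> x" using elim by simp
        then have w: "max x0 x1 \<le> w" using y unfolding w_def by (subst pos_le_divide_eq) auto
        have "w \<le> c * x"
        proof -
          have "x * 1 \<le> x * (c * y)" using y elim C by (intro mult_left_mono) auto
          then show ?thesis using y by (simp add: w_def field_simps)
        qed
        then have "f u \<le> C * f w" using w u by (intro dec) auto
        moreover have "a * f w < f x" using x1[of w] w y by (simp add: w_def)
        then have "f w \<le> f x / a" using a by (simp add: field_simps)
        then have "C * f w \<le> C * (f x / a)" using C by (intro mult_left_mono) auto
        moreover have "C * (f x / a) * 1 \<le> C * (f x / a) * C"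
          using C a pos[of x] elim by (intro mult_left_mono) auto
        ultimately show "f u \<le> C * C / a * f x" by (simp add: mult.commute mult.left_commute)
      qed
    qed
  qed
qed

text \<open>Fekete's lemma for superadditive functions of a real variable. Writing
  \<open>s = k * s0 + q\<close> with \<open>0 \<le> q \<le> s0\<close> leaves a remainder, which the
  local lower bound controls; the upper bound keeps the supremum finite. It serves to show that the
  \<open>Lim\<close> defining the Matuszewska index is an actual limit.\<close>

lemma superadditive_div_tendsto:
  fixes \<phi> :: "real \<Rightarrow> real"
  assumes super: "\<And>s t. 0 \<le> s \<Longrightarrow> 0 \<le> t \<Longrightarrow> \<phi> s + \<phi> t \<le> \<phi> (s + t)"
    and upper: "\<And>s. 0 \<le> s \<Longrightarrow> \<phi> s \<le> C"
    and lower: "\<And>A. \<exists>B. \<forall>s\<in>{0..A}. B \<le> \<phi> s"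
  shows "((\<lambda>s. \<phi> s / s) \<longlongrightarrow> (SUP s\<in>{1..}. \<phi> s / s)) at_top"
proof -
  define \<sigma> where "\<sigma> = (SUP s\<in>{1..}. \<phi> s / s)"
  have bdd: "bdd_above ((\<lambda>s. \<phi> s / s) ` {1..})"
  proof (rule bdd_aboveI2)
    fix s :: real assume "s \<in> {1..}"
    then have "\<phi> s / s \<le> max 0 C / s" using upper[of s] by (intro divide_right_mono) auto
    also have "\<dots> \<le> max 0 C / 1" using \<open>s \<in> {1..}\<close> by (intro divide_left_mono) auto
    finally show "\<phi> s / s \<le> max 0 C" by simp
  qed
  have "\<forall>\<^sub>F s in at_top. \<bar>\<phi> s / s - \<sigma>\<bar> < e" if e: "e > 0" for e
  proof -
    obtain s0 where s0: "1 \<le> s0" "\<sigma> - e / 2 < \<phi> s0 / s0"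
      using less_cSUP_iff[OF _ bdd, of "\<sigma> - e / 2"] e by (auto simp: \<sigma>_def)
    obtain B where B: "\<And>s. s \<in> {0..s0} \<Longrightarrow> B \<le> \<phi> s" using lower[of s0] by blast
    have mult: "real k * \<phi> s0 + \<phi> s \<le> \<phi> (real k * s0 + s)" if "0 \<le> s" for k s
    proof (induction k)
      case (Suc k)
      have "real (Suc k) * \<phi> s0 + \<phi> s \<le> \<phi> s0 + \<phi> (real k * s0 + s)"
        using Suc by (simp add: algebra_simps)
      also have "\<dots> \<le> \<phi> (s0 + (real k * s0 + s))" using s0 that by (intro super) auto
      finally show ?case by (simp add: algebra_simps)
    qed simp
    define a where "a = \<sigma> - e / 2"
    \<comment> \<open>The loss in the linear lower bound: \<open>\<bar>a\<bar> * s0\<close> for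
      replacing \<open>k * s0\<close> by \<open>s\<close>, and \<open>\<bar>B\<bar>\<close> for the
      value at the remainder.\<close>
    define D where "D = \<bar>a\<bar> * s0 + \<bar>B\<bar>"
    have key: "a * s - D \<le> \<phi> s" if s: "0 \<le> s" for s
    proof -
      define k where "k = nat \<lfloor>s / s0\<rfloor>"
      define q where "q = s - real k * s0"
      have "0 \<le> s / s0" using s s0 by simp
      then have "real k \<le> s / s0" "s / s0 < real k + 1" unfolding k_def by linarith+
      then have q: "0 \<le> q" "q \<le> s0" using s0 by (auto simp: q_def field_simps)
      have "a * s0 \<le> \<phi> s0" using s0 by (simp add: a_def field_simps)
      then have "real k * (a * s0) \<le> real k * \<phi> s0" by (intro mult_left_mono) auto
      moreover have "B \<le> \<phi> q" using B q by simp
      moreover have "real k * \<phi> s0 + \<phi> q \<le> \<phi> s" using mult[of q k] q by (simp add: q_def)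
      moreover have "a * q \<le> \<bar>a\<bar> * s0"
        using q by (meson abs_ge_self abs_ge_zero mult_mono order_trans)
      moreover have "real k * (a * s0) = a * s - a * q" by (simp add: q_def algebra_simps)
      ultimately show ?thesis by (simp add: D_def)
    qed
    show ?thesis using eventually_gt_at_top[of "max 1 (2 * D / e)"]
    proof eventually_elim
      case (elim s)
      have "\<phi> s / s \<le> \<sigma>" unfolding \<sigma>_def using elim by (intro cSUP_upper bdd) auto
      moreover have "(a * s - D) / s \<le> \<phi> s / s" using key[of s] elim by (intro divide_right_mono) auto
      then have "a - D / s \<le> \<phi> s / s" using elim by (simp add: diff_divide_distrib)
      moreover have "D / s < e / 2" using elim e by (simp add: field_simps)
      ultimately show ?case using e unfolding a_def by linarith
    qed
  qed
  then show ?thesis unfolding tendsto_iff dist_real_def \<sigma>_def by blast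
qed

lemma lower_ratio_bounded:
  assumes ad: "almost_decreasing f"
  obtains C where "0 < C" "\<And>y. 1 \<le> y \<Longrightarrow> lower_ratio f y \<le> ereal C"
proof -
  obtain C x0 where C: "1 \<le> C" "0 < x0" and pos: "\<And>x. x0 \<le> x \<Longrightarrow> 0 < f x"
    and dec: "\<And>x u. x0 \<le> x \<Longrightarrow> x \<le> u \<Longrightarrow> f u \<le> C * f x"
    using almost_decreasingE[OF ad] by blast
  show ?thesis
  proof (rule that[of C])
    fix y :: real assume y: "1 \<le> y"
    have "lower_ratio f y \<le> Limsup at_top (\<lambda>x. ereal (f (x * y) / f x))"
      unfolding lower_ratio_def by (rule Liminf_le_Limsup) simp
    also have "\<dots> \<le> ereal C"
    proof (rule Limsup_bounded)
      show "\<forall>\<^sub>F x in at_top. ereal (f (x * y) / f x) \<le> ereal C"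
        using eventually_ge_at_top[of x0]
      proof eventually_elim
        case (elim x)
        have "x * 1 \<le> x * y" using elim C y by (intro mult_left_mono) auto
        then show ?case using dec[of x "x * y"] pos[of x] elim by (simp add: field_simps)
      qed
    qed
    finally show "lower_ratio f y \<le> ereal C" .
  qed (use C in simp)
qed

text \<open>\<open>Lim\<close> carries no information where no limit exists, so the hypothesis on
  the index becomes usable only after convergence is proved. In the variable \<open>ln y\<close> the
  logarithm of the lower ratio is superadditive, hence Fekete's lemma applies. Once a single
  \<open>y > 1\<close> has lower ratio above \<open>y powr (- q)\<close>, iteration along a
  geometric sequence and almost decrease give the power bound.\<close>

lemma lower_Matuszewska_index_power_bound:
  assumes ad: "almost_decreasing f" and lr: "\<And>y. 1 \<le> y \<Longrightarrow> 0 < lower_ratio f y"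
    and idx: "\<bar>lower_Matuszewska_index f\<bar> < ereal p"
  obtains q c where "0 < q" "q < p" "0 < c" "\<forall>\<^sub>F x in at_top. c * x powr (-q) \<le> f x"
proof -
  obtain C x0 where C: "1 \<le> C" "0 < x0" and pos: "\<And>x. x0 \<le> x \<Longrightarrow> 0 < f x"
    and dec: "\<And>x u. x0 \<le> x \<Longrightarrow> x \<le> u \<Longrightarrow> f u \<le> C * f x"
    using almost_decreasingE[OF ad] by blast
  obtain C' where C': "0 < C'" "\<And>y. 1 \<le> y \<Longrightarrow> lower_ratio f y \<le> ereal C'"
    using lower_ratio_bounded[OF ad] by blast
  have evp: "\<forall>\<^sub>F x in at_top. 0 < f x"
    using eventually_ge_at_top[of x0] by eventually_elim (rule pos)
  define g where "g y = real_of_ereal (lower_ratio f y)" for y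
  have g: "lower_ratio f y = ereal (g y)" "0 < g y" "g y \<le> C'" if "1 \<le> y" for y
    using lr[OF that] C'(2)[OF that] unfolding g_def by (cases "lower_ratio f y"; simp)+
  \<comment> \<open>A ratio over the factor \<open>y * z\<close> splits into ratios over
    \<open>y\<close> and over \<open>z\<close>, and the lower limit of a product of positive
    quantities is at least the product of the lower limits.\<close>
  have super: "g y * g z \<le> g (y * z)" if "1 \<le> y" "1 \<le> z" for y z
  proof -
    have "a * b \<le> g (y * z)" if a: "0 < a" "a < g y" and b: "0 < b" "b < g z" for a b
    proof -
      have "\<forall>\<^sub>F x in at_top. a * f x < f (x * y)"
        using g[OF \<open>1 \<le> y\<close>] a by (intro lower_ratio_gtD evp) auto
      moreover have "\<forall>\<^sub>F x in at_top. b * f x < f (x * z)"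
        using g[OF \<open>1 \<le> z\<close>] b by (intro lower_ratio_gtD evp) auto
      then have "\<forall>\<^sub>F x in at_top. b * f (x * y) < f (x * y * z)"
        by (rule eventually_compose_filterlim)
           (use that(1) \<open>1 \<le> y\<close> in \<open>auto intro!: filterlim_at_top_mult_tendsto_pos filterlim_ident\<close>)
      ultimately have "\<forall>\<^sub>F x in at_top. (a * b) * f x \<le> f (x * (y * z))"
      proof eventually_elim
        case (elim x)
        have "b * (a * f x) \<le> b * f (x * y)" using elim b by (intro mult_left_mono) auto
        with elim show ?case by (simp add: algebra_simps)
      qed
      from lower_ratio_geI[OF this evp] show ?thesis
        using g[of "y * z"] mult_mono[OF \<open>1 \<le> y\<close> \<open>1 \<le> z\<close>] \<open>1 \<le> y\<close> by simp
    qed note ab = this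
    \<comment> \<open>The bound for strictly smaller factors passes to the limit as these increase
      to \<open>g y\<close> and \<open>g z\<close>.\<close>
    have lim: "((\<lambda>e. (g y * (1 - e)) * (g z * (1 - e))) \<longlongrightarrow> (g y * (1 - 0)) * (g z * (1 - 0))) (at_right (0::real))"
      by (intro tendsto_intros)
    have "\<forall>\<^sub>F e in at_right (0::real). (g y * (1 - e)) * (g z * (1 - e)) \<le> g (y * z)"
      using eventually_at_right_real[of 0 1, OF zero_less_one]
      by (eventually_elim, intro ab) (use g[OF that(1)] g[OF that(2)] in auto)
    from tendsto_upperbound[OF lim this] show ?thesis by simp
  qed
  \<comment> \<open>Up to the factor \<open>C\<close>, the lower ratio at the right end
    \<open>A\<close> bounds all earlier ones from below; this is the local lower bound in Fekete's
    lemma.\<close>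
  have lowb: "g A / C \<le> g y" if "1 \<le> y" "y \<le> A" for y A
  proof -
    have "a \<le> C * g y" if a: "a < g A" for a
    proof -
      have "\<forall>\<^sub>F x in at_top. a * f x < f (x * A)"
        using g[of A] \<open>1 \<le> y\<close> \<open>y \<le> A\<close> a by (intro lower_ratio_gtD evp) auto
      then have "\<forall>\<^sub>F x in at_top. a / C * f x \<le> f (x * y)"
        using eventually_ge_at_top[of x0]
      proof eventually_elim
        case (elim x)
        have "x * 1 \<le> x * y" "x * y \<le> x * A"
          using elim C \<open>1 \<le> y\<close> \<open>y \<le> A\<close> by (intro mult_left_mono; simp)+
        then have "f (x * A) \<le> C * f (x * y)" using elim by (intro dec) auto
        then show ?case using elim C by (simp add: field_simps)
      qed
      from lower_ratio_geI[OF this evp] show ?thesis using C \<open>1 \<le> y\<close> g[of y]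
        by (simp add: field_simps)
    qed
    then have "g A \<le> C * g y" by (rule dense_le)
    then show ?thesis using C by (simp add: field_simps)
  qed
  define \<phi> where "\<phi> s = ln (g (exp s))" for s
  define \<sigma> where "\<sigma> = (SUP s\<in>{1..}. \<phi> s / s)"
  have ge: "0 < g (exp s)" "g (exp s) \<le> C'" if "0 \<le> s" for s using g[of "exp s"] that by auto
  have lim: "((\<lambda>s. \<phi> s / s) \<longlongrightarrow> \<sigma>) at_top"
    unfolding \<sigma>_def
  proof (rule superadditive_div_tendsto)
    fix s t :: real assume st: "0 \<le> s" "0 \<le> t"
    have "\<phi> s + \<phi> t = ln (g (exp s) * g (exp t))"
      using ge[OF st(1)] ge[OF st(2)] by (simp add: \<phi>_def ln_mult)
    also have "\<dots> \<le> ln (g (exp s * exp t))"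
      using super[of "exp s" "exp t"] st ge(1)[OF st(1)] ge(1)[OF st(2)]
      by (intro ln_mono) auto
    finally show "\<phi> s + \<phi> t \<le> \<phi> (s + t)" by (simp add: \<phi>_def exp_add)
  next
    fix s :: real assume "0 \<le> s"
    then show "\<phi> s \<le> ln C'" using ge[of s] C' unfolding \<phi>_def by (intro ln_mono) auto
  next
    fix A :: real
    have "ln (g (exp (max 0 A)) / C) \<le> \<phi> s" if "s \<in> {0..A}" for s
      unfolding \<phi>_def using lowb[of "exp s" "exp (max 0 A)"] that ge(1)[of s] ge(1)[of "max 0 A"] C
      by (intro ln_mono) auto
    then show "\<exists>B. \<forall>s\<in>{0..A}. B \<le> \<phi> s" by blast
  qed
  have "((\<lambda>y. \<phi> (ln y) / ln y) \<longlongrightarrow> \<sigma>) at_top"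
    by (rule filterlim_compose[OF lim ln_at_top])
  then have "((\<lambda>y. ereal (\<phi> (ln y) / ln y)) \<longlongrightarrow> ereal \<sigma>) at_top" by (rule tendsto_ereal)
  moreover have "\<forall>\<^sub>F y in at_top. ereal (\<phi> (ln y) / ln y) = ext_ln (lower_ratio f y) / ereal (ln y)"
    using eventually_gt_at_top[of 1]
  proof eventually_elim
    case (elim y)
    then show ?case using g[of y] by (simp add: ext_ln_def \<phi>_def)
  qed
  ultimately have "((\<lambda>y. ext_ln (lower_ratio f y) / ereal (ln y)) \<longlongrightarrow> ereal \<sigma>) at_top"
    by (rule Lim_transform_eventually)
  then have "lower_Matuszewska_index f = ereal \<sigma>"
    unfolding lower_Matuszewska_index_def by (intro tendsto_Lim) auto
  with idx have \<sigma>p: "\<bar>\<sigma>\<bar> < p" by simp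
  \<comment> \<open>The midpoint leaves room on both sides: \<open>- q < \<sigma>\<close> and
    \<open>q < p\<close>.\<close>
  define q where "q = (\<bar>\<sigma>\<bar> + p) / 2"
  have q: "0 < q" "q < p" "-q < \<sigma>" using \<sigma>p unfolding q_def by (auto simp: abs_real_def field_simps split: if_splits)
  have "\<forall>\<^sub>F s in at_top. -q < \<phi> s / s" using lim q by (auto intro: order_tendstoD)
  then have "\<exists>s>0. -q < \<phi> s / s"
    using eventually_happens[OF eventually_conj[OF _ eventually_gt_at_top[of 0]]] by fastforce
  then obtain s where s: "s > 0" "-q < \<phi> s / s" by blast
  define y where "y = exp s"
  have y: "1 < y" using s by (simp add: y_def)
  have "exp (- q * s) < g y"
  proof -
    have "- q * s < \<phi> s" using s by (simp add: field_simps)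
    then have "exp (- q * s) < exp (\<phi> s)" by simp
    then show ?thesis using ge[of s] s by (simp add: \<phi>_def y_def)
  qed
  then have gy: "y powr (- q) < g y" by (simp add: y_def powr_def)
  have "\<forall>\<^sub>F x in at_top. y powr (- q) * f x < f (x * y)"
    using g[of y] y gy by (intro lower_ratio_gtD evp) auto
  then obtain x1 where x1: "\<And>x. x1 \<le> x \<Longrightarrow> y powr (- q) * f x < f (x * y)"
    by (auto simp: eventually_at_top_linorder)
  define X where "X = max x0 x1"
  have X: "0 < X" "x0 \<le> X" "x1 \<le> X" using C by (auto simp: X_def)
  have iter: "(y ^ k) powr (- q) * f X \<le> f (X * y ^ k)" for k
  proof (induction k)
    case (Suc k)
    have "X * 1 \<le> X * y ^ k" using y X by (intro mult_left_mono one_le_power) auto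
    then have "x1 \<le> X * y ^ k" using X by linarith
    then have "y powr (- q) * f (X * y ^ k) < f (X * y ^ k * y)" by (rule x1)
    moreover have "y powr (- q) * ((y ^ k) powr (- q) * f X) \<le> y powr (- q) * f (X * y ^ k)"
      using Suc by (intro mult_left_mono) auto
    moreover have "(y ^ Suc k) powr (- q) = y powr (- q) * (y ^ k) powr (- q)"
      using y by (simp add: powr_mult)
    moreover have "X * y ^ Suc k = X * y ^ k * y" by simp
    ultimately show ?case by (simp only: mult.assoc)
  qed simp
  show ?thesis
  proof (rule that[of q "(y / X) powr (- q) * f X / C"])
    show "0 < (y / X) powr (- q) * f X / C" using y X C pos[of X] by simp
    show "\<forall>\<^sub>F x in at_top. (y / X) powr (- q) * f X / C * x powr (- q) \<le> f x"
      using eventually_ge_at_top[of X]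
    proof eventually_elim
      case (elim x)
      \<comment> \<open>The least power with \<open>x \<le> X * y ^ k\<close>. It also satisfies
        \<open>X * y ^ k \<le> y * x\<close>, so \<open>f\<close> at this grid point is at least a
        multiple of \<open>x powr (- q)\<close>, and almost decrease transfers this back to
        \<open>x\<close>.\<close>
      define k where "k = nat \<lceil>log y (x / X)\<rceil>"
      have l0: "0 \<le> log y (x / X)" using y X elim by (simp add: zero_le_log_cancel_iff)
      then have k: "log y (x / X) \<le> real k" "real k \<le> log y (x / X) + 1"
        unfolding k_def by linarith+
      have k1: "x / X \<le> y ^ k"
        using k(1) y X elim by (simp add: log_le_iff powr_realpow)
      have k2: "y ^ k \<le> y * (x / X)"
      proof -
        have "y powr real k \<le> y powr (log y (x / X) + 1)" using k(2) y by (intro powr_mono) auto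
        also have "\<dots> = (x / X) * y" using y X elim by (simp add: powr_add)
        finally show ?thesis using y by (simp add: powr_realpow mult.commute)
      qed
      have "f (X * y ^ k) \<le> C * f x" using k1 X elim by (intro dec) (auto simp: field_simps)
      moreover have "(y * (x / X)) powr (- q) * f X \<le> (y ^ k) powr (- q) * f X"
        using k2 y q pos[of X] X elim by (intro mult_right_mono powr_mono2') auto
      ultimately have "(y * (x / X)) powr (- q) * f X \<le> C * f x" using iter[of k] by linarith
      moreover have "(y * (x / X)) powr (- q) = (y / X) powr (- q) * x powr (- q)"
        using y X elim by (simp flip: powr_mult)
      ultimately show ?case using C by (simp add: field_simps)
    qed
  qed (use q in auto)
qed

section \<open>The constants \<open>l_const\<close> and \<open>L_const\<close> as monotone
  limits\<close>

lemma mono_ereal_tendsto_at_right: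
  fixes h :: "real \<Rightarrow> ereal"
  assumes "\<And>x y. 0 < x \<Longrightarrow> x \<le> y \<Longrightarrow> h x \<le> h y"
  shows "(h \<longlongrightarrow> (INF x\<in>{0<..}. h x)) (at_right 0)"
proof (rule order_tendstoI)
  fix a assume "a < (INF x\<in>{0<..}. h x)"
  then have "\<And>x. 0 < x \<Longrightarrow> a < h x" by (auto dest: less_INF_D)
  then show "\<forall>\<^sub>F x in at_right 0. a < h x" using eventually_at_right_less[of "0::real"]
    by (auto elim: eventually_mono)
next
  fix a assume "(INF x\<in>{0<..}. h x) < a"
  then obtain x where x: "0 < x" "h x < a" by (auto simp: INF_less_iff)
  show "\<forall>\<^sub>F x in at_right 0. h x < a"
    using eventually_at_right_real[OF x(1)]
  proof eventually_elim
    case (elim y)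
    then have "h y \<le> h x" by (intro assms) auto
    with x(2) show ?case by order
  qed
qed

lemma antimono_ereal_tendsto_at_right:
  fixes h :: "real \<Rightarrow> ereal"
  assumes "\<And>x y. 0 < x \<Longrightarrow> x \<le> y \<Longrightarrow> h y \<le> h x"
  shows "(h \<longlongrightarrow> (SUP x\<in>{0<..}. h x)) (at_right 0)"
proof (rule order_tendstoI)
  fix a assume "(SUP x\<in>{0<..}. h x) < a"
  then have "\<And>x. 0 < x \<Longrightarrow> h x < a" by (auto dest: SUP_lessD)
  then show "\<forall>\<^sub>F x in at_right 0. h x < a" using eventually_at_right_less[of "0::real"]
    by (auto elim: eventually_mono)
next
  fix a assume "a < (SUP x\<in>{0<..}. h x)"
  then obtain x where x: "0 < x" "a < h x" by (auto simp: less_SUP_iff)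
  show "\<forall>\<^sub>F x in at_right 0. a < h x"
    using eventually_at_right_real[OF x(1)]
  proof eventually_elim
    case (elim y)
    then have "h x \<le> h y" by (intro assms) auto
    with x(2) show ?case by order
  qed
qed

lemma mem_relative_interval_iff:
  fixes x z eps :: real
  shows "z \<in> {(1 - eps) * x..(1 + eps) * x} \<longleftrightarrow> \<bar>z - x\<bar> \<le> eps * x"
  by (auto simp: abs_le_iff algebra_simps)

abbreviation "inf_ratio f eps \<equiv> (\<lambda>x. (INF z\<in>{(1 - eps) * x..(1 + eps) * x}. ereal (f z)) / ereal (f x))"

abbreviation "sup_ratio f eps \<equiv> (\<lambda>x. (SUP z\<in>{(1 - eps) * x..(1 + eps) * x}. ereal (f z)) / ereal (f x))"

text \<open>Widening the interval can only lower its infimum, so the lower limits are antimonotone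
  in \<open>eps\<close> and the \<open>Lim\<close> of the definition is their supremum.
  \<open>L_const\<close> is treated dually.\<close>

lemma l_const_eq_SUP:
  assumes "eventually_positive f"
  shows "l_const f = (SUP eps\<in>{0<..}. Liminf at_top (inf_ratio f eps))"
  unfolding l_const_def
proof (intro tendsto_Lim antimono_ereal_tendsto_at_right)
  fix eps eps' :: real assume eps: "0 < eps" "eps \<le> eps'"
  show "Liminf at_top (inf_ratio f eps')
     \<le> Liminf at_top (inf_ratio f eps)"
  proof (rule Liminf_mono)
    show "\<forall>\<^sub>F x in at_top. inf_ratio f eps' x
      \<le> inf_ratio f eps x"
      using assms[unfolded eventually_positive_def] eventually_gt_at_top[of 0]
    proof eventually_elim
      case (elim x)
      have "eps * x \<le> eps' * x" using elim eps by (intro mult_right_mono) auto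
      then have "{(1 - eps) * x..(1 + eps) * x} \<subseteq> {(1 - eps') * x..(1 + eps') * x}"
        unfolding subset_iff mem_relative_interval_iff by force
      then show ?case using elim by (intro ereal_divide_right_mono INF_superset_mono) auto
    qed
  qed
qed simp

lemma L_const_eq_INF:
  assumes "eventually_positive f"
  shows "L_const f = (INF eps\<in>{0<..}. Limsup at_top (sup_ratio f eps))"
  unfolding L_const_def
proof (intro tendsto_Lim mono_ereal_tendsto_at_right)
  fix eps eps' :: real assume eps: "0 < eps" "eps \<le> eps'"
  show "Limsup at_top (sup_ratio f eps)
     \<le> Limsup at_top (sup_ratio f eps')"
  proof (rule Limsup_mono)
    show "\<forall>\<^sub>F x in at_top. sup_ratio f eps x
      \<le> sup_ratio f eps' x"
      using assms[unfolded eventually_positive_def] eventually_gt_at_top[of 0]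
    proof eventually_elim
      case (elim x)
      have "eps * x \<le> eps' * x" using elim eps by (intro mult_right_mono) auto
      then have "{(1 - eps) * x..(1 + eps) * x} \<subseteq> {(1 - eps') * x..(1 + eps') * x}"
        unfolding subset_iff mem_relative_interval_iff by force
      then show ?case using elim by (intro ereal_divide_right_mono SUP_subset_mono) auto
    qed
  qed
qed simp

lemma less_l_constD:
  assumes ep: "eventually_positive f" and "ereal a < l_const f"
  obtains eps where "0 < eps" "\<forall>\<^sub>F x in at_top. \<forall>z. \<bar>z - x\<bar> \<le> eps * x \<longrightarrow> a * f x \<le> f z"
proof -
  obtain eps where eps: "0 < eps" "ereal a < Liminf at_top (inf_ratio f eps)"
    using assms(2) unfolding l_const_eq_SUP[OF ep] by (auto simp: less_SUP_iff)
  have "\<forall>\<^sub>F x in at_top. \<forall>z. \<bar>z - x\<bar> \<le> eps * x \<longrightarrow> a * f x \<le> f z"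
    using less_LiminfD[OF eps(2)] ep[unfolded eventually_positive_def]
  proof eventually_elim
    case (elim x)
    show ?case
    proof (intro allI impI)
      fix z assume "\<bar>z - x\<bar> \<le> eps * x"
      then have "inf_ratio f eps x \<le> ereal (f z) / ereal (f x)"
        using elim(2) mem_relative_interval_iff[of z eps x]
        by (intro ereal_divide_right_mono INF_lower) auto
      with elim(1) have "ereal a < ereal (f z) / ereal (f x)" by order
      then show "a * f x \<le> f z" using elim(2) by (simp add: field_simps)
    qed
  qed
  with eps(1) that show ?thesis by blast
qed

lemma l_const_geI:
  assumes ep: "eventually_positive f" and "0 < eps"
    and "\<forall>\<^sub>F x in at_top. \<forall>z. \<bar>z - x\<bar> \<le> eps * x \<longrightarrow> a * f x \<le> f z"
  shows "ereal a \<le> l_const f"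
  unfolding l_const_eq_SUP[OF ep]
proof (rule SUP_upper2)
  show "eps \<in> {0<..}" using assms by simp
  show "ereal a \<le> Liminf at_top (inf_ratio f eps)"
  proof (rule Liminf_bounded)
    show "\<forall>\<^sub>F x in at_top. ereal a \<le> inf_ratio f eps x"
      using assms(3) ep[unfolded eventually_positive_def]
    proof eventually_elim
      case (elim x)
      have "ereal (f x) * ereal a \<le> (INF z\<in>{(1 - eps) * x..(1 + eps) * x}. ereal (f z))"
        using elim mem_relative_interval_iff by (auto intro!: INF_greatest simp: mult.commute)
      with elim(2) show ?case by (simp add: ereal_le_divide_pos)
    qed
  qed
qed

lemma l_const_le_1:
  assumes ep: "eventually_positive f"
  shows "l_const f \<le> 1"
  unfolding l_const_eq_SUP[OF ep]
proof (rule SUP_least)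
  fix eps :: real assume "eps \<in> {0<..}"
  have "Liminf at_top (inf_ratio f eps)
     \<le> Limsup at_top (inf_ratio f eps)"
    by (rule Liminf_le_Limsup) simp
  also have "\<dots> \<le> 1"
  proof (rule Limsup_bounded)
    show "\<forall>\<^sub>F x in at_top. inf_ratio f eps x \<le> 1"
      using ep[unfolded eventually_positive_def] eventually_gt_at_top[of 0]
    proof eventually_elim
      case (elim x)
      have "inf_ratio f eps x \<le> ereal (f x) / ereal (f x)"
        using elim \<open>eps \<in> _\<close> mem_relative_interval_iff[of x eps x]
        by (intro ereal_divide_right_mono INF_lower) auto
      with elim show ?case by simp
    qed
  qed
  finally show "Liminf at_top (inf_ratio f eps) \<le> 1" .
qed

lemma L_const_lessD:
  assumes ep: "eventually_positive f" and "L_const f < ereal a"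
  obtains eps where "0 < eps" "\<forall>\<^sub>F x in at_top. \<forall>z. \<bar>z - x\<bar> \<le> eps * x \<longrightarrow> f z \<le> a * f x"
proof -
  obtain eps where eps: "0 < eps" "Limsup at_top (sup_ratio f eps) < ereal a"
    using assms(2) unfolding L_const_eq_INF[OF ep] by (auto simp: INF_less_iff)
  have "\<forall>\<^sub>F x in at_top. \<forall>z. \<bar>z - x\<bar> \<le> eps * x \<longrightarrow> f z \<le> a * f x"
    using Limsup_lessD[OF eps(2)] ep[unfolded eventually_positive_def]
  proof eventually_elim
    case (elim x)
    show ?case
    proof (intro allI impI)
      fix z assume "\<bar>z - x\<bar> \<le> eps * x"
      then have "ereal (f z) / ereal (f x) \<le> sup_ratio f eps x"
        using elim(2) mem_relative_interval_iff[of z eps x]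
        by (intro ereal_divide_right_mono SUP_upper) auto
      with elim(1) have "ereal (f z) / ereal (f x) < ereal a" by order
      then show "f z \<le> a * f x" using elim(2) by (simp add: field_simps)
    qed
  qed
  with eps(1) that show ?thesis by blast
qed

lemma L_const_leI:
  assumes ep: "eventually_positive f" and "0 < eps"
    and "\<forall>\<^sub>F x in at_top. \<forall>z. \<bar>z - x\<bar> \<le> eps * x \<longrightarrow> f z \<le> a * f x"
  shows "L_const f \<le> ereal a"
  unfolding L_const_eq_INF[OF ep]
proof (rule INF_lower2)
  show "eps \<in> {0<..}" using assms by simp
  show "Limsup at_top (sup_ratio f eps) \<le> ereal a"
  proof (rule Limsup_bounded)
    show "\<forall>\<^sub>F x in at_top. sup_ratio f eps x \<le> ereal a"
      using assms(3) ep[unfolded eventually_positive_def]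
    proof eventually_elim
      case (elim x)
      have "(SUP z\<in>{(1 - eps) * x..(1 + eps) * x}. ereal (f z)) \<le> ereal (f x) * ereal a"
        using elim mem_relative_interval_iff by (auto intro!: SUP_least simp: mult.commute)
      with elim(2) show ?case by (simp add: ereal_divide_le_pos)
    qed
  qed
qed

lemma L_const_ge_1:
  assumes ep: "eventually_positive f"
  shows "1 \<le> L_const f"
  unfolding L_const_eq_INF[OF ep]
proof (rule INF_greatest)
  fix eps :: real assume "eps \<in> {0<..}"
  have "1 \<le> Liminf at_top (sup_ratio f eps)"
  proof (rule Liminf_bounded)
    show "\<forall>\<^sub>F x in at_top. 1 \<le> sup_ratio f eps x"
      using ep[unfolded eventually_positive_def] eventually_gt_at_top[of 0]
    proof eventually_elim
      case (elim x)
      have "ereal (f x) / ereal (f x) \<le> sup_ratio f eps x"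
        using elim \<open>eps \<in> _\<close> mem_relative_interval_iff[of x eps x]
        by (intro ereal_divide_right_mono SUP_upper) auto
      with elim show ?case by simp
    qed
  qed
  also have "\<dots> \<le> Limsup at_top (sup_ratio f eps)"
    by (rule Liminf_le_Limsup) simp
  finally show "1 \<le> Limsup at_top (sup_ratio f eps)" .
qed

text \<open>Both follow from dominated variation with factor 1/2: every \<open>z\<close> in
  \<open>[x / 2, 3 * x / 2]\<close> lies to the right of \<open>x / 2\<close>, and conversely
  \<open>x\<close> lies to the right of \<open>z / 2\<close>, so the roles of \<open>x\<close> and
  \<open>z\<close> can be exchanged.\<close>

lemma l_const_pos_L_const_finite:
  assumes ad: "almost_decreasing f" and lr: "\<And>y. 1 \<le> y \<Longrightarrow> 0 < lower_ratio f y"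
  shows "0 < l_const f" "L_const f < \<infinity>"
proof -
  have ep: "eventually_positive f" using ad by (simp add: almost_decreasing_def)
  obtain K where K: "0 < K" "\<forall>\<^sub>F x in at_top. \<forall>u\<ge>1/2 * x. f u \<le> K * f x"
    using dominated_variation[OF ad lr, of "1/2"] by auto
  have "L_const f \<le> ereal K"
  proof (rule L_const_leI[OF ep, of "1/2"])
    show "\<forall>\<^sub>F x in at_top. \<forall>z. \<bar>z - x\<bar> \<le> 1 / 2 * x \<longrightarrow> f z \<le> K * f x"
      using K(2)
    proof eventually_elim
      case (elim x)
      show ?case
      proof (intro allI impI)
        fix z assume "\<bar>z - x\<bar> \<le> 1 / 2 * x"
        then have "1 / 2 * x \<le> z" by arith
        with elim show "f z \<le> K * f x" by blast
      qed
    qed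
  qed simp
  then show "L_const f < \<infinity>" by auto
  obtain x0 where x0: "\<And>x u. x0 \<le> x \<Longrightarrow> 1/2 * x \<le> u \<Longrightarrow> f u \<le> K * f x"
    using K(2) by (auto simp: eventually_at_top_linorder)
  have "ereal (1 / K) \<le> l_const f"
  proof (rule l_const_geI[OF ep, of "1/2"])
    show "\<forall>\<^sub>F x in at_top. \<forall>z. \<bar>z - x\<bar> \<le> 1 / 2 * x \<longrightarrow> 1 / K * f x \<le> f z"
      using eventually_ge_at_top[of "max 0 (2 * x0)"]
    proof eventually_elim
      case (elim x)
      show ?case
      proof (intro allI impI)
        fix z assume z: "\<bar>z - x\<bar> \<le> 1 / 2 * x"
        have "1 / 2 * x \<le> z" "z \<le> 2 * x" using z elim by arith+
        then have "f x \<le> K * f z" using elim by (intro x0) auto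
        then show "1 / K * f x \<le> f z" using K by (simp add: field_simps)
      qed
    qed
  qed simp
  then show "0 < l_const f" using K(1) by (metis ereal_less(2) less_le_trans zero_less_divide_1_iff)
qed

section \<open>Intermediate regular variation\<close>

text \<open>The hypothesis speaks only about factors close to 1. Powers of one such factor
  \<open>w\<close> overshoot \<open>y\<close>, at the price of a power of 1/2, and almost decrease
  leads back from \<open>w ^ k\<close> to \<open>y\<close>.\<close>

lemma intermediate_regularly_varying_lower_ratio_pos:
  assumes ir: "intermediate_regularly_varying f" and ad: "almost_decreasing f" and y: "1 \<le> y"
  shows "0 < lower_ratio f y"
proof -
  obtain C x0 where C: "1 \<le> C" "0 < x0" and pos: "\<And>x. x0 \<le> x \<Longrightarrow> 0 < f x"
    and dec: "\<And>x u. x0 \<le> x \<Longrightarrow> x \<le> u \<Longrightarrow> f u \<le> C * f x"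
    using almost_decreasingE[OF ad] by blast
  have evp: "\<forall>\<^sub>F x in at_top. 0 < f x"
    using eventually_ge_at_top[of x0] by eventually_elim (rule pos)
  have "\<forall>\<^sub>F y in at_right 1. ereal (1/2) < lower_ratio f y"
    using ir unfolding intermediate_regularly_varying_def
    by (intro order_tendstoD(1)[where y=1]) auto
  then obtain w where w: "1 < w" "ereal (1/2) < lower_ratio f w"
    using eventually_happens[OF eventually_conj[OF _ eventually_at_right_less]] by fastforce
  obtain x1 where x1: "\<And>x. x1 \<le> x \<Longrightarrow> 1/2 * f x < f (x * w)"
    using lower_ratio_gtD[OF w(2) evp] by (auto simp: eventually_at_top_linorder)
  obtain k where k: "y < w ^ k" using real_arch_pow[OF w(1)] by blast
  have it: "(1/2) ^ k * f x \<le> f (x * w ^ k)" if "max x0 x1 \<le> x" for x k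
  proof (induction k)
    case (Suc k)
    have "x * 1 \<le> x * w ^ k" using w that C by (intro mult_left_mono one_le_power) auto
    then have "1/2 * f (x * w ^ k) < f (x * w ^ k * w)" using that by (intro x1) auto
    with Suc show ?case by (simp add: algebra_simps)
  qed simp
  have "ereal ((1/2) ^ k / C) \<le> lower_ratio f y"
  proof (rule lower_ratio_geI[OF _ evp])
    show "\<forall>\<^sub>F x in at_top. (1/2) ^ k / C * f x \<le> f (x * y)"
      using eventually_ge_at_top[of "max x0 x1"]
    proof eventually_elim
      case (elim x)
      have "x * 1 \<le> x * y" "x * y \<le> x * w ^ k"
        using elim C y k by (intro mult_left_mono; simp)+
      then have "f (x * w ^ k) \<le> C * f (x * y)" using elim by (intro dec) auto
      then have "(1/2) ^ k * f x \<le> C * f (x * y)" using it[OF elim, of k] by linarith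
      then show ?case using C by (simp add: pos_divide_le_eq mult.commute)
    qed
  qed
  moreover have "0 < (1/2) ^ k / C" using C by simp
  ultimately show ?thesis by (metis ereal_less(2) less_le_trans)
qed

text \<open>Pointwise ratio limits become locally uniform by a Baire category argument: the set where
  the ratio bounds hold from a given threshold on is closed under limits from the right.\<close>

lemma intermediate_regularly_varying_uniform:
  assumes ir: "intermediate_regularly_varying f" and \<rho>: "1 < \<rho>"
    and rc: "\<And>x. continuous (at_right x) f"
  obtains eps where "0 < eps" "\<forall>\<^sub>F x in at_top. \<forall>z. \<bar>z - x\<bar> \<le> eps * x \<longrightarrow> f z \<le> \<rho> * f x"
proof -
  \<comment> \<open>The final comparison passes from \<open>z\<close> to an intermediate point
    \<open>x\<close> and from there to \<open>v\<close>; each half costs one factor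
    \<open>\<theta>\<close>.\<close>
  define \<theta> where "\<theta> = sqrt \<rho>"
  have \<theta>: "1 < \<theta>" "\<theta> * \<theta> = \<rho>" using \<rho> by (auto simp: \<theta>_def)
  have evp: "\<forall>\<^sub>F x in at_top. 0 < f x"
    using ir by (simp add: intermediate_regularly_varying_def eventually_positive_def)
  have "\<forall>\<^sub>F y in at_right 1. ereal (1/\<theta>) < lower_ratio f y"
    using ir \<theta> unfolding intermediate_regularly_varying_def
    by (intro order_tendstoD(1)[where y=1]) auto
  moreover have "\<forall>\<^sub>F y in at_right 1. upper_ratio f y < ereal \<theta>"
    using ir \<theta> unfolding intermediate_regularly_varying_def
    by (intro order_tendstoD(2)[where y=1]) auto
  ultimately have "\<forall>\<^sub>F y in at_right 1. ereal (1/\<theta>) < lower_ratio f y \<and> upper_ratio f y < ereal \<theta>"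
    by (rule eventually_conj)
  then obtain b where b: "1 < b"
    and lu: "\<And>y. 1 < y \<Longrightarrow> y < b \<Longrightarrow> ereal (1/\<theta>) < lower_ratio f y \<and> upper_ratio f y < ereal \<theta>"
    unfolding eventually_at_right_field by blast
  \<comment> \<open>The threshold \<open>n + 1\<close> rather than \<open>n\<close> keeps
    \<open>x\<close> positive throughout.\<close>
  define E where "E n = {y. \<forall>x\<ge>real n + 1. f (x * y) \<le> \<theta> * f x \<and> f x \<le> \<theta> * f (x * y)}" for n
  have cover: "\<exists>n. y \<in> E n" if y: "1 < y" "y < b" for y
  proof -
    have "\<forall>\<^sub>F x in at_top. 1/\<theta> * f x < f (x * y)"
      by (rule lower_ratio_gtD[OF _ evp]) (use lu y in simp)
    moreover have "\<forall>\<^sub>F x in at_top. ereal (f (x * y) / f x) < ereal \<theta>"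
      by (rule Limsup_lessD) (use lu y in \<open>simp add: upper_ratio_def\<close>)
    ultimately have "\<forall>\<^sub>F x in at_top. f (x * y) \<le> \<theta> * f x \<and> f x \<le> \<theta> * f (x * y)"
      using evp by eventually_elim (use \<theta> in \<open>auto simp: field_simps\<close>)
    then obtain x0 where x0: "\<And>x. x0 \<le> x \<Longrightarrow> f (x * y) \<le> \<theta> * f x \<and> f x \<le> \<theta> * f (x * y)"
      by (auto simp: eventually_at_top_linorder)
    obtain n where "x0 \<le> real n" using real_arch_simple by blast
    then show ?thesis using x0 by (intro exI[of _ n]) (auto simp: E_def)
  qed
  \<comment> \<open>Right continuity of \<open>f\<close> permits limits only from the right: as
    \<open>w k\<close> approaches \<open>y\<close> from above and \<open>x > 0\<close>, also
    \<open>x * w k\<close> approaches \<open>x * y\<close> from above.\<close>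
  have right_closed: "y \<in> E n" if y: "1 < y" and ap: "\<And>e. 0 < e \<Longrightarrow> \<exists>w\<in>E n. y < w \<and> w < y + e" for y n
  proof -
    have "f (x * y) \<le> \<theta> * f x \<and> f x \<le> \<theta> * f (x * y)" if x: "real n + 1 \<le> x" for x
    proof -
      obtain w where w: "\<And>k. w k \<in> E n" "\<And>k. y < w k" "\<And>k. w k < y + 1 / real (Suc k)"
        using ap[of "1 / real (Suc k)" for k] by (metis divide_pos_pos of_nat_0_less_iff zero_less_Suc zero_less_one)
      have wl: "w \<longlonglongrightarrow> y"
      proof (rule tendsto_sandwich[OF _ _ tendsto_const])
        show "(\<lambda>k. y + 1 / real (Suc k)) \<longlonglongrightarrow> y"
          using tendsto_add[OF tendsto_const LIMSEQ_Suc[OF lim_1_over_n], of y] by simp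
      qed (use w in \<open>auto intro!: always_eventually less_imp_le\<close>)
      have "filterlim (\<lambda>k. x * w k) (at_right (x * y)) sequentially"
        unfolding filterlim_at using wl w(2) x
        by (auto intro!: tendsto_intros always_eventually)
      then have lim: "(\<lambda>k. f (x * w k)) \<longlonglongrightarrow> f (x * y)"
        using rc[of "x * y"] unfolding continuous_within by (rule filterlim_compose[rotated])
      have "f (x * w k) \<le> \<theta> * f x" "f x \<le> \<theta> * f (x * w k)" for k
        using w(1)[of k] x by (auto simp: E_def)
      then have "f (x * y) \<le> \<theta> * f x" "f x \<le> \<theta> * f (x * y)"
        by (auto intro!: LIMSEQ_le_const2[OF lim] LIMSEQ_le_const[OF tendsto_mult_left[OF lim]])
      then show ?thesis by simp
    qed
    then show ?thesis by (auto simp: E_def)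
  qed
  define a where "a = (1 + b) / 2"
  define S where "S = {(1 + a) / 2..a}"
  have a: "1 < a" "a < b" using b by (auto simp: a_def)
  have Sne: "S \<noteq> {}" using a by (auto simp: S_def)
  have Sb: "1 < y" "y < b" if "y \<in> S" for y using that a b by (auto simp: S_def)
  \<comment> \<open>Relatively open subsets of the compact interval \<open>S\<close>. Their
    intersection is empty because the \<open>E n\<close> cover \<open>S\<close>, so by Baire some
    \<open>G n\<close> is not dense in \<open>S\<close>, and the closure of that \<open>E n\<close>
    contains an interval.\<close>
  define G where "G n = S - closure (E n)" for n
  have "\<exists>n. \<not> S \<subseteq> closure (G n)"
  proof (rule ccontr)
    assume "\<not> ?thesis"
    then have "S \<subseteq> closure (\<Inter> (range G))"
      by (intro Baire) (auto simp: S_def G_def Diff_eq intro!: openin_open_Int)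
    moreover have "\<Inter> (range G) = {}"
    proof -
      have "y \<notin> \<Inter> (range G)" for y
      proof (cases "y \<in> S")
        case True
        then obtain n where "y \<in> E n" using cover Sb by blast
        then have "y \<notin> G n" using closure_subset by (auto simp: G_def)
        then show ?thesis by blast
      qed (auto simp: G_def)
      then show ?thesis by blast
    qed
    ultimately show False using Sne by simp
  qed
  then obtain n s where s: "s \<in> S" "s \<notin> closure (G n)" by blast
  then obtain e where e: "0 < e" "\<And>y. y \<in> G n \<Longrightarrow> e \<le> dist y s"
    unfolding closure_approachable by (meson not_le)
  define c where "c = max (s - e) ((1 + a) / 2)"
  define d where "d = min (s + e) a"
  have "(1 + a) / 2 \<le> c" by (simp add: c_def)
  then have "1 < c" using a by simp
  moreover have "c < d" using s e(1) a by (auto simp: c_def d_def S_def)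
  ultimately have cd: "c < d" "1 < c" by auto
  have cl: "y \<in> closure (E n)" if "c < y" "y < d" for y
  proof (rule ccontr)
    assume "y \<notin> closure (E n)"
    moreover have "y \<in> S" using that by (auto simp: c_def d_def S_def)
    ultimately have "e \<le> dist y s" using e(2) by (simp add: G_def)
    then show False using that by (auto simp: c_def d_def dist_real_def)
  qed
  \<comment> \<open>Every point of the open interval has points of \<open>E n\<close> just to its
    right, found near some \<open>m\<close> slightly further right; \<open>right_closed\<close> then
    removes the closure.\<close>
  have sub: "y \<in> E n" if y: "c < y" "y < d" for y
  proof (rule right_closed)
    show "1 < y" using y cd by simp
    fix e' :: real assume e': "0 < e'"
    define m where "m = (y + min d (y + e')) / 2"
    have m: "y < m" "m < d" "m < y + e'" using y e' by (auto simp: m_def min_def)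
    then have "m \<in> closure (E n)" using y by (intro cl) auto
    moreover have "0 < min (m - y) (y + e' - m)" using m by simp
    ultimately obtain w where w: "w \<in> E n" "dist w m < min (m - y) (y + e' - m)"
      unfolding closure_approachable by blast
    then show "\<exists>w\<in>E n. y < w \<and> w < y + e'"
      by (intro bexI[OF _ w(1)]) (auto simp: dist_real_def abs_less_iff)
  qed
  define r where "r = (c + d) / 2"
  have r: "c < r" "r < d" "1 < r" using cd by (auto simp: r_def)
  \<comment> \<open>With \<open>v = x * r\<close> and \<open>z = x * y\<close>, the condition
    \<open>\<bar>z - v\<bar> \<le> eps * v\<close> reads
    \<open>\<bar>y - r\<bar> \<le> (d - c) / 4\<close>, which keeps \<open>y\<close> in the interval
    with midpoint \<open>r\<close>.\<close>
  define eps where "eps = (d - c) / (4 * r)"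
  have eps: "0 < eps" "eps * r = (d - c) / 4" using r by (auto simp: eps_def)
  show ?thesis
  proof (rule that[OF eps(1)])
    show "\<forall>\<^sub>F x in at_top. \<forall>z. \<bar>z - x\<bar> \<le> eps * x \<longrightarrow> f z \<le> \<rho> * f x"
      using eventually_ge_at_top[of "(real n + 1) * r"]
    proof eventually_elim
      case (elim v)
      show ?case
      proof (intro allI impI)
        fix z assume z: "\<bar>z - v\<bar> \<le> eps * v"
        define x where "x = v / r"
        have x: "real n + 1 \<le> x" "v = x * r" using elim r by (auto simp: x_def field_simps)
        define y where "y = z / x"
        have x0: "0 < x" using x(1) by linarith
        have zy: "z = x * y" using x0 by (simp add: y_def)
        have "x * \<bar>y - r\<bar> = \<bar>z - v\<bar>" using x0 by (simp add: zy x(2) abs_mult flip: right_diff_distrib)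
        also have "\<dots> \<le> x * (eps * r)" using z by (simp add: x(2) mult_ac)
        also have "\<dots> = x * ((d - c) / 4)" by (simp only: eps(2))
        finally have "\<bar>y - r\<bar> \<le> (d - c) / 4" using x0 by simp
        then have yr: "y - r \<le> (d - c) / 4" "- (y - r) \<le> (d - c) / 4" by (simp_all only: abs_le_iff)
        have "c < y" using yr(2) cd unfolding r_def by (simp add: field_simps)
        moreover have "y < d" using yr(1) cd unfolding r_def by (simp add: field_simps)
        ultimately have "y \<in> E n" by (rule sub)
        then have "f z \<le> \<theta> * f x" using x(1) by (auto simp: E_def zy)
        moreover have "f x \<le> \<theta> * f v" using sub[OF r(1,2)] x by (auto simp: E_def)
        then have "\<theta> * f x \<le> \<theta> * (\<theta> * f v)" using \<theta> by (intro mult_left_mono) auto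
        ultimately show "f z \<le> \<rho> * f v" using \<theta>(2) by (simp flip: mult.assoc)
      qed
    qed
  qed
qed

text \<open>The uniform upper estimate settles \<open>L_const\<close>. For \<open>l_const\<close>
  the same estimate is used with \<open>x\<close> and \<open>z\<close> exchanged, so that an upper
  bound of \<open>f x\<close> by \<open>f z\<close> becomes a lower bound for
  \<open>f z\<close>.\<close>

lemma intermediate_regularly_varying_l_const_L_const:
  assumes ir: "intermediate_regularly_varying f" and rc: "\<And>x. continuous (at_right x) f"
  shows "l_const f = 1" "L_const f = 1"
proof -
  have ep: "eventually_positive f" using ir by (simp add: intermediate_regularly_varying_def)
  have le: "L_const f \<le> ereal (1 + e)" if e: "0 < e" for e
  proof -
    obtain eps where "0 < eps" "\<forall>\<^sub>F x in at_top. \<forall>z. \<bar>z - x\<bar> \<le> eps * x \<longrightarrow> f z \<le> (1 + e) * f x"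
      using intermediate_regularly_varying_uniform[OF ir _ rc, of "1 + e"] e by auto
    then show ?thesis by (rule L_const_leI[OF ep])
  qed
  then have "L_const f \<le> 1 + ereal e" if "0 < e" for e
    using le[OF that] by (simp add: one_ereal_def)
  then have "L_const f \<le> 1" by (rule ereal_le_epsilon2[rule_format])
  with L_const_ge_1[OF ep] show "L_const f = 1" by order
  have "ereal (1 - e) \<le> l_const f" if e: "0 < e" for e
  proof -
    obtain eps where eps: "0 < eps" "\<forall>\<^sub>F x in at_top. \<forall>z. \<bar>z - x\<bar> \<le> eps * x \<longrightarrow> f z \<le> (1 + e) * f x"
      using intermediate_regularly_varying_uniform[OF ir _ rc, of "1 + e"] e by auto
    then obtain x0 where x0: "\<And>x z. x0 \<le> x \<Longrightarrow> \<bar>z - x\<bar> \<le> eps * x \<Longrightarrow> f z \<le> (1 + e) * f x"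
      by (auto simp: eventually_at_top_linorder)
    \<comment> \<open>The cap 1/2 gives \<open>x / 2 \<le> z\<close>, hence
      \<open>eps / 2 * x \<le> eps * z\<close>: closeness relative to \<open>x\<close> becomes
      closeness relative to \<open>z\<close>.\<close>
    define \<delta> where "\<delta> = min (1/2) (eps / 2)"
    show ?thesis
    proof (rule l_const_geI[OF ep, of \<delta>])
      show "\<forall>\<^sub>F x in at_top. \<forall>z. \<bar>z - x\<bar> \<le> \<delta> * x \<longrightarrow> (1 - e) * f x \<le> f z"
        using eventually_ge_at_top[of "max 0 (2 * x0)"] ep[unfolded eventually_positive_def]
      proof eventually_elim
        case (elim x)
        show ?case
        proof (intro allI impI)
          fix z assume z: "\<bar>z - x\<bar> \<le> \<delta> * x"
          have "\<delta> * x \<le> 1/2 * x" "\<delta> * x \<le> eps / 2 * x"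
            using elim by (intro mult_right_mono; simp add: \<delta>_def)+
          with z have z2: "x / 2 \<le> z" "\<bar>x - z\<bar> \<le> eps / 2 * x" by linarith+
          have "eps * (x / 2) \<le> eps * z" using z2 eps by (intro mult_left_mono) auto
          with z2 elim have "f x \<le> (1 + e) * f z" by (intro x0) auto
          then have "f x / (1 + e) \<le> f z" using e by (simp add: field_simps)
          moreover have "(1 - e) * f x \<le> f x / (1 + e)"
          proof -
            have "(1 - e) * (1 + e) \<le> 1" by (simp add: algebra_simps)
            then have "(1 - e) * (1 + e) * f x \<le> 1 * f x" using elim by (intro mult_right_mono) auto
            then show ?thesis using e by (simp add: field_simps)
          qed
          ultimately show "(1 - e) * f x \<le> f z" by simp
        qed
      qed
    qed (use eps in \<open>auto simp: \<delta>_def\<close>)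
  qed
  then have "1 \<le> l_const f + ereal e" if "0 < e" for e
    using that by (cases "l_const f") (force simp: one_ereal_def field_simps)+
  then have "1 \<le> l_const f" by (rule ereal_le_epsilon2[rule_format])
  with l_const_le_1[OF ep] show "l_const f = 1" by order
qed

text \<open>The conclusion weakens as the tolerance grows, so small tolerances suffice; the cap 1/4
  lets later estimates absorb terms quadratic in \<open>\<eta>\<close>. Positivity of
  \<open>h\<close> keeps the quotients clear of division by zero.\<close>

lemma uniformly_lesssimI:
  assumes "\<And>\<eta>. 0 < \<eta> \<Longrightarrow> \<eta> < 1/4 \<Longrightarrow>
    \<forall>\<^sub>F t in at_top. \<forall>x\<in>D t. 0 < h t x \<and> g t x \<le> (1 + \<eta>) * h t x"
  shows "uniformly_lesssim D (\<lambda>t x. ereal (g t x)) (\<lambda>t x. ereal (h t x))"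
  unfolding uniformly_lesssim_def
proof (rule ereal_le_epsilon2)
  fix e :: real assume "0 < e"
  define \<eta> where "\<eta> = min e (1/5)"
  have \<eta>: "0 < \<eta>" "\<eta> < 1/4" "\<eta> \<le> e" using \<open>0 < e\<close> by (auto simp: \<eta>_def)
  show "Limsup at_top (\<lambda>t. SUP x\<in>D t. ereal (g t x) / ereal (h t x)) \<le> 1 + ereal e"
  proof (rule Limsup_bounded)
    show "\<forall>\<^sub>F t in at_top. (SUP x\<in>D t. ereal (g t x) / ereal (h t x)) \<le> 1 + ereal e"
      using assms[OF \<eta>(1,2)]
    proof eventually_elim
      case (elim t)
      show ?case
      proof (rule SUP_least)
        fix x assume "x \<in> D t"
        then have h: "0 < h t x" "g t x \<le> (1 + \<eta>) * h t x" using elim by auto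
        have "(1 + \<eta>) * h t x \<le> (1 + e) * h t x" using \<eta> h by (intro mult_right_mono) auto
        with h(2) have "g t x \<le> (1 + e) * h t x" by (rule order_trans)
        then have "g t x / h t x \<le> 1 + e" using h(1) by (simp add: pos_divide_le_eq)
        then show "ereal (g t x) / ereal (h t x) \<le> 1 + ereal e" using h by (simp add: one_ereal_def)
      qed
    qed
  qed
qed

section \<open>Deviations of sums of nonnegative i.i.d. variables\<close>

text \<open>Up to 1 this is the quadratic Taylor bound, weakened through
  \<open>u\<^sup>2 \<le> u powr r\<close>; beyond 1 the last term alone dominates
  \<open>exp u\<close>. The power \<open>r\<close> replaces the square because claims may lack a
  second moment.\<close>

lemma exp_le_powr_bound:
  fixes u r :: real
  assumes "0 \<le> u" "1 < r" "r \<le> 2"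
  shows "exp u \<le> 1 + u + u powr r * exp u"
proof (cases "u \<le> 1")
  case True
  have "exp u \<le> 1 + u + u\<^sup>2" using assms True by (intro exp_bound) auto
  also have "u\<^sup>2 = u powr 2" using assms by simp
  also have "u powr 2 \<le> u powr r" using assms True by (intro powr_mono') auto
  also have "\<dots> \<le> u powr r * exp u"
    using mult_left_mono[of 1 "exp u" "u powr r"] assms by simp
  finally show ?thesis by simp
next
  case False
  then have "1 \<le> u powr r" using assms by (intro ge_one_powr_ge_zero) auto
  then have "1 * exp u \<le> u powr r * exp u" by (intro mult_right_mono) auto
  with assms show ?thesis by linarith
qed

lemma exp_minus_le_powr_bound:
  fixes u r :: real
  assumes "0 \<le> u" "1 < r" "r \<le> 2"
  shows "exp (- u) \<le> 1 - u + u powr r"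
proof (cases "u \<le> 1")
  case True
  \<comment> \<open>The product equals \<open>1 + u ^ 3\<close>.\<close>
  have "1 \<le> (1 - u + u\<^sup>2) * (1 + u)" using assms by (simp add: algebra_simps power2_eq_square)
  also have "\<dots> \<le> (1 - u + u\<^sup>2) * exp u"
    using assms True exp_ge_add_one_self[of u] by (intro mult_left_mono) auto
  finally have "exp (- u) \<le> 1 - u + u\<^sup>2" by (simp add: exp_minus field_simps)
  also have "u\<^sup>2 = u powr 2" using assms by simp
  also have "u powr 2 \<le> u powr r" using assms True by (intro powr_mono') auto
  finally show ?thesis by simp
next
  case False
  have "exp (- u) \<le> 1" using assms by simp
  moreover have "u powr 1 \<le> u powr r" using False assms by (intro powr_mono) auto
  then have "u \<le> u powr r" using assms by simp
  ultimately show ?thesis by linarith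
qed

section \<open>Conditioning on one of two independent random variables\<close>

text \<open>Rectangles determine the law of the pair, so it is a product measure and Tonelli
  applies. The product rule on rectangles is the form of independence available both for disjoint
  families of claims and for the claims against \<open>(N t, Y t)\<close>.\<close>

lemma (in prob_space) indep_rv_nn_integral:
  assumes U[measurable]: "random_variable R U" and W[measurable]: "random_variable Q W"
    and ind: "\<And>A B. A \<in> sets R \<Longrightarrow> B \<in> sets Q \<Longrightarrow>
      prob ((\<lambda>\<omega>. (U \<omega>, W \<omega>)) -` (A \<times> B) \<inter> space M) = prob (U -` A \<inter> space M) * prob (W -` B \<inter> space M)"
    and g[measurable]: "g \<in> borel_measurable (R \<Otimes>\<^sub>M Q)"
  shows "(\<integral>\<^sup>+\<omega>. g (U \<omega>, W \<omega>) \<partial>M) = (\<integral>\<^sup>+\<omega>. \<integral>\<^sup>+\<omega>'. g (U \<omega>', W \<omega>) \<partial>M \<partial>M)"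
proof -
  interpret U: prob_space "distr M R U" by (rule prob_space_distr) simp
  interpret W: prob_space "distr M Q W" by (rule prob_space_distr) simp
  interpret UW: pair_prob_space "distr M R U" "distr M Q W" ..
  have eq: "distr M R U \<Otimes>\<^sub>M distr M Q W = distr M (R \<Otimes>\<^sub>M Q) (\<lambda>x. (U x, W x))"
  proof (rule pair_measure_eqI)
    fix A B assume "A \<in> sets (distr M R U)" "B \<in> sets (distr M Q W)"
    then show "emeasure (distr M R U) A * emeasure (distr M Q W) B =
        emeasure (distr M (R \<Otimes>\<^sub>M Q) (\<lambda>x. (U x, W x))) (A \<times> B)"
      using ind[of A B] by (simp add: emeasure_distr emeasure_eq_measure ennreal_mult')
  qed (auto intro: U.sigma_finite_measure_axioms W.sigma_finite_measure_axioms cong: sets_pair_measure_cong)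
  have g': "g \<in> borel_measurable (distr M R U \<Otimes>\<^sub>M distr M Q W)"
    using g by (simp cong: measurable_cong_sets sets_pair_measure_cong)
  have "(\<integral>\<^sup>+\<omega>. g (U \<omega>, W \<omega>) \<partial>M) = (\<integral>\<^sup>+z. g z \<partial>distr M (R \<Otimes>\<^sub>M Q) (\<lambda>x. (U x, W x)))"
    by (simp add: nn_integral_distr)
  also have "\<dots> = (\<integral>\<^sup>+w. \<integral>\<^sup>+u. g (u, w) \<partial>distr M R U \<partial>distr M Q W)"
    unfolding eq[symmetric] by (rule UW.nn_integral_snd[OF g', symmetric])
  also have "\<dots> = (\<integral>\<^sup>+w. \<integral>\<^sup>+\<omega>'. g (U \<omega>', w) \<partial>M \<partial>distr M Q W)"
    by (intro nn_integral_cong nn_integral_distr) auto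
  also have "\<dots> = (\<integral>\<^sup>+\<omega>. \<integral>\<^sup>+\<omega>'. g (U \<omega>', W \<omega>) \<partial>M \<partial>M)"
    by (subst nn_integral_distr) auto
  finally show ?thesis .
qed

text \<open>Conditioning on \<open>W\<close> becomes integration against an independent second
  sample point \<open>\<omega>'\<close>, so no conditional probabilities enter. Integrability is
  recorded because later comparisons are made under the integral.\<close>

lemma (in prob_space)
  assumes U[measurable]: "random_variable R U" and W[measurable]: "random_variable Q W"
    and ind: "\<And>A B. A \<in> sets R \<Longrightarrow> B \<in> sets Q \<Longrightarrow>
      prob ((\<lambda>\<omega>. (U \<omega>, W \<omega>)) -` (A \<times> B) \<inter> space M) = prob (U -` A \<inter> space M) * prob (W -` B \<inter> space M)"
    and P[measurable]: "Measurable.pred (R \<Otimes>\<^sub>M Q) (\<lambda>z. P (fst z) (snd z))"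
  shows indep_rv_prob_eq_integrable: "integrable M (\<lambda>\<omega>. prob {\<omega>'\<in>space M. P (U \<omega>') (W \<omega>)})"
    and indep_rv_prob_eq:
      "prob {\<omega>\<in>space M. P (U \<omega>) (W \<omega>)} = (\<integral>\<omega>. prob {\<omega>'\<in>space M. P (U \<omega>') (W \<omega>)} \<partial>M)"
proof -
  let ?g = "\<lambda>z. indicator {z\<in>space (R \<Otimes>\<^sub>M Q). P (fst z) (snd z)} z :: ennreal"
  have "{z\<in>space (R \<Otimes>\<^sub>M Q). P (fst z) (snd z)} \<in> sets (R \<Otimes>\<^sub>M Q)" by measurable
  then have g[measurable]: "?g \<in> borel_measurable (R \<Otimes>\<^sub>M Q)" by (rule borel_measurable_indicator)
  have P2: "{\<omega>'\<in>space M. P (U \<omega>') (W \<omega>)} \<in> events" if "\<omega> \<in> space M" for \<omega>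
  proof -
    have "(\<lambda>\<omega>'. (U \<omega>', W \<omega>)) \<in> M \<rightarrow>\<^sub>M R \<Otimes>\<^sub>M Q"
      using measurable_space[OF W that] by measurable
    from measurable_compose[OF this P] show ?thesis by simp
  qed
  have inner: "(\<integral>\<^sup>+\<omega>'. ?g (U \<omega>', W \<omega>) \<partial>M) = ennreal (prob {\<omega>'\<in>space M. P (U \<omega>') (W \<omega>)})"
    if "\<omega> \<in> space M" for \<omega>
  proof -
    have "(\<integral>\<^sup>+\<omega>'. ?g (U \<omega>', W \<omega>) \<partial>M) = (\<integral>\<^sup>+\<omega>'. indicator {\<omega>'\<in>space M. P (U \<omega>') (W \<omega>)} \<omega>' \<partial>M)"
      using measurable_space[OF W that] measurable_space[OF U]
      by (intro nn_integral_cong) (auto simp: indicator_def space_pair_measure)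
    also have "\<dots> = ennreal (prob {\<omega>'\<in>space M. P (U \<omega>') (W \<omega>)})"
      using P2[OF that] by (simp add: emeasure_eq_measure)
    finally show ?thesis .
  qed
  have "(\<lambda>\<omega>. enn2real (\<integral>\<^sup>+\<omega>'. ?g (U \<omega>', W \<omega>) \<partial>M)) \<in> borel_measurable M" by measurable
  also have "?this \<longleftrightarrow> (\<lambda>\<omega>. prob {\<omega>'\<in>space M. P (U \<omega>') (W \<omega>)}) \<in> borel_measurable M"
    by (intro measurable_cong) (simp add: inner)
  finally show int: "integrable M (\<lambda>\<omega>. prob {\<omega>'\<in>space M. P (U \<omega>') (W \<omega>)})"
    by (intro integrable_const_bound[of _ 1]) auto
  have "ennreal (prob {\<omega>\<in>space M. P (U \<omega>) (W \<omega>)}) = (\<integral>\<^sup>+\<omega>. indicator {\<omega>\<in>space M. P (U \<omega>) (W \<omega>)} \<omega> \<partial>M)"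
  proof -
    have "(\<lambda>\<omega>. (U \<omega>, W \<omega>)) \<in> M \<rightarrow>\<^sub>M R \<Otimes>\<^sub>M Q" by measurable
    from measurable_compose[OF this P] show ?thesis by (simp add: emeasure_eq_measure)
  qed
  also have "\<dots> = (\<integral>\<^sup>+\<omega>. ?g (U \<omega>, W \<omega>) \<partial>M)"
    using measurable_space[OF W] measurable_space[OF U]
    by (intro nn_integral_cong) (auto simp: indicator_def space_pair_measure)
  also have "\<dots> = (\<integral>\<^sup>+\<omega>. \<integral>\<^sup>+\<omega>'. ?g (U \<omega>', W \<omega>) \<partial>M \<partial>M)"
    by (rule indep_rv_nn_integral[OF U W ind g])
  also have "\<dots> = (\<integral>\<^sup>+\<omega>. ennreal (prob {\<omega>'\<in>space M. P (U \<omega>') (W \<omega>)}) \<partial>M)"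
    by (intro nn_integral_cong inner)
  also have "\<dots> = ennreal (\<integral>\<omega>. prob {\<omega>'\<in>space M. P (U \<omega>') (W \<omega>)} \<partial>M)"
    by (intro nn_integral_eq_integral int) auto
  finally show "prob {\<omega>\<in>space M. P (U \<omega>) (W \<omega>)} = (\<integral>\<omega>. prob {\<omega>'\<in>space M. P (U \<omega>') (W \<omega>)} \<partial>M)"
    by (subst (asm) ennreal_inj) (auto intro!: integral_nonneg_AE)
qed

section \<open>Exponential bounds and a weak law for the claims\<close>

text \<open>The cap \<open>r \<le> 2\<close> fits the exponential inequalities above; a moment of
  higher order implies one of order 2, so the theorem instantiates the locale with
  \<open>min r 2\<close>.\<close>

locale iid_claims = prob_space M for M :: "'a measure" +
  fixes X :: "nat \<Rightarrow> 'a \<Rightarrow> real" and F :: "real measure" and mu r :: real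
  assumes indep: "indep_vars (\<lambda>_. borel) X {1..}"
    and distr_X: "\<And>k. 1 \<le> k \<Longrightarrow> distr M borel (X k) = F"
    and X_nonneg: "\<And>k. 1 \<le> k \<Longrightarrow> AE \<omega> in M. 0 \<le> X k \<omega>"
    and integrable_F: "integrable F (\<lambda>x. x)"
    and mu_eq: "mu = (\<integral>x. x \<partial>F)"
    and r_gt_1: "1 < r" and r_le_2: "r \<le> 2"
    and integrable_powr: "integrable F (\<lambda>x. \<bar>x\<bar> powr r)"
begin

definition moment :: real where "moment = (\<integral>x. \<bar>x\<bar> powr r \<partial>F)"

abbreviation "csum J \<omega> \<equiv> (\<Sum>i\<in>J. X i \<omega>) - card J * mu"

lemma X_measurable [measurable]: "1 \<le> k \<Longrightarrow> X k \<in> borel_measurable M"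
  using indep by (auto simp: indep_vars_def)

lemma F_nonneg: "AE x in F. 0 \<le> x"
  by (subst distr_X[of 1, symmetric], simp, subst AE_distr_iff) (use X_nonneg[of 1] in auto)

lemma sets_F [measurable_cong, simp]: "sets F = sets borel" and space_F [simp]: "space F = UNIV"
  using distr_X[of 1] by auto

lemma real_distribution_F: "real_distribution F"
  using distr_X[of 1] real_distribution_distr[of "X 1"] by simp

lemma moment_nonneg: "0 \<le> moment" by (simp add: moment_def)

lemma mu_nonneg: "0 \<le> mu"
  unfolding mu_eq using F_nonneg by (rule integral_nonneg_AE)

lemma prob_X_eq: "1 \<le> k \<Longrightarrow> A \<in> sets borel \<Longrightarrow> prob {\<omega>\<in>space M. X k \<omega> \<in> A} = measure F A"
  by (subst distr_X[of k, symmetric]) (auto simp: measure_distr vimage_def Int_def conj_commute)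

lemma prob_X_gt_le:
  assumes "1 \<le> k" "0 < y"
  shows "prob {\<omega>\<in>space M. y < X k \<omega>} \<le> moment / y powr r"
proof -
  interpret F: real_distribution F by (rule real_distribution_F)
  have "measure F {y<..} * y powr r = (\<integral>x. indicator {y<..} x * y powr r \<partial>F)" by simp
  also have "\<dots> \<le> moment" unfolding moment_def
  proof (rule integral_mono)
    show "integrable F (\<lambda>x. indicator {y<..} x * y powr r)"
      by (intro integrable_mult_left F.integrable_const_bound[of _ 1]) auto
    show "indicator {y<..} x * y powr r \<le> \<bar>x\<bar> powr r" for x
      using assms r_gt_1 by (auto simp: indicator_def intro!: powr_mono2)
  qed (rule integrable_powr)
  finally have "measure F {y<..} \<le> moment / y powr r" using assms by (simp add: field_simps)
  then show ?thesis using prob_X_eq[OF assms(1), of "{y<..}"] by simp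
qed

text \<open>Exponential Markov inequality with a general \<open>\<phi>\<close> in place of the
  exponential, so that a truncation can be built into \<open>\<phi>\<close>. Boundedness makes the
  product integrable; it is asked almost everywhere because \<open>exp (- (h * z))\<close> is
  bounded only on the nonnegative half-line.\<close>

lemma chernoff:
  fixes a c B :: real
  assumes J: "finite J" "J \<subseteq> {1..}" and [measurable]: "\<phi> \<in> borel_measurable borel"
    and bd: "AE x in F. 0 \<le> \<phi> x \<and> \<phi> x \<le> B" and le: "(\<integral>x. \<phi> x \<partial>F) \<le> exp a"
    and A: "A \<in> events" "AE \<omega> in M. \<omega> \<in> A \<longrightarrow> exp c \<le> (\<Prod>i\<in>J. \<phi> (X i \<omega>))"
  shows "prob A \<le> exp (card J * a - c)"
proof -
  interpret F: real_distribution F by (rule real_distribution_F)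
  have ipos: "0 \<le> (\<integral>x. \<phi> x \<partial>F)" using bd by (intro integral_nonneg_AE) auto
  have bdX: "AE \<omega> in M. 0 \<le> \<phi> (X i \<omega>) \<and> \<phi> (X i \<omega>) \<le> B" if "i \<in> J" for i
  proof -
    have i: "1 \<le> i" using that J by auto
    then have "AE x in distr M borel (X i). 0 \<le> \<phi> x \<and> \<phi> x \<le> B"
      using bd by (simp only: distr_X)
    then show ?thesis using i by (subst (asm) AE_distr_iff) auto
  qed
  have ind: "indep_vars (\<lambda>_. borel) (\<lambda>i \<omega>. \<phi> (X i \<omega>)) J"
    by (rule indep_vars_compose2[OF indep_vars_subset[OF indep J(2)]]) simp
  have int: "integrable M (\<lambda>\<omega>. \<phi> (X i \<omega>))" if "i \<in> J" for i
    by (rule integrable_const_bound[of _ B]) (use bdX[OF that] that J in auto)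
  have ex: "(\<integral>\<omega>. \<phi> (X i \<omega>) \<partial>M) = (\<integral>x. \<phi> x \<partial>F)" if "i \<in> J" for i
    using that J by (subst distr_X[of i, symmetric]) (auto simp: integral_distr)
  have "prob A * exp c = (\<integral>\<omega>. indicator A \<omega> * exp c \<partial>M)" using A by simp
  also have "\<dots> \<le> (\<integral>\<omega>. (\<Prod>i\<in>J. \<phi> (X i \<omega>)) \<partial>M)"
  proof (rule integral_mono_AE)
    show "integrable M (\<lambda>\<omega>. indicator A \<omega> * exp c)"
      using A by (intro integrable_mult_left integrable_real_indicator) (auto simp: emeasure_eq_measure)
    show "integrable M (\<lambda>\<omega>. \<Prod>i\<in>J. \<phi> (X i \<omega>))" by (rule indep_vars_integrable[OF J(1) ind int])
    have "AE \<omega> in M. \<forall>i\<in>J. 0 \<le> \<phi> (X i \<omega>)" using J(1) bdX by (auto simp: AE_finite_all)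
    then show "AE \<omega> in M. indicator A \<omega> * exp c \<le> (\<Prod>i\<in>J. \<phi> (X i \<omega>))"
      using A(2) by eventually_elim (auto simp: indicator_def intro!: prod_nonneg)
  qed
  also have "\<dots> = (\<integral>x. \<phi> x \<partial>F) ^ card J"
    by (subst indep_vars_lebesgue_integral[OF J(1) ind int]) (auto simp: ex)
  also have "\<dots> \<le> exp a ^ card J" using le ipos by (intro power_mono) auto
  also have "\<dots> = exp (card J * a)" by (simp add: exp_of_nat_mult)
  finally show ?thesis by (simp add: exp_diff field_simps)
qed

lemma sum_measurable [measurable]: "J \<subseteq> {1..} \<Longrightarrow> (\<lambda>\<omega>. \<Sum>i\<in>J. X i \<omega>) \<in> borel_measurable M"
  by (intro borel_measurable_sum) auto

lemma chernoff_upper: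
  assumes J: "finite J" "J \<subseteq> {1..}" and h: "0 < h" "0 < y"
  shows "prob {\<omega>\<in>space M. x < csum J \<omega> \<and> (\<forall>i\<in>J. X i \<omega> \<le> y)}
    \<le> exp (card J * (h powr r * exp (h * y) * moment) - h * x)"
proof -
  interpret F: real_distribution F by (rule real_distribution_F)
  have Xm: "\<And>i. i \<in> J \<Longrightarrow> X i \<in> borel_measurable M" using J by auto
  \<comment> \<open>The indicator makes the product vanish as soon as one claim exceeds
    \<open>y\<close>. The majorant of \<open>\<phi>\<close> keeps the untruncated linear term, which
    integrates to exactly \<open>h * mu\<close>.\<close>
  define \<phi> where "\<phi> z = exp (h * z) * indicator {..y} z" for z :: real
  have [measurable]: "\<phi> \<in> borel_measurable borel" unfolding \<phi>_def by measurable
  have "(\<integral>z. \<phi> z \<partial>F) \<le> (\<integral>z. 1 + h * z + h powr r * exp (h * y) * \<bar>z\<bar> powr r \<partial>F)"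
  proof (rule integral_mono_AE)
    show "integrable F \<phi>"
      by (rule F.integrable_const_bound[of _ "exp (h * y)"])
         (use h in \<open>auto simp: \<phi>_def indicator_def\<close>)
    show "integrable F (\<lambda>z. 1 + h * z + h powr r * exp (h * y) * \<bar>z\<bar> powr r)"
      using integrable_F integrable_powr by simp
    show "AE z in F. \<phi> z \<le> 1 + h * z + h powr r * exp (h * y) * \<bar>z\<bar> powr r"
      using F_nonneg
    proof eventually_elim
      case (elim z)
      have "0 \<le> h powr r * exp (h * y) * \<bar>z\<bar> powr r" by simp
      moreover have "exp (h * z) \<le> 1 + h * z + h powr r * exp (h * y) * \<bar>z\<bar> powr r" if "z \<le> y"
      proof -
        have "exp (h * z) \<le> 1 + h * z + (h * z) powr r * exp (h * z)"
          using elim h r_gt_1 r_le_2 by (intro exp_le_powr_bound) auto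
        also have "(h * z) powr r * exp (h * z) \<le> (h * z) powr r * exp (h * y)"
          using that h by (intro mult_left_mono) auto
        also have "\<dots> = h powr r * exp (h * y) * \<bar>z\<bar> powr r"
          using elim h by (simp add: powr_mult)
        finally show ?thesis by simp
      qed
      moreover have "0 \<le> h * z" using elim h by simp
      ultimately show ?case by (auto simp: \<phi>_def indicator_def)
    qed
  qed
  also have "\<dots> = 1 + h * mu + h powr r * exp (h * y) * moment"
    using integrable_F integrable_powr F.prob_space by (simp add: mu_eq moment_def)
  also have "\<dots> \<le> exp (h * mu + h powr r * exp (h * y) * moment)"
    using exp_ge_add_one_self[of "h * mu + h powr r * exp (h * y) * moment"] by linarith
  finally have le: "(\<integral>z. \<phi> z \<partial>F) \<le> exp (h * mu + h powr r * exp (h * y) * moment)" .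
  have "prob {\<omega>\<in>space M. x < csum J \<omega> \<and> (\<forall>i\<in>J. X i \<omega> \<le> y)}
     \<le> exp (card J * (h * mu + h powr r * exp (h * y) * moment) - h * (x + card J * mu))"
  proof (rule chernoff[OF J _ _ le])
    show "\<phi> \<in> borel_measurable borel" by measurable
    show "AE z in F. 0 \<le> \<phi> z \<and> \<phi> z \<le> exp (h * y)"
      using h by (auto simp: \<phi>_def indicator_def)
    show "{\<omega>\<in>space M. x < csum J \<omega> \<and> (\<forall>i\<in>J. X i \<omega> \<le> y)} \<in> events"
      using J Xm by measurable
    have "exp (h * (x + card J * mu)) \<le> (\<Prod>i\<in>J. \<phi> (X i \<omega>))"
      if "x < csum J \<omega>" "\<forall>i\<in>J. X i \<omega> \<le> y" for \<omega>
    proof -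
      have "(\<Prod>i\<in>J. \<phi> (X i \<omega>)) = (\<Prod>i\<in>J. exp (h * X i \<omega>))"
        by (intro prod.cong) (use that in \<open>auto simp: \<phi>_def\<close>)
      also have "\<dots> = exp (h * (\<Sum>i\<in>J. X i \<omega>))"
        using J by (simp add: exp_sum sum_distrib_left)
      finally show ?thesis using that h by simp
    qed
    then show "AE \<omega> in M. \<omega> \<in> {\<omega>\<in>space M. x < csum J \<omega> \<and> (\<forall>i\<in>J. X i \<omega> \<le> y)}
        \<longrightarrow> exp (h * (x + card J * mu)) \<le> (\<Prod>i\<in>J. \<phi> (X i \<omega>))"
      by (intro always_eventually) auto
  qed
  then show ?thesis by (simp add: algebra_simps)
qed

text \<open>Claims are nonnegative, so \<open>exp (- (h * z))\<close> is at most 1 and large claims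
  do no harm on this side.\<close>

lemma chernoff_lower:
  assumes J: "finite J" "J \<subseteq> {1..}" and h: "0 < h"
  shows "prob {\<omega>\<in>space M. csum J \<omega> < - x}
    \<le> exp (card J * (h powr r * moment) - h * x)"
proof -
  interpret F: real_distribution F by (rule real_distribution_F)
  define \<phi> where "\<phi> z = exp (- (h * z))" for z :: real
  have [measurable]: "\<phi> \<in> borel_measurable borel" unfolding \<phi>_def by measurable
  have bd: "AE z in F. 0 \<le> \<phi> z \<and> \<phi> z \<le> 1"
    using F_nonneg by eventually_elim (use h in \<open>simp add: \<phi>_def\<close>)
  have "(\<integral>z. \<phi> z \<partial>F) \<le> (\<integral>z. 1 - h * z + h powr r * \<bar>z\<bar> powr r \<partial>F)"
  proof (rule integral_mono_AE)
    show "integrable F \<phi>"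
      by (rule F.integrable_const_bound[of _ 1])
         (use bd in \<open>auto simp: \<phi>_def\<close>)
    show "integrable F (\<lambda>z. 1 - h * z + h powr r * \<bar>z\<bar> powr r)"
      using integrable_F integrable_powr by simp
    show "AE z in F. \<phi> z \<le> 1 - h * z + h powr r * \<bar>z\<bar> powr r"
      using F_nonneg
    proof eventually_elim
      case (elim z)
      then show ?case
        using exp_minus_le_powr_bound[of "h * z" r] h r_gt_1 r_le_2 by (simp add: \<phi>_def powr_mult)
    qed
  qed
  also have "\<dots> = 1 - h * mu + h powr r * moment"
    using integrable_F integrable_powr F.prob_space by (simp add: mu_eq moment_def)
  also have "\<dots> \<le> exp (- h * mu + h powr r * moment)"
    using exp_ge_add_one_self[of "- h * mu + h powr r * moment"] by linarith
  finally have le: "(\<integral>z. \<phi> z \<partial>F) \<le> exp (- h * mu + h powr r * moment)" .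
  have "prob {\<omega>\<in>space M. csum J \<omega> < - x}
     \<le> exp (card J * (- h * mu + h powr r * moment) - h * (x - card J * mu))"
  proof (rule chernoff[OF J _ bd le])
    show "\<phi> \<in> borel_measurable borel" by measurable
    show "{\<omega>\<in>space M. csum J \<omega> < - x} \<in> events"
      using J by measurable
    have "exp (h * (x - card J * mu)) \<le> (\<Prod>i\<in>J. \<phi> (X i \<omega>))"
      if "csum J \<omega> < - x" for \<omega>
    proof -
      have "(\<Prod>i\<in>J. \<phi> (X i \<omega>)) = exp (- (h * (\<Sum>i\<in>J. X i \<omega>)))"
        using J by (simp add: \<phi>_def exp_sum sum_distrib_left flip: sum_negf)
      moreover have "h * (\<Sum>i\<in>J. X i \<omega>) \<le> h * (card J * mu - x)"
        using that h by (intro mult_left_mono) auto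
      ultimately show ?thesis by (simp add: algebra_simps)
    qed
    then show "AE \<omega> in M. \<omega> \<in> {\<omega>\<in>space M. csum J \<omega> < - x}
        \<longrightarrow> exp (h * (x - card J * mu)) \<le> (\<Prod>i\<in>J. \<phi> (X i \<omega>))"
      by (intro always_eventually) auto
  qed
  then show ?thesis by (simp add: algebra_simps)
qed

text \<open>With truncation level \<open>y = \<alpha> x\<close>, the choice \<open>exp (h y) = x powr s\<close> with \<open>1 + s < r\<close> keeps the
  moment term bounded, while \<open>exp (- h x) = x powr (- s / \<alpha>)\<close> decays as fast as desired.\<close>

lemma no_big_jump:
  fixes \<gamma> K :: real
  assumes "0 < \<gamma>" "0 < K"
  obtains \<alpha> where "0 < \<alpha>" "\<alpha> < 1"
    "\<forall>\<^sub>F x in at_top. \<forall>J. finite J \<longrightarrow> J \<subseteq> {1..} \<longrightarrow> \<gamma> * card J \<le> x \<longrightarrow>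
       prob {\<omega>\<in>space M. x < csum J \<omega> \<and> (\<forall>i\<in>J. X i \<omega> \<le> \<alpha> * x)} \<le> x powr - K"
proof -
  \<comment> \<open>Half of the excess of \<open>r\<close> over 1: then
    \<open>1 + s - r = - s\<close>, so \<open>x powr (1 - r)\<close> still decays after
    multiplication by \<open>x powr s\<close>.\<close>
  define s where "s = (r - 1) / 2"
  \<comment> \<open>This makes \<open>s / \<alpha> \<ge> K + 1\<close>, one power more than
    required; the spare \<open>ln x > 1\<close> absorbs the moment term, which is below 1.\<close>
  define \<alpha> where "\<alpha> = min (1/2) (s / (K + 1))"
  have s: "0 < s" "1 + s - r = - s" using r_gt_1 by (auto simp: s_def field_simps)
  have \<alpha>: "0 < \<alpha>" "\<alpha> < 1" "\<alpha> \<le> s / (K + 1)" using s assms by (auto simp: \<alpha>_def)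
  have sa: "K + 1 \<le> s / \<alpha>" using \<alpha> assms by (simp add: field_simps)
  have lim: "((\<lambda>x. ln x powr r * x powr - s) \<longlongrightarrow> 0) at_top"
    using s r_gt_1 by real_asymp
  have lim2: "((\<lambda>x. 1 / \<gamma> * (s / \<alpha>) powr r * moment * (ln x powr r * x powr - s)) \<longlongrightarrow> 0) at_top"
    using tendsto_mult[OF tendsto_const lim, of "1 / \<gamma> * (s / \<alpha>) powr r * moment"] by simp
  have "\<forall>\<^sub>F x in at_top. 1 / \<gamma> * (s / \<alpha>) powr r * moment * (ln x powr r * x powr - s) < 1"
    by (rule order_tendstoD(2)[OF lim2]) simp
  moreover have "\<forall>\<^sub>F x in at_top. exp 1 < (x::real)" by (rule eventually_gt_at_top)
  ultimately have "\<forall>\<^sub>F x in at_top. \<forall>J. finite J \<longrightarrow> J \<subseteq> {1..} \<longrightarrow> \<gamma> * card J \<le> x \<longrightarrow>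
       prob {\<omega>\<in>space M. x < csum J \<omega> \<and> (\<forall>i\<in>J. X i \<omega> \<le> \<alpha> * x)} \<le> x powr - K"
  proof eventually_elim
    case (elim x)
    have x: "1 < x" using elim(2) exp_ge_add_one_self[of 1] by linarith
    have lnx: "1 < ln x" using elim(2) x by (metis exp_gt_zero ln_exp ln_less_cancel_iff less_trans)
    define h where "h = s * ln x / (\<alpha> * x)"
    have h: "0 < h" using s x \<alpha> lnx by (simp add: h_def)
    have hy: "exp (h * (\<alpha> * x)) = x powr s" using x \<alpha> by (simp add: h_def powr_def)
    have hpr: "h powr r = (s / \<alpha>) powr r * ln x powr r * x powr - r"
      using s \<alpha> x lnx by (simp add: h_def powr_mult powr_divide powr_minus field_simps)
    have hx: "(K + 1) * ln x \<le> h * x"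
    proof -
      have "(K + 1) * ln x \<le> (s / \<alpha>) * ln x" using sa lnx by (intro mult_right_mono) auto
      then show ?thesis using x by (simp add: h_def field_simps)
    qed
    show ?case
    proof (intro allI impI)
      fix J :: "nat set" assume J: "finite J" "J \<subseteq> {1..}" "\<gamma> * card J \<le> x"
      have "card J * (h powr r * exp (h * (\<alpha> * x)) * moment) \<le> x / \<gamma> * (h powr r * x powr s * moment)"
        using J assms moment_nonneg unfolding hy by (intro mult_right_mono) (auto simp: field_simps)
      also have "\<dots> = x / \<gamma> * ((s / \<alpha>) powr r * ln x powr r * x powr - r * x powr s * moment)"
        by (simp only: hpr)
      also have "x / \<gamma> * ((s / \<alpha>) powr r * ln x powr r * x powr - r * x powr s * moment)
        = 1 / \<gamma> * (s / \<alpha>) powr r * moment * (ln x powr r * (x powr 1 * x powr - r * x powr s))"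
        using x by simp
      also have "x powr 1 * x powr - r * x powr s = x powr - s"
      proof -
        have "x powr 1 * x powr - r * x powr s = x powr (1 + - r + s)" by (simp only: powr_add)
        also have "1 + - r + s = - s" using s by simp
        finally show ?thesis .
      qed
      finally have "card J * (h powr r * exp (h * (\<alpha> * x)) * moment) < 1" using elim(1) by linarith
      then have le: "card J * (h powr r * exp (h * (\<alpha> * x)) * moment) - h * x \<le> - K * ln x"
        using hx lnx by (simp add: algebra_simps)
      have "prob {\<omega>\<in>space M. x < csum J \<omega> \<and> (\<forall>i\<in>J. X i \<omega> \<le> \<alpha> * x)}
        \<le> exp (card J * (h powr r * exp (h * (\<alpha> * x)) * moment) - h * x)"
        by (rule chernoff_upper[OF J(1,2) h]) (use \<alpha> x in simp)
      also have "\<dots> \<le> exp (- K * ln x)" using le by simp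
      also have "\<dots> = x powr - K" using x by (simp add: powr_def)
      finally show "prob {\<omega>\<in>space M. x < csum J \<omega> \<and> (\<forall>i\<in>J. X i \<omega> \<le> \<alpha> * x)} \<le> x powr - K" .
    qed
  qed
  with \<alpha> that show ?thesis by blast
qed

text \<open>Stated for all index sets of sufficient size because it is applied to the claims other
  than a chosen one. In the absence of a variance, upward deviations are split according to whether
  some claim exceeds \<open>\<alpha> * (\<eta> * card J)\<close>.\<close>

lemma weak_law:
  fixes \<eta> :: real
  assumes \<eta>: "0 < \<eta>"
  obtains n0 where "\<And>J. finite J \<Longrightarrow> J \<subseteq> {1..} \<Longrightarrow> n0 \<le> card J \<Longrightarrow>
    prob {\<omega>\<in>space M. \<eta> * card J < \<bar>csum J \<omega>\<bar>} \<le> \<eta>"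
proof -
  obtain \<alpha> where \<alpha>: "0 < \<alpha>" "\<alpha> < 1"
    and ub: "\<forall>\<^sub>F x in at_top. \<forall>J. finite J \<longrightarrow> J \<subseteq> {1..} \<longrightarrow> \<eta> * card J \<le> x \<longrightarrow>
       prob {\<omega>\<in>space M. x < csum J \<omega> \<and> (\<forall>i\<in>J. X i \<omega> \<le> \<alpha> * x)} \<le> x powr - 1"
    using no_big_jump[of \<eta> 1] \<eta> by auto
  \<comment> \<open>Chosen so that \<open>h powr (r - 1) * moment \<le> \<eta> / 2\<close>: in the
    lower exponential bound the moment term then consumes at most half of
    \<open>h * \<eta> * n\<close>. The summand 1 guards against a vanishing moment.\<close>
  define h where "h = (\<eta> / (2 * (moment + 1))) powr (1 / (r - 1))"
  have h: "0 < h" using \<eta> moment_nonneg by (simp add: h_def)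
  have "h powr (r - 1) = \<eta> / (2 * (moment + 1))"
    using \<eta> moment_nonneg r_gt_1 by (simp add: h_def powr_powr)
  moreover have "\<eta> / (2 * (moment + 1)) * moment \<le> \<eta> / (2 * (moment + 1)) * (moment + 1)"
    using \<eta> moment_nonneg by (intro mult_left_mono) auto
  moreover have "\<eta> / (2 * (moment + 1)) * (moment + 1) = \<eta> / 2"
    using moment_nonneg by (simp add: field_simps)
  ultimately have h2: "h powr (r - 1) * moment \<le> \<eta> / 2" by (simp only:)
  have hr: "h powr r * moment \<le> h * (\<eta> / 2)"
  proof -
    have "h powr r = h * h powr (r - 1)" using h by (simp add: powr_mult_base)
    then show ?thesis using h mult_left_mono[OF h2, of h]
      by (simp add: mult.assoc)
  qed
  have lin: "filterlim (\<lambda>n. c * real n) at_top sequentially" if "0 < c" for c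
    using that by (intro filterlim_tendsto_pos_mult_at_top[OF tendsto_const] filterlim_real_sequentially)
  have "(\<lambda>n. (\<eta> * real n) powr - 1) \<longlonglongrightarrow> 0"
    by (rule tendsto_neg_powr[OF _ lin[OF \<eta>]]) simp
  then have "\<forall>\<^sub>F n in sequentially. (\<eta> * real n) powr - 1 < \<eta> / 3"
    using \<eta> by (intro order_tendstoD(2)[where y=0]) auto
  moreover have "(\<lambda>n. exp (- (h * (\<eta> / 2) * real n))) \<longlonglongrightarrow> 0"
    by (rule filterlim_compose[OF exp_at_bot])
       (use lin[of "h * (\<eta> / 2)"] h \<eta> in \<open>simp add: filterlim_uminus_at_top\<close>)
  then have "\<forall>\<^sub>F n in sequentially. exp (- (h * (\<eta> / 2) * real n)) < \<eta> / 3"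
    using \<eta> by (intro order_tendstoD(2)[where y=0]) auto
  moreover have "((\<lambda>n. (\<alpha> * \<eta>) powr - r * real n powr (1 - r) * moment) \<longlonglongrightarrow> (\<alpha> * \<eta>) powr - r * 0 * moment)"
    by (intro tendsto_mult tendsto_const tendsto_neg_powr filterlim_real_sequentially) (use r_gt_1 in simp)
  then have "\<forall>\<^sub>F n in sequentially. (\<alpha> * \<eta>) powr - r * real n powr (1 - r) * moment < \<eta> / 3"
    using \<eta> by (intro order_tendstoD(2)[where y=0]) auto
  ultimately have "\<forall>\<^sub>F n in sequentially. \<forall>J. finite J \<longrightarrow> J \<subseteq> {1..} \<longrightarrow> card J = n \<longrightarrow>
    prob {\<omega>\<in>space M. \<eta> * card J < \<bar>csum J \<omega>\<bar>} \<le> \<eta>"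
    using eventually_compose_filterlim[OF ub lin[OF \<eta>]] eventually_gt_at_top[of 0]
  proof eventually_elim
    case (elim n)
    show ?case
    proof (intro allI impI)
      fix J :: "nat set" assume J: "finite J" "J \<subseteq> {1..}" "card J = n"
      have Xm[measurable]: "\<And>i. i \<in> J \<Longrightarrow> X i \<in> borel_measurable M" using J by auto
      have [measurable]: "(\<lambda>\<omega>. \<Sum>i\<in>J. X i \<omega>) \<in> borel_measurable M" using J by auto
      let ?x = "\<eta> * real n"
      let ?A = "{\<omega>\<in>space M. ?x < csum J \<omega> \<and> (\<forall>i\<in>J. X i \<omega> \<le> \<alpha> * ?x)}"
      let ?B = "{\<omega>\<in>space M. csum J \<omega> < - ?x}"
      let ?C = "\<lambda>i. {\<omega>\<in>space M. \<alpha> * ?x < X i \<omega>}"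
      have m: "?A \<in> events" "?B \<in> events" "\<And>i. i \<in> J \<Longrightarrow> ?C i \<in> events"
        using J by measurable
      have mC: "(\<Union>i\<in>J. ?C i) \<in> events" using m J by auto
      have "prob {\<omega>\<in>space M. \<eta> * card J < \<bar>csum J \<omega>\<bar>}
        \<le> prob (?A \<union> ?B \<union> (\<Union>i\<in>J. ?C i))"
        using m mC by (intro finite_measure_mono) (auto simp: J(3) abs_less_iff not_le)
      also have "\<dots> \<le> prob ?A + prob ?B + prob (\<Union>i\<in>J. ?C i)"
        using measure_Un_le[OF sets.Un[OF m(1,2)] mC] measure_Un_le[OF m(1,2)] by linarith
      also have "prob ?A \<le> \<eta> / 3"
        by (rule order_trans[OF elim(4)[rule_format, OF J(1,2)]]) (use J(3) elim(1) in simp_all)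
      also have "prob ?B \<le> \<eta> / 3"
      proof -
        have "prob ?B \<le> exp (card J * (h powr r * moment) - h * ?x)"
          by (rule chernoff_lower[OF J(1,2) h])
        also have "\<dots> \<le> exp (n * (h * (\<eta> / 2)) - h * ?x)"
          using mult_left_mono[OF hr, of "real n"] J(3)
          by (intro exp_le_cancel_iff[THEN iffD2] diff_right_mono) simp
        also have "\<dots> = exp (- (h * (\<eta> / 2) * real n))" by (simp add: algebra_simps)
        finally show ?thesis using elim(2) by linarith
      qed
      also have "prob (\<Union>i\<in>J. ?C i) \<le> \<eta> / 3"
      proof -
        have "prob (\<Union>i\<in>J. ?C i) \<le> (\<Sum>i\<in>J. prob (?C i))"
          using J m by (intro finite_measure_subadditive_finite) auto
        \<comment> \<open>A union bound over \<open>n\<close> claims, each of order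
          \<open>n powr (- r)\<close>, leaves \<open>n powr (1 - r)\<close>, which vanishes because
          \<open>r > 1\<close>.\<close>
        also have "\<dots> \<le> (\<Sum>i\<in>J. moment / (\<alpha> * ?x) powr r)"
          using J \<alpha> \<eta> elim(5) by (intro sum_mono prob_X_gt_le) auto
        also have "\<dots> = (\<alpha> * \<eta>) powr - r * real n powr (1 - r) * moment"
        proof -
          have "(\<alpha> * ?x) powr r = (\<alpha> * \<eta>) powr r * real n powr r"
            using \<alpha> \<eta> by (simp add: powr_mult)
          moreover have "real n powr (1 - r) = real n / real n powr r"
            using elim(5) by (simp add: powr_diff)
          ultimately show ?thesis using J by (simp add: powr_minus_divide)
        qed
        finally show ?thesis using elim(3) by linarith
      qed
      finally show "prob {\<omega>\<in>space M. \<eta> * card J < \<bar>csum J \<omega>\<bar>} \<le> \<eta>"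
        by simp
    qed
  qed
  then obtain n0 where "\<And>n J. n0 \<le> n \<Longrightarrow> finite J \<Longrightarrow> J \<subseteq> {1..} \<Longrightarrow> card J = n \<Longrightarrow>
    prob {\<omega>\<in>space M. \<eta> * card J < \<bar>csum J \<omega>\<bar>} \<le> \<eta>"
    unfolding eventually_sequentially by blast
  then show ?thesis using that by blast
qed

end

section \<open>Local probabilities of i.i.d. sums\<close>

lemma mem_translate_Delta_iff: "z \<in> (+) x ` Delta T \<longleftrightarrow> z - x \<in> Delta T"
  by (force simp: image_iff)

lemma Delta_borel [measurable]: "Delta T \<in> sets borel"
  by (simp add: Delta_def)

lemma Delta_pos: "z \<in> Delta T \<Longrightarrow> 0 < z"
  by (auto simp: Delta_def split: if_splits)

lemma F_Delta_eq: "F_Delta F T x = measure F {u. u - x \<in> Delta T}"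
proof -
  have "(+) x ` Delta T = {u. u - x \<in> Delta T}" using mem_translate_Delta_iff by blast
  then show ?thesis by (simp only: F_Delta_def)
qed

lemma F_Delta_nonneg: "0 \<le> F_Delta F T x"
  by (simp add: F_Delta_def)

text \<open>The window is open on the left and closed on the right, so \<open>f\<close> is a
  difference of right-continuous functions. The category argument for intermediate regular variation
  relies on this regularity.\<close>

lemma F_Delta_right_continuous:
  assumes "real_distribution F" and "0 < T"
  shows "continuous (at_right x) (F_Delta F T)"
proof -
  interpret F: real_distribution F by fact
  show ?thesis
  proof (cases "T = \<infinity>")
    case True
    have "F_Delta F T = (\<lambda>x. 1 - cdf F x)"
    proof
      fix x
      have "F_Delta F T x = measure F (UNIV - {..x})"
        using True by (auto simp: F_Delta_eq Delta_def intro!: arg_cong[where f="measure F"])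
      also have "\<dots> = 1 - cdf F x"
        using F.prob_compl[of "{..x}"] by (simp add: cdf_def)
      finally show "F_Delta F T x = 1 - cdf F x" .
    qed
    then show ?thesis by (simp add: continuous_intros F.cdf_is_right_cont)
  next
    case False
    then obtain c where c: "T = ereal c" "0 < c" using assms(2) by (cases T) auto
    have "F_Delta F T = (\<lambda>x. cdf F (x + c) - cdf F x)"
    proof
      fix x
      have "F_Delta F T x = measure F {x<..x + c}"
        using c by (auto simp: F_Delta_eq Delta_def algebra_simps intro!: arg_cong[where f="measure F"])
      also have "\<dots> = cdf F (x + c) - cdf F x"
        using c by (intro F.cdf_diff_eq[symmetric]) simp
      finally show "F_Delta F T x = cdf F (x + c) - cdf F x" .
    qed
    moreover have "((\<lambda>x. cdf F (x + c)) \<longlongrightarrow> cdf F (x + c)) (at_right x)"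
    proof (rule filterlim_compose[of "cdf F"])
      show "(cdf F \<longlongrightarrow> cdf F (x + c)) (at_right (x + c))"
        using F.cdf_is_right_cont by (simp add: continuous_within)
      show "filterlim (\<lambda>x. x + c) (at_right (x + c)) (at_right x)"
        unfolding filterlim_at
        by (auto intro!: tendsto_intros eventually_mono[OF eventually_at_right_less])
    qed
    ultimately show ?thesis
      using F.cdf_is_right_cont[of x] by (simp add: continuous_within tendsto_diff)
  qed
qed

section \<open>One big claim: probabilities that a sum hits a window\<close>

locale local_claims = iid_claims +
  fixes T :: ereal and q :: real and c0 :: real
  assumes T_pos: "0 < T"
    and ad: "almost_decreasing (F_Delta F T)"
    and lr: "\<And>y. 1 \<le> y \<Longrightarrow> 0 < lower_ratio (F_Delta F T) y"
    and q_pos: "0 < q" and c0_pos: "0 < c0"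
    and power_bound: "\<forall>\<^sub>F x in at_top. c0 * x powr (- q) \<le> F_Delta F T x"
begin

sublocale F: real_distribution F by (rule real_distribution_F)

abbreviation "f \<equiv> F_Delta F T"

definition local_prob :: "nat set \<Rightarrow> real \<Rightarrow> real" where
  "local_prob J x = prob {\<omega>\<in>space M. csum J \<omega> - x \<in> Delta T}"

lemma f_pos: "\<forall>\<^sub>F x in at_top. 0 < f x"
  using ad by (simp add: almost_decreasing_def eventually_positive_def)

text \<open>Uniformity in \<open>v\<close> is the point: it covers every configuration of the
  remaining claims. A window starting above \<open>y / 2\<close> is controlled by dominated
  variation. A finite window starting below it misses \<open>{y<..}\<close> once
  \<open>y \<ge> 2 * T\<close>, and an infinite one meets it in \<open>{y<..}\<close> itself, of
  mass \<open>f y\<close>.\<close>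

lemma single_jump_le:
  obtains C where "0 < C"
    "\<forall>\<^sub>F y in at_top. \<forall>v. measure F {u. u - v \<in> Delta T \<and> y < u} \<le> C * f y"
proof -
  obtain K where K: "0 < K" "\<forall>\<^sub>F x in at_top. \<forall>u\<ge>1/2 * x. f u \<le> K * f x"
    using dominated_variation[OF ad lr, of "1/2"] by auto
  have "\<forall>\<^sub>F y in at_top. \<forall>v. measure F {u. u - v \<in> Delta T \<and> y < u} \<le> max 1 K * f y"
    \<comment> \<open>For \<open>T = \<infinity>\<close> the value \<open>real_of_ereal T\<close> is
      0, so the threshold reads \<open>0 \<le> y\<close>.\<close>
    using K(2) eventually_ge_at_top[of "2 * real_of_ereal T"]
  proof eventually_elim
    case (elim y)
    show ?case
    proof
      fix v
      show "measure F {u. u - v \<in> Delta T \<and> y < u} \<le> max 1 K * f y"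
      proof (cases "1/2 * y \<le> v")
        case True
        have "measure F {u. u - v \<in> Delta T \<and> y < u} \<le> f v"
          unfolding F_Delta_eq by (intro F.finite_measure_mono) auto
        also have "\<dots> \<le> K * f y" using elim(1) True by blast
        also have "\<dots> \<le> max 1 K * f y" by (intro mult_right_mono F_Delta_nonneg) auto
        finally show ?thesis .
      next
        case False
        show ?thesis
        proof (cases "T = \<infinity>")
          case True
          have "measure F {u. u - v \<in> Delta T \<and> y < u} \<le> 1 * f y"
            unfolding F_Delta_eq using True by (simp, intro F.finite_measure_mono) (auto simp: Delta_def)
          also have "\<dots> \<le> max 1 K * f y" by (intro mult_right_mono F_Delta_nonneg) auto
          finally show ?thesis .
        next
          case fin: False
          have "{u. u - v \<in> Delta T \<and> y < u} = {}"
            using fin False elim(2) by (auto simp: Delta_def)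
          then have "measure F {u. u - v \<in> Delta T \<and> y < u} = 0" by (simp only: measure_empty)
          moreover have "0 \<le> max 1 K * f y" by (simp add: F_Delta_nonneg)
          ultimately show ?thesis by linarith
        qed
      qed
    qed
  qed
  then show ?thesis by (intro that[of "max 1 K"]) auto
qed

text \<open>Given all claims but \<open>j\<close>, the claim \<open>X j\<close> has to fall into a
  window starting at \<open>v\<close>. The probability thus separates into a bound for one claim and
  the probability of the condition \<open>P\<close> on the others, while \<open>V\<close> restricts
  claim \<open>j\<close> itself.\<close>

lemma jump_prob:
  fixes x K :: real
  assumes J: "finite J" "J \<subseteq> {1..}" "j \<in> J" and V[measurable]: "V \<in> sets borel"
    and P[measurable]: "Measurable.pred (PiM (J - {j}) (\<lambda>_. borel)) P"
  defines "W \<equiv> \<lambda>\<omega>. restrict (\<lambda>i. X i \<omega>) (J - {j})"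
  defines "E \<equiv> {\<omega>\<in>space M. (csum J \<omega> - x \<in> Delta T \<and> X j \<omega> \<in> V) \<and> P (W \<omega>)}"
  defines "v \<equiv> \<lambda>w. x + card J * mu - (\<Sum>i\<in>J - {j}. w i)"
  shows jump_prob_le: "0 \<le> K \<Longrightarrow> (\<And>w. P w \<Longrightarrow> measure F {u. u - v w \<in> Delta T \<and> u \<in> V} \<le> K) \<Longrightarrow>
      prob E \<le> K * prob {\<omega>\<in>space M. P (W \<omega>)}"
    and jump_prob_ge: "(\<And>w. P w \<Longrightarrow> K \<le> measure F {u. u - v w \<in> Delta T \<and> u \<in> V}) \<Longrightarrow>
      K * prob {\<omega>\<in>space M. P (W \<omega>)} \<le> prob E"
proof -
  let ?Q = "PiM (J - {j}) (\<lambda>_. borel) :: (nat \<Rightarrow> real) measure"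
  have j: "1 \<le> j" using J by auto
  \<comment> \<open>\<open>indep_var_restrict\<close> speaks of restricted families, so claim
    \<open>j\<close> appears as a family with one index.\<close>
  let ?R = "PiM {j} (\<lambda>_. borel) :: (nat \<Rightarrow> real) measure"
  let ?U = "\<lambda>\<omega>. restrict (\<lambda>i. X i \<omega>) {j}"
  have ind: "indep_var ?R ?U ?Q W"
    unfolding W_def using J by (intro indep_var_restrict[OF indep]) auto
  note [measurable] = indep_var_rv1[OF ind] indep_var_rv2[OF ind]
  have v[measurable]: "v \<in> borel_measurable ?Q" unfolding v_def by measurable
  let ?D = "\<lambda>u w. (u - v w \<in> Delta T \<and> u \<in> V) \<and> P w"
  have D: "Measurable.pred (?R \<Otimes>\<^sub>M ?Q) (\<lambda>z. ?D (fst z j) (snd z))"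
    by measurable
  have eq: "prob {\<omega>\<in>space M. ?D (?U \<omega> j) (W \<omega>)} =
      (\<integral>\<omega>. prob {\<omega>'\<in>space M. ?D (?U \<omega>' j) (W \<omega>)} \<partial>M)"
    by (rule indep_rv_prob_eq[OF indep_var_rv1[OF ind] indep_var_rv2[OF ind] indep_varD[OF ind] D])
  have int: "integrable M (\<lambda>\<omega>. prob {\<omega>'\<in>space M. ?D (?U \<omega>' j) (W \<omega>)})"
    by (rule indep_rv_prob_eq_integrable[OF indep_var_rv1[OF ind] indep_var_rv2[OF ind] indep_varD[OF ind] D])
  have Fslice: "prob {\<omega>'\<in>space M. ?D (?U \<omega>' j) w} = measure F {u. ?D u w}" for w
  proof -
    have "prob {\<omega>'\<in>space M. X j \<omega>' \<in> {u. ?D u w}} = measure F {u. ?D u w}"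
      by (rule prob_X_eq[OF j]) measurable
    then show ?thesis by simp
  qed
  have sumJ: "(\<Sum>i\<in>J. X i \<omega>) = X j \<omega> + (\<Sum>i\<in>J - {j}. W \<omega> i)" for \<omega>
    using J by (simp add: sum.remove[of J j] W_def)
  have E: "E = {\<omega>\<in>space M. (X j \<omega> - v (W \<omega>) \<in> Delta T \<and> X j \<omega> \<in> V) \<and> P (W \<omega>)}"
    unfolding E_def v_def sumJ by (simp add: algebra_simps)
  have prob_E: "prob E = (\<integral>\<omega>. measure F {u. (u - v (W \<omega>) \<in> Delta T \<and> u \<in> V) \<and> P (W \<omega>)} \<partial>M)"
  proof -
    have "prob E = prob {\<omega>\<in>space M. ?D (?U \<omega> j) (W \<omega>)}" unfolding E by simp
    also note eq
    finally show ?thesis by (simp only: Fslice)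
  qed
  have int': "integrable M (\<lambda>\<omega>. measure F {u. (u - v (W \<omega>) \<in> Delta T \<and> u \<in> V) \<and> P (W \<omega>)})"
    using int unfolding Fslice .
  have S[measurable]: "{\<omega>\<in>space M. P (W \<omega>)} \<in> events" by measurable
  have KS: "K * prob {\<omega>\<in>space M. P (W \<omega>)} = (\<integral>\<omega>. K * indicator {\<omega>\<in>space M. P (W \<omega>)} \<omega> \<partial>M)" for K :: real
    using S by simp
  have intK: "integrable M (\<lambda>\<omega>. K * indicator {\<omega>\<in>space M. P (W \<omega>)} \<omega>)" for K :: real
    using S by (intro integrable_mult_right integrable_real_indicator) (auto simp: emeasure_eq_measure)
  show "prob E \<le> K * prob {\<omega>\<in>space M. P (W \<omega>)}"
    if "0 \<le> K" "\<And>w. P w \<Longrightarrow> measure F {u. u - v w \<in> Delta T \<and> u \<in> V} \<le> K"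
    unfolding prob_E KS using that by (intro integral_mono int' intK) (auto simp: indicator_def)
  show "K * prob {\<omega>\<in>space M. P (W \<omega>)} \<le> prob E"
    if "\<And>w. P w \<Longrightarrow> K \<le> measure F {u. u - v w \<in> Delta T \<and> u \<in> V}"
    unfolding prob_E KS using that by (intro integral_mono int' intK) (auto simp: indicator_def)
qed

lemma local_prob_split:
  assumes J: "finite J" "J \<subseteq> {1..}"
  shows "local_prob J x \<le> prob {\<omega>\<in>space M. x < csum J \<omega> \<and> (\<forall>i\<in>J. X i \<omega> \<le> y)}
    + (\<Sum>j\<in>J. prob {\<omega>\<in>space M. csum J \<omega> - x \<in> Delta T \<and> X j \<omega> \<in> {y<..}})"
proof -
  have [measurable]: "\<And>i. i \<in> J \<Longrightarrow> X i \<in> borel_measurable M" "(\<lambda>\<omega>. \<Sum>i\<in>J. X i \<omega>) \<in> borel_measurable M"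
    using J by auto
  let ?A = "{\<omega>\<in>space M. x < csum J \<omega> \<and> (\<forall>i\<in>J. X i \<omega> \<le> y)}"
  let ?B = "\<lambda>j. {\<omega>\<in>space M. csum J \<omega> - x \<in> Delta T \<and> X j \<omega> \<in> {y<..}}"
  have m: "?A \<in> events" "\<And>j. j \<in> J \<Longrightarrow> ?B j \<in> events" using J by measurable
  then have mU: "(\<Union>j\<in>J. ?B j) \<in> events" using J by auto
  have "local_prob J x \<le> prob (?A \<union> (\<Union>j\<in>J. ?B j))"
    unfolding local_prob_def
  proof (intro finite_measure_mono subsetI)
    fix \<omega> assume "\<omega> \<in> {\<omega>\<in>space M. csum J \<omega> - x \<in> Delta T}"
    then show "\<omega> \<in> ?A \<union> (\<Union>j\<in>J. ?B j)"
      using Delta_pos[of "csum J \<omega> - x" T] by (cases "\<forall>i\<in>J. X i \<omega> \<le> y") (auto simp: not_le)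
  qed (use m mU in auto)
  also have "\<dots> \<le> prob ?A + prob (\<Union>j\<in>J. ?B j)" using m mU by (intro measure_Un_le)
  also have "prob (\<Union>j\<in>J. ?B j) \<le> (\<Sum>j\<in>J. prob (?B j))"
    using J m by (intro finite_measure_subadditive_finite) auto
  finally show ?thesis by simp
qed

text \<open>A bound of the right order for every number of claims with
  \<open>\<gamma> * card J \<le> x\<close>, few claims included; the sharp bounds below ask for
  many. Absence of a claim above \<open>\<alpha> * x\<close> costs at most
  \<open>x powr (- q)\<close>, hence at most \<open>f x / c0\<close>.\<close>

lemma local_prob_upper:
  fixes \<gamma> :: real
  assumes \<gamma>: "0 < \<gamma>"
  obtains C :: real where "0 < C" "\<forall>\<^sub>F x in at_top. \<forall>J. finite J \<longrightarrow> J \<subseteq> {1..} \<longrightarrow> \<gamma> * card J \<le> x \<longrightarrow>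
    local_prob J x \<le> C * card J * f x"
proof -
  obtain \<alpha> where \<alpha>: "0 < \<alpha>" "\<alpha> < 1" and nbj: "\<forall>\<^sub>F x in at_top. \<forall>J. finite J \<longrightarrow> J \<subseteq> {1..} \<longrightarrow> \<gamma> * card J \<le> x \<longrightarrow>
       prob {\<omega>\<in>space M. x < csum J \<omega> \<and> (\<forall>i\<in>J. X i \<omega> \<le> \<alpha> * x)} \<le> x powr - q"
    using no_big_jump[OF \<gamma> q_pos] by blast
  obtain C where C: "0 < C" and jump: "\<forall>\<^sub>F y in at_top. \<forall>v. measure F {u. u - v \<in> Delta T \<and> y < u} \<le> C * f y"
    using single_jump_le by blast
  obtain K where K: "0 < K" "\<forall>\<^sub>F x in at_top. \<forall>u\<ge>\<alpha> * x. f u \<le> K * f x"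
    using dominated_variation[OF ad lr \<alpha>(1)] by blast
  have l\<alpha>: "filterlim (\<lambda>x. \<alpha> * x) at_top at_top"
    using \<alpha> by (intro filterlim_tendsto_pos_mult_at_top[OF tendsto_const] filterlim_ident)
  have "\<forall>\<^sub>F x in at_top. \<forall>J. finite J \<longrightarrow> J \<subseteq> {1..} \<longrightarrow> \<gamma> * card J \<le> x \<longrightarrow>
    local_prob J x \<le> (1 / c0 + C * K) * card J * f x"
    using nbj eventually_compose_filterlim[OF jump l\<alpha>] K(2) power_bound eventually_gt_at_top[of 0]
  proof eventually_elim
    case (elim x)
    show ?case
    proof (intro allI impI)
      fix J :: "nat set" assume J: "finite J" "J \<subseteq> {1..}" "\<gamma> * card J \<le> x"
      show "local_prob J x \<le> (1 / c0 + C * K) * card J * f x"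
      proof (cases "J = {}")
        case True
        \<comment> \<open>The empty sum is separate: the claimed bound is 0 here and could not
          absorb \<open>x powr (- q)\<close>.\<close>
        have "- x \<notin> Delta T" using elim(5) by (auto dest: Delta_pos)
        then show ?thesis using True by (simp add: local_prob_def)
      next
        case False
        then have n1: "1 \<le> card J" using J by (simp add: Suc_le_eq card_gt_0_iff)
        have "prob {\<omega>\<in>space M. csum J \<omega> - x \<in> Delta T \<and> X j \<omega> \<in> {\<alpha> * x<..}} \<le> C * K * f x"
          if j: "j \<in> J" for j
        proof -
          have "prob {\<omega>\<in>space M. (csum J \<omega> - x \<in> Delta T \<and> X j \<omega> \<in> {\<alpha> * x<..}) \<and> True}
             \<le> (C * f (\<alpha> * x)) * prob {\<omega>\<in>space M. True}"
            using elim(2) C by (intro jump_prob_le[OF J(1,2) j, where P="\<lambda>_. True"]) (auto simp: F_Delta_nonneg)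
          also have "\<dots> = C * f (\<alpha> * x)" by (simp add: prob_space)
          also have "\<dots> \<le> C * (K * f x)" using elim(3) C by (intro mult_left_mono) auto
          finally show ?thesis by (simp add: mult.assoc)
        qed
        then have "(\<Sum>j\<in>J. prob {\<omega>\<in>space M. csum J \<omega> - x \<in> Delta T \<and> X j \<omega> \<in> {\<alpha> * x<..}})
          \<le> card J * (C * K * f x)"
          by (rule sum_bounded_above)
        moreover have "x powr - q \<le> f x / c0" using elim(4) c0_pos by (simp add: field_simps)
        moreover have "1 * (f x / c0) \<le> card J * (f x / c0)"
          using n1 c0_pos F_Delta_nonneg[of F T x] by (intro mult_right_mono) auto
        ultimately show ?thesis
          using local_prob_split[OF J(1,2), of x "\<alpha> * x"] elim(1)[rule_format, OF J]
          by (simp only: distrib_right distrib_left mult_1 mult_1_left times_divide_eq_left times_divide_eq_right mult_ac)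
      qed
    qed
  qed
  then show ?thesis using C K c0_pos by (intro that[of "1 / c0 + C * K"]) (auto simp: add_pos_pos)
qed

text \<open>With \<open>n = card J\<close>, the window for claim \<open>j\<close> starts at
  \<open>x + mu\<close> minus the centered sum of the other claims. Each of the two corrections is
  at most \<open>eps * \<gamma> / 2 * n\<close>, and \<open>\<gamma> * n \<le> x\<close>.\<close>

lemma leave_one_out_near:
  fixes \<gamma> eps \<eta> x :: real
  assumes J: "finite J" "j \<in> J" "\<gamma> * card J \<le> x" "2 * mu / (eps * \<gamma>) \<le> card J"
    and \<gamma>: "0 < \<gamma>" and eps: "0 < eps" and \<eta>: "0 < \<eta>" "\<eta> \<le> eps * \<gamma> / 2"
    and w: "\<bar>(\<Sum>i\<in>J - {j}. w i) - card (J - {j}) * mu\<bar> \<le> \<eta> * card (J - {j})"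
  shows "\<bar>x + card J * mu - (\<Sum>i\<in>J - {j}. w i) - x\<bar> \<le> eps * x"
proof -
  have c: "card J = Suc (card (J - {j}))" using card.remove[OF J(1,2)] .
  have "x + card J * mu - (\<Sum>i\<in>J - {j}. w i) - x = mu - ((\<Sum>i\<in>J - {j}. w i) - card (J - {j}) * mu)"
    by (simp only: c) (simp add: algebra_simps)
  then have "\<bar>x + card J * mu - (\<Sum>i\<in>J - {j}. w i) - x\<bar> \<le> \<bar>mu\<bar> + \<bar>(\<Sum>i\<in>J - {j}. w i) - card (J - {j}) * mu\<bar>"
    by (simp only: abs_triangle_ineq4)
  moreover have "card (J - {j}) \<le> card J" using c by linarith
  then have "\<eta> * card (J - {j}) \<le> eps * \<gamma> / 2 * card J"
    using \<eta> by (intro mult_mono) simp_all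
  moreover have "mu \<le> eps * \<gamma> / 2 * card J" using J(4) eps \<gamma> by (simp add: field_simps)
  moreover have "eps * (\<gamma> * card J) \<le> eps * x" using J eps by (intro mult_left_mono) auto
  then have "eps * \<gamma> / 2 * card J + eps * \<gamma> / 2 * card J \<le> eps * x" by (simp add: mult_ac)
  ultimately show ?thesis using w abs_of_nonneg[OF mu_nonneg] by linarith
qed

lemma card_threshold:
  fixes \<gamma> x0 a :: real
  assumes "0 < \<gamma>"
  obtains n0 where "\<And>n. n0 \<le> n \<Longrightarrow> n1 \<le> n \<and> a \<le> real n \<and> x0 \<le> \<gamma> * real n"
proof (rule that[of "max n1 (nat \<lceil>max a (x0 / \<gamma>)\<rceil>)"])
  fix n assume "max n1 (nat \<lceil>max a (x0 / \<gamma>)\<rceil>) \<le> n"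
  then have "n1 \<le> n" "max a (x0 / \<gamma>) \<le> n" by linarith+
  then show "n1 \<le> n \<and> a \<le> real n \<and> x0 \<le> \<gamma> * real n" using assms by (simp add: field_simps)
qed

text \<open>\<open>s\<close> stands for any bound of \<open>f\<close> near \<open>x\<close>, which
  avoids suprema. A threshold on \<open>card J\<close> suffices because
  \<open>\<gamma> * card J \<le> x\<close> makes \<open>x\<close> large as well. For each
  \<open>j\<close> the other claims either obey the weak law, which puts the window near
  \<open>x\<close>, or deviate, which costs the factor \<open>\<eta>\<close>.\<close>

lemma local_prob_asymp_upper:
  fixes \<gamma> eps :: real
  assumes \<gamma>: "0 < \<gamma>" and eps: "0 < eps"
  obtains n0 where "\<And>J x s. finite J \<Longrightarrow> J \<subseteq> {1..} \<Longrightarrow> n0 \<le> card J \<Longrightarrow> \<gamma> * card J \<le> x \<Longrightarrow>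
    (\<And>z. \<bar>z - x\<bar> \<le> eps * x \<Longrightarrow> f z \<le> s) \<Longrightarrow> local_prob J x \<le> card J * (s + eps * f x)"
proof -
  obtain \<alpha> where \<alpha>: "0 < \<alpha>" "\<alpha> < 1" and nbj: "\<forall>\<^sub>F x in at_top. \<forall>J. finite J \<longrightarrow> J \<subseteq> {1..} \<longrightarrow> \<gamma> * card J \<le> x \<longrightarrow>
       prob {\<omega>\<in>space M. x < csum J \<omega> \<and> (\<forall>i\<in>J. X i \<omega> \<le> \<alpha> * x)} \<le> x powr - (q + 1)"
    \<comment> \<open>The additional power provides a factor \<open>1 / x\<close>, which brings the
      event without big claims below \<open>eps / 2 * f x\<close>.\<close>
    using no_big_jump[OF \<gamma>, of "q + 1"] q_pos by auto
  obtain C where C: "0 < C" and jump: "\<forall>\<^sub>F y in at_top. \<forall>v. measure F {u. u - v \<in> Delta T \<and> y < u} \<le> C * f y"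
    using single_jump_le by blast
  obtain K where K: "0 < K" "\<forall>\<^sub>F x in at_top. \<forall>u\<ge>\<alpha> * x. f u \<le> K * f x"
    using dominated_variation[OF ad lr \<alpha>(1)] by blast
  have l\<alpha>: "filterlim (\<lambda>x. \<alpha> * x) at_top at_top"
    using \<alpha> by (intro filterlim_tendsto_pos_mult_at_top[OF tendsto_const] filterlim_ident)
  \<comment> \<open>The first bound serves \<open>leave_one_out_near\<close>; the second reduces the
    constant \<open>C * K\<close> of the deviating configurations to \<open>eps / 2\<close>.\<close>
  define \<eta> where "\<eta> = min (eps * \<gamma> / 2) (eps / (2 * (C * K)))"
  have \<eta>: "0 < \<eta>" "\<eta> \<le> eps * \<gamma> / 2" "C * K * \<eta> \<le> eps / 2"
  proof -
    show "0 < \<eta>" "\<eta> \<le> eps * \<gamma> / 2" using eps \<gamma> C K by (auto simp: \<eta>_def)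
    have "\<eta> \<le> eps / (2 * (C * K))" by (simp add: \<eta>_def)
    then show "C * K * \<eta> \<le> eps / 2" using C K by (simp add: field_simps)
  qed
  obtain n1 where wl: "\<And>J. finite J \<Longrightarrow> J \<subseteq> {1..} \<Longrightarrow> n1 \<le> card J \<Longrightarrow>
      prob {\<omega>\<in>space M. \<eta> * card J < \<bar>csum J \<omega>\<bar>} \<le> \<eta>"
    using weak_law[OF \<eta>(1)] by blast
  have "\<forall>\<^sub>F x in at_top. \<forall>J s. finite J \<longrightarrow> J \<subseteq> {1..} \<longrightarrow> \<gamma> * card J \<le> x \<longrightarrow>
     n1 + 1 \<le> card J \<longrightarrow> 2 * mu / (eps * \<gamma>) \<le> card J \<longrightarrow>
    (\<forall>z. \<bar>z - x\<bar> \<le> eps * x \<longrightarrow> f z \<le> s) \<longrightarrow> local_prob J x \<le> card J * (s + eps * f x)"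
    using nbj eventually_compose_filterlim[OF jump l\<alpha>] K(2) power_bound eventually_gt_at_top[of "max 0 (2 / (c0 * eps))"]
  proof eventually_elim
    case (elim x)
    show ?case
    proof (intro allI impI)
      fix J :: "nat set" and s assume J: "finite J" "J \<subseteq> {1..}" "\<gamma> * card J \<le> x"
        and n: "n1 + 1 \<le> card J" "2 * mu / (eps * \<gamma>) \<le> card J"
        and s: "\<forall>z. \<bar>z - x\<bar> \<le> eps * x \<longrightarrow> f z \<le> s"
      have x: "0 < x" "2 / (c0 * eps) < x" using elim(5) by auto
      have fx: "f x \<le> s" "0 \<le> f x" "0 \<le> s" using s[rule_format, of x] x eps F_Delta_nonneg[of F T x] by auto
      have "prob {\<omega>\<in>space M. csum J \<omega> - x \<in> Delta T \<and> X j \<omega> \<in> {\<alpha> * x<..}} \<le> s + eps / 2 * f x"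
        if j: "j \<in> J" for j
      proof -
        let ?R = "J - {j}"
        let ?P = "\<lambda>w. \<eta> * card ?R < \<bar>(\<Sum>i\<in>?R. w i) - card ?R * mu\<bar>"
        let ?W = "\<lambda>\<omega>. restrict (\<lambda>i. X i \<omega>) ?R"
        let ?E = "\<lambda>\<omega>. csum J \<omega> - x \<in> Delta T \<and> X j \<omega> \<in> {\<alpha> * x<..}"
        have cR: "card ?R = card J - 1" "real (card J) = real (card ?R) + 1"
          using J j n by auto
        have Rle: "n1 \<le> card ?R" "card ?R \<le> card J" using cR(1) n(1) by linarith+
        have [measurable]: "\<And>i. i \<in> J \<Longrightarrow> X i \<in> borel_measurable M"
            "(\<lambda>\<omega>. \<Sum>i\<in>J. X i \<omega>) \<in> borel_measurable M" "(\<lambda>\<omega>. \<Sum>i\<in>?R. X i \<omega>) \<in> borel_measurable M"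
          using J by (auto intro!: sum_measurable)
        \<comment> \<open>The deviation of the other claims is estimated together with the jump, so
          its probability is multiplied by \<open>f (\<alpha> * x)\<close>.\<close>
        have bad: "prob {\<omega>\<in>space M. ?E \<omega> \<and> ?P (?W \<omega>)} \<le> (C * f (\<alpha> * x)) * prob {\<omega>\<in>space M. ?P (?W \<omega>)}"
        proof (rule jump_prob_le[OF J(1,2) j])
          show "0 \<le> C * f (\<alpha> * x)" using C by (simp add: F_Delta_nonneg)
          show "measure F {u. u - (x + card J * mu - (\<Sum>i\<in>?R. w i)) \<in> Delta T \<and> u \<in> {\<alpha> * x<..}} \<le> C * f (\<alpha> * x)" for w
            using elim(2) by simp
        qed measurable
        also have "\<dots> \<le> C * f (\<alpha> * x) * \<eta>"
        proof (rule mult_left_mono)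
          have "{\<omega>\<in>space M. ?P (?W \<omega>)} =
              {\<omega>\<in>space M. \<eta> * card ?R < \<bar>csum ?R \<omega>\<bar>}"
            by simp
          moreover have "prob {\<omega>\<in>space M. \<eta> * card ?R < \<bar>csum ?R \<omega>\<bar>} \<le> \<eta>"
            by (rule wl) (use J Rle(1) in auto)
          ultimately show "prob {\<omega>\<in>space M. ?P (?W \<omega>)} \<le> \<eta>" by (simp only:)
          show "0 \<le> C * f (\<alpha> * x)" using C by (simp add: F_Delta_nonneg)
        qed
        also have "\<dots> \<le> C * (K * f x) * \<eta>"
          using elim(3) C \<eta> by (intro mult_left_mono mult_right_mono) auto
        also have "\<dots> = C * K * \<eta> * f x" by simp
        also have "\<dots> \<le> eps / 2 * f x" using \<eta>(3) fx by (intro mult_right_mono) auto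
        finally have bad: "prob {\<omega>\<in>space M. ?E \<omega> \<and> ?P (?W \<omega>)} \<le> eps / 2 * f x" .
        have "prob {\<omega>\<in>space M. ?E \<omega> \<and> \<not> ?P (?W \<omega>)} \<le> s * prob {\<omega>\<in>space M. \<not> ?P (?W \<omega>)}"
        proof (rule jump_prob_le[OF J(1,2) j _ _ fx(3)])
          fix w assume w: "\<not> ?P w"
          let ?v = "x + card J * mu - (\<Sum>i\<in>?R. w i)"
          have "\<bar>?v - x\<bar> \<le> eps * x"
            using w by (intro leave_one_out_near[OF J(1) j J(3) n(2) \<gamma> eps \<eta>(1,2)]) simp
          then have "f ?v \<le> s" using s by blast
          moreover have "measure F {u. u - ?v \<in> Delta T \<and> u \<in> {\<alpha> * x<..}} \<le> f ?v"
            unfolding F_Delta_eq by (intro F.finite_measure_mono) auto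
          ultimately show "measure F {u. u - ?v \<in> Delta T \<and> u \<in> {\<alpha> * x<..}} \<le> s" by linarith
        qed auto
        also have "\<dots> \<le> s * 1" using fx by (intro mult_left_mono) auto
        finally have good: "prob {\<omega>\<in>space M. ?E \<omega> \<and> \<not> ?P (?W \<omega>)} \<le> s" by simp
        have "prob {\<omega>\<in>space M. ?E \<omega>} \<le> prob ({\<omega>\<in>space M. ?E \<omega> \<and> \<not> ?P (?W \<omega>)} \<union> {\<omega>\<in>space M. ?E \<omega> \<and> ?P (?W \<omega>)})"
          using j by (intro finite_measure_mono) auto
        also have "\<dots> \<le> prob {\<omega>\<in>space M. ?E \<omega> \<and> \<not> ?P (?W \<omega>)} + prob {\<omega>\<in>space M. ?E \<omega> \<and> ?P (?W \<omega>)}"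
          using j by (intro measure_Un_le) auto
        finally show ?thesis using good bad by linarith
      qed
      then have "(\<Sum>j\<in>J. prob {\<omega>\<in>space M. csum J \<omega> - x \<in> Delta T \<and> X j \<omega> \<in> {\<alpha> * x<..}})
          \<le> card J * (s + eps / 2 * f x)"
        by (rule sum_bounded_above)
      moreover have "x powr - (q + 1) \<le> card J * (eps / 2 * f x)"
      proof -
        have "x powr - (q + 1) = x powr - q * (1 / x)" using x by (simp add: powr_diff powr_minus field_simps)
        also have "\<dots> \<le> (f x / c0) * (c0 * eps / 2)"
          using elim(4) c0_pos x eps fx by (intro mult_mono) (auto simp: field_simps)
        also have "\<dots> = 1 * (eps / 2 * f x)" using c0_pos by simp
        also have "\<dots> \<le> card J * (eps / 2 * f x)" using n eps fx by (intro mult_right_mono) auto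
        finally show ?thesis .
      qed
      moreover have "local_prob J x \<le> x powr - (q + 1) + (\<Sum>j\<in>J. prob {\<omega>\<in>space M. csum J \<omega> - x \<in> Delta T \<and> X j \<omega> \<in> {\<alpha> * x<..}})"
        using local_prob_split[OF J(1,2), of x "\<alpha> * x"] elim(1)[rule_format, OF J] by linarith
      ultimately show "local_prob J x \<le> card J * (s + eps * f x)" by (simp add: algebra_simps)
    qed
  qed
  then obtain x0 where x0: "\<forall>x\<ge>x0. \<forall>J s. finite J \<longrightarrow> J \<subseteq> {1..} \<longrightarrow> \<gamma> * card J \<le> x \<longrightarrow>
     n1 + 1 \<le> card J \<longrightarrow> 2 * mu / (eps * \<gamma>) \<le> card J \<longrightarrow>
    (\<forall>z. \<bar>z - x\<bar> \<le> eps * x \<longrightarrow> f z \<le> s) \<longrightarrow> local_prob J x \<le> card J * (s + eps * f x)"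
    unfolding eventually_at_top_linorder by blast
  obtain n0 where n0: "\<And>n. n0 \<le> n \<Longrightarrow> n1 + 1 \<le> n \<and> 2 * mu / (eps * \<gamma>) \<le> real n \<and> x0 \<le> \<gamma> * real n"
    using card_threshold[OF \<gamma>] by blast
  show ?thesis
  proof (rule that[of n0])
    fix J :: "nat set" and x s
    assume J: "finite J" "J \<subseteq> {1..}" "n0 \<le> card J" "\<gamma> * card J \<le> x"
      and s: "\<And>z. \<bar>z - x\<bar> \<le> eps * x \<Longrightarrow> f z \<le> s"
    show "local_prob J x \<le> card J * (s + eps * f x)"
      using n0[OF J(3)] J s by (intro x0[rule_format]) auto
  qed
qed

text \<open>Disjoint events take the place of inclusion-exclusion: on \<open>B' j\<close> the sum
  hits the window, the claims other than \<open>j\<close> are near their mean and none of them is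
  large. Passing from \<open>B j\<close> to \<open>B' j\<close> loses only a second large claim, a
  total of order \<open>x powr (1 - r) * f x\<close>.\<close>

lemma local_prob_asymp_lower:
  fixes \<gamma> eps :: real
  assumes \<gamma>: "0 < \<gamma>" and eps: "0 < eps" "eps < 1"
  obtains n0 where "\<And>J x s. finite J \<Longrightarrow> J \<subseteq> {1..} \<Longrightarrow> n0 \<le> card J \<Longrightarrow> \<gamma> * card J \<le> x \<Longrightarrow>
    0 \<le> s \<Longrightarrow> (\<And>z. \<bar>z - x\<bar> \<le> eps * x \<Longrightarrow> s \<le> f z) \<Longrightarrow> card J * (s - eps * f x) \<le> local_prob J x"
proof -
  \<comment> \<open>On \<open>B j\<close> the window for claim \<open>j\<close> starts at or above
    \<open>(1 - eps) * x\<close>, so that claim automatically exceeds \<open>\<alpha> * x\<close>.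
    This makes the \<open>B' j\<close> disjoint.\<close>
  define \<alpha> where "\<alpha> = 1 - eps"
  have \<alpha>: "0 < \<alpha>" using eps by (simp add: \<alpha>_def)
  obtain C where C: "0 < C" and jump: "\<forall>\<^sub>F y in at_top. \<forall>v. measure F {u. u - v \<in> Delta T \<and> y < u} \<le> C * f y"
    using single_jump_le by blast
  obtain K where K: "0 < K" "\<forall>\<^sub>F x in at_top. \<forall>u\<ge>\<alpha> * x. f u \<le> K * f x"
    using dominated_variation[OF ad lr \<alpha>] by blast
  have l\<alpha>: "filterlim (\<lambda>x. \<alpha> * x) at_top at_top"
    using \<alpha> by (intro filterlim_tendsto_pos_mult_at_top[OF tendsto_const] filterlim_ident)
  define \<eta> where "\<eta> = min (eps * \<gamma> / 2) (eps / 2)"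
  have \<eta>: "0 < \<eta>" "\<eta> \<le> eps * \<gamma> / 2" "\<eta> \<le> eps / 2" using eps \<gamma> by (auto simp: \<eta>_def)
  obtain n1 where wl: "\<And>J. finite J \<Longrightarrow> J \<subseteq> {1..} \<Longrightarrow> n1 \<le> card J \<Longrightarrow>
      prob {\<omega>\<in>space M. \<eta> * card J < \<bar>csum J \<omega>\<bar>} \<le> \<eta>"
    using weak_law[OF \<eta>(1)] by blast
  \<comment> \<open>The coefficient of \<open>f x\<close> for two large claims: at most
    \<open>x / \<gamma>\<close> indices, each contributing the order
    \<open>x powr (- r)\<close>.\<close>
  have "((\<lambda>x. C * K * moment / \<gamma> * \<alpha> powr - r * x powr (1 - r)) \<longlongrightarrow> C * K * moment / \<gamma> * \<alpha> powr - r * 0) at_top"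
    by (intro tendsto_mult tendsto_const tendsto_neg_powr filterlim_ident) (use r_gt_1 in simp)
  then have "\<forall>\<^sub>F x in at_top. C * K * moment / \<gamma> * \<alpha> powr - r * x powr (1 - r) < eps / 2"
    using eps by (intro order_tendstoD(2)[where y=0]) auto
  then have "\<forall>\<^sub>F x in at_top. \<forall>J s. finite J \<longrightarrow> J \<subseteq> {1..} \<longrightarrow> \<gamma> * card J \<le> x \<longrightarrow>
     n1 + 1 \<le> card J \<longrightarrow> 2 * mu / (eps * \<gamma>) \<le> card J \<longrightarrow> 0 \<le> s \<longrightarrow>
    (\<forall>z. \<bar>z - x\<bar> \<le> eps * x \<longrightarrow> s \<le> f z) \<longrightarrow> card J * (s - eps * f x) \<le> local_prob J x"
    using eventually_compose_filterlim[OF jump l\<alpha>] K(2) eventually_gt_at_top[of 0]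
  proof eventually_elim
    case (elim x)
    show ?case
    proof (intro allI impI)
      fix J :: "nat set" and s assume J: "finite J" "J \<subseteq> {1..}" "\<gamma> * card J \<le> x"
        and n: "n1 + 1 \<le> card J" "2 * mu / (eps * \<gamma>) \<le> card J" and s0: "0 \<le> s"
        and s: "\<forall>z. \<bar>z - x\<bar> \<le> eps * x \<longrightarrow> s \<le> f z"
      have x: "0 < x" using elim(4) .
      have fx: "s \<le> f x" "0 \<le> f x" using s[rule_format, of x] x eps F_Delta_nonneg[of F T x] by auto
      let ?y = "\<alpha> * x"
      let ?S = "\<lambda>\<omega>. csum J \<omega> - x"
      let ?G = "\<lambda>j w. \<bar>(\<Sum>i\<in>J - {j}. w i) - card (J - {j}) * mu\<bar> \<le> \<eta> * card (J - {j})"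
      let ?W = "\<lambda>j \<omega>. restrict (\<lambda>i. X i \<omega>) (J - {j})"
      define B where "B j = {\<omega>\<in>space M. (?S \<omega> \<in> Delta T \<and> X j \<omega> \<in> UNIV) \<and> ?G j (?W j \<omega>)}" for j
      define B' where "B' j = {\<omega>\<in>B j. \<forall>i\<in>J - {j}. X i \<omega> \<le> ?y}" for j
      define D where "D j i = {\<omega>\<in>space M. (?S \<omega> \<in> Delta T \<and> X j \<omega> \<in> {?y<..}) \<and> ?y < ?W j \<omega> i}" for j i
      have mes[measurable]: "\<And>i. i \<in> J \<Longrightarrow> X i \<in> borel_measurable M"
            "(\<lambda>\<omega>. \<Sum>i\<in>J. X i \<omega>) \<in> borel_measurable M"
        using J by auto
      have mesR[measurable]: "(\<lambda>\<omega>. \<Sum>i\<in>J - {j}. X i \<omega>) \<in> borel_measurable M" for j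
        using J by (auto intro!: sum_measurable)
      have B_alt: "B j = {\<omega>\<in>space M. ?S \<omega> \<in> Delta T \<and> \<bar>csum (J - {j}) \<omega>\<bar> \<le> \<eta> * card (J - {j})}" for j
        unfolding B_def by simp
      have D_alt: "D j i = {\<omega>\<in>space M. ?S \<omega> \<in> Delta T \<and> ?y < X j \<omega> \<and> ?y < X i \<omega>}" if "i \<in> J - {j}" for j i
        using that unfolding D_def by auto
      have mB: "B j \<in> events" if "j \<in> J" for j unfolding B_alt by measurable
      have mB': "B' j \<in> events" if "j \<in> J" for j
      proof -
        have "B' j = B j \<inter> {\<omega>\<in>space M. \<forall>i\<in>J - {j}. X i \<omega> \<le> ?y}" by (auto simp: B'_def B_def)
        moreover have "{\<omega>\<in>space M. \<forall>i\<in>J - {j}. X i \<omega> \<le> ?y} \<in> events"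
        proof -
          have [measurable]: "\<And>i. i \<in> J - {j} \<Longrightarrow> X i \<in> borel_measurable M" using mes(1) by auto
          show ?thesis using J by measurable
        qed
        ultimately show ?thesis using mB[OF that] by simp
      qed
      have mD: "D j i \<in> events" if "j \<in> J" "i \<in> J - {j}" for j i
      proof -
        have "i \<in> J" using that by auto
        note [measurable] = mes(1)[OF that(1)] mes(1)[OF this]
        show ?thesis unfolding D_alt[OF that(2)] by measurable
      qed
      have Rle: "n1 \<le> card (J - {j})" "card (J - {j}) \<le> card J" "real (card J) = real (card (J - {j})) + 1"
        if "j \<in> J" for j
      proof -
        have "card (J - {j}) = card J - 1" using J that by auto
        then show "n1 \<le> card (J - {j})" "card (J - {j}) \<le> card J" "real (card J) = real (card (J - {j})) + 1"
          using n(1) by linarith+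
      qed
      have vx: "\<bar>x + card J * mu - (\<Sum>i\<in>J - {j}. w i) - x\<bar> \<le> eps * x" if j: "j \<in> J" and w: "?G j w" for j and w :: "nat \<Rightarrow> real"
        by (rule leave_one_out_near[OF J(1) j J(3) n(2) \<gamma> eps(1) \<eta>(1,2) w])
      have big: "?y < X j \<omega>" if "j \<in> J" "\<omega> \<in> B j" for j \<omega>
      proof -
        have "?S \<omega> \<in> Delta T" and G: "?G j (?W j \<omega>)" using that by (auto simp: B_def)
        then have "0 < ?S \<omega>" by (auto dest: Delta_pos)
        moreover have "(\<Sum>i\<in>J. X i \<omega>) = X j \<omega> + (\<Sum>i\<in>J - {j}. ?W j \<omega> i)"
          using J that by (simp add: sum.remove[of J j])
        ultimately have "x + card J * mu - (\<Sum>i\<in>J - {j}. ?W j \<omega> i) < X j \<omega>" by linarith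
        then show ?thesis using vx[OF that(1) G] unfolding \<alpha>_def left_diff_distrib by linarith
      qed
      have disj: "disjoint_family_on B' J"
        unfolding disjoint_family_on_def
      proof (intro ballI impI)
        fix i j assume ij: "i \<in> J" "j \<in> J" "i \<noteq> j"
        have False if "\<omega> \<in> B' i" "\<omega> \<in> B' j" for \<omega>
        proof -
          have "?y < X j \<omega>" using that ij by (intro big) (auto simp: B'_def)
          moreover have "X j \<omega> \<le> ?y" using that ij by (auto simp: B'_def)
          ultimately show False by simp
        qed
        then show "B' i \<inter> B' j = {}" by blast
      qed
      have lowB: "s - eps / 2 * f x \<le> prob (B j)" if j: "j \<in> J" for j
      proof -
        have "s * prob {\<omega>\<in>space M. ?G j (?W j \<omega>)} \<le> prob (B j)"
          unfolding B_def
        proof (rule jump_prob_ge[OF J(1,2) j])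
          fix w assume w: "?G j w"
          show "s \<le> measure F {u. u - (x + card J * mu - (\<Sum>i\<in>J - {j}. w i)) \<in> Delta T \<and> u \<in> UNIV}"
            using s[rule_format, OF vx[OF j w]] by (simp add: F_Delta_eq)
        qed measurable
        moreover have "1 - \<eta> \<le> prob {\<omega>\<in>space M. ?G j (?W j \<omega>)}"
        proof -
          have "prob {\<omega>\<in>space M. \<eta> * card (J - {j}) < \<bar>csum (J - {j}) \<omega>\<bar>} \<le> \<eta>"
            by (rule wl) (use J Rle(1)[OF j] in auto)
          moreover have "{\<omega>\<in>space M. ?G j (?W j \<omega>)} = space M - {\<omega>\<in>space M. \<eta> * card (J - {j}) < \<bar>csum (J - {j}) \<omega>\<bar>}"
            by (auto simp: not_less)
          moreover have "{\<omega>\<in>space M. \<eta> * card (J - {j}) < \<bar>csum (J - {j}) \<omega>\<bar>} \<in> events"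
            by measurable
          ultimately show ?thesis by (simp only: prob_compl)
        qed
        then have "s * (1 - \<eta>) \<le> s * prob {\<omega>\<in>space M. ?G j (?W j \<omega>)}" by (rule mult_left_mono) fact
        \<comment> \<open>Since \<open>s \<le> f x\<close>, the loss from the weak law is a multiple
          of \<open>f x\<close>.\<close>
        moreover have "s * \<eta> \<le> f x * (eps / 2)" using fx s0 \<eta> by (intro mult_mono) auto
        ultimately show ?thesis by (simp add: algebra_simps)
      qed
      have upD: "prob (D j i) \<le> C * K * f x * (moment / ?y powr r)" if j: "j \<in> J" and i: "i \<in> J - {j}" for j i
      proof -
        have "prob (D j i) \<le> C * f ?y * prob {\<omega>\<in>space M. ?y < ?W j \<omega> i}"
          unfolding D_def
        proof (rule jump_prob_le[OF J(1,2) j])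
          show "Measurable.pred (Pi\<^sub>M (J - {j}) (\<lambda>_. borel)) (\<lambda>w. ?y < w i)" using i by measurable
          show "0 \<le> C * f ?y" using C by (simp add: F_Delta_nonneg)
          show "measure F {u. u - (x + card J * mu - (\<Sum>i\<in>J - {j}. w i)) \<in> Delta T \<and> u \<in> {?y<..}} \<le> C * f ?y" for w
            using elim(2) by simp
        qed simp
        also have "\<dots> \<le> C * (K * f x) * (moment / ?y powr r)"
        proof (intro mult_mono)
          show "f ?y \<le> K * f x" using elim(3) by auto
          have "prob {\<omega>\<in>space M. ?y < X i \<omega>} \<le> moment / ?y powr r"
            using i J \<alpha> x by (intro prob_X_gt_le) auto
          then show "prob {\<omega>\<in>space M. ?y < ?W j \<omega> i} \<le> moment / ?y powr r" using i by simp
        qed (use C K fx in \<open>auto simp: F_Delta_nonneg\<close>)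
        finally show ?thesis by (simp add: mult.assoc)
      qed
      have lowB': "s - eps * f x \<le> prob (B' j)" if j: "j \<in> J" for j
      proof -
        have mU: "(\<Union>i\<in>J - {j}. D j i) \<in> events" using mD j J by auto
        have "B j \<subseteq> B' j \<union> (\<Union>i\<in>J - {j}. D j i)"
        proof
          fix \<omega> assume w: "\<omega> \<in> B j"
          show "\<omega> \<in> B' j \<union> (\<Union>i\<in>J - {j}. D j i)"
          proof (cases "\<forall>i\<in>J - {j}. X i \<omega> \<le> ?y")
            case True then show ?thesis using w by (auto simp: B'_def)
          next
            case False
            then obtain i where i: "i \<in> J - {j}" "?y < X i \<omega>" by (auto simp: not_le)
            then have "\<omega> \<in> D j i" using w big[OF j w] by (auto simp: D_alt B_def)
            then show ?thesis using i by blast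
          qed
        qed
        then have "prob (B j) \<le> prob (B' j \<union> (\<Union>i\<in>J - {j}. D j i))"
          using mB' j mU by (intro finite_measure_mono) auto
        also have "\<dots> \<le> prob (B' j) + prob (\<Union>i\<in>J - {j}. D j i)"
          using mB'[OF j] mU by (rule measure_Un_le)
        also have "prob (\<Union>i\<in>J - {j}. D j i) \<le> (\<Sum>i\<in>J - {j}. prob (D j i))"
          using J mD j by (intro finite_measure_subadditive_finite) auto
        also have "\<dots> \<le> card (J - {j}) * (C * K * f x * (moment / ?y powr r))"
          using upD[OF j] by (rule sum_bounded_above)
        also have "\<dots> \<le> x / \<gamma> * (C * K * f x * (moment / ?y powr r))"
        proof (rule mult_right_mono)
          have "\<gamma> * card (J - {j}) \<le> \<gamma> * card J" using Rle(2)[OF j] \<gamma> by (intro mult_left_mono) auto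
          then have "\<gamma> * card (J - {j}) \<le> x" using J(3) by linarith
          then show "card (J - {j}) \<le> x / \<gamma>" using \<gamma> by (simp add: pos_le_divide_eq mult.commute)
        qed (use C K fx moment_nonneg in auto)
        also have "\<dots> = (C * K * moment / \<gamma> * \<alpha> powr - r * x powr (1 - r)) * f x"
          using x \<alpha> by (simp add: powr_mult powr_diff powr_minus_divide mult_ac)
        also have "\<dots> \<le> eps / 2 * f x" using elim(1) fx by (intro mult_right_mono) auto
        finally show ?thesis using lowB[OF j] by linarith
      qed
      have "card J * (s - eps * f x) = (\<Sum>j\<in>J. s - eps * f x)" by simp
      also have "\<dots> \<le> (\<Sum>j\<in>J. prob (B' j))" by (rule sum_mono) (rule lowB')
      also have "\<dots> = prob (\<Union>j\<in>J. B' j)"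
        using J mB' disj by (intro finite_measure_finite_Union[symmetric]) auto
      also have "\<dots> \<le> local_prob J x"
        unfolding local_prob_def by (intro finite_measure_mono) (auto simp: B'_def B_def)
      finally show "card J * (s - eps * f x) \<le> local_prob J x" .
    qed
  qed
  then obtain x0 where x0: "\<forall>x\<ge>x0. \<forall>J s. finite J \<longrightarrow> J \<subseteq> {1..} \<longrightarrow> \<gamma> * card J \<le> x \<longrightarrow>
     n1 + 1 \<le> card J \<longrightarrow> 2 * mu / (eps * \<gamma>) \<le> card J \<longrightarrow> 0 \<le> s \<longrightarrow>
    (\<forall>z. \<bar>z - x\<bar> \<le> eps * x \<longrightarrow> s \<le> f z) \<longrightarrow> card J * (s - eps * f x) \<le> local_prob J x"
    unfolding eventually_at_top_linorder by blast
  obtain n0 where n0: "\<And>n. n0 \<le> n \<Longrightarrow> n1 + 1 \<le> n \<and> 2 * mu / (eps * \<gamma>) \<le> real n \<and> x0 \<le> \<gamma> * real n"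
    using card_threshold[OF \<gamma>] by blast
  show ?thesis
  proof (rule that[of n0])
    fix J :: "nat set" and x s
    assume J: "finite J" "J \<subseteq> {1..}" "n0 \<le> card J" "\<gamma> * card J \<le> x" and s0: "0 \<le> s"
      and s: "\<And>z. \<bar>z - x\<bar> \<le> eps * x \<Longrightarrow> s \<le> f z"
    show "card J * (s - eps * f x) \<le> local_prob J x"
      using n0[OF J(3)] J s s0 by (intro x0[rule_format]) auto
  qed
qed

lemma local_prob_nonneg: "0 \<le> local_prob J x" by (simp add: local_prob_def)

lemma local_prob_le_1: "local_prob J x \<le> 1" by (simp add: local_prob_def)

text \<open>The moment of order \<open>r\<close> forces \<open>f x \<le> moment / x powr r\<close>,
  which no slower power can stay below. The consequence \<open>1 < q\<close> gives
  \<open>n \<le> n powr q\<close>, by which linear terms are merged with the moment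
  condition.\<close>

lemma q_ge_r: "r \<le> q"
proof (rule ccontr)
  assume "\<not> r \<le> q"
  then have lim: "filterlim (\<lambda>x. c0 * x powr (r - q)) at_top at_top"
    using c0_pos by real_asymp
  have "\<forall>\<^sub>F x in at_top. moment < c0 * x powr (r - q)"
    using lim by (simp add: filterlim_at_top_dense)
  moreover have "\<forall>\<^sub>F x in at_top. c0 * x powr (r - q) \<le> moment"
    using power_bound eventually_gt_at_top[of 0]
  proof eventually_elim
    case (elim x)
    have "f x \<le> measure F {x<..}"
      unfolding F_Delta_eq by (intro F.finite_measure_mono) (auto dest: Delta_pos)
    also have "\<dots> = prob {\<omega>\<in>space M. x < X 1 \<omega>}"
      using prob_X_eq[of 1 "{x<..}"] by simp
    also have "\<dots> \<le> moment / x powr r" using elim by (intro prob_X_gt_le) auto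
    finally have "c0 * x powr - q \<le> moment / x powr r" using elim by simp
    then show ?case using elim by (simp add: powr_diff powr_minus_divide field_simps)
  qed
  ultimately have "\<forall>\<^sub>F x::real in at_top. False" by eventually_elim simp
  then show False by simp
qed

lemma q_gt_1: "1 < q" using q_ge_r r_gt_1 by simp

lemma le_powr_q: "real n \<le> real n powr q"
proof (cases "n = 0")
  case False
  then have "real n powr 1 \<le> real n powr q" using q_gt_1 by (intro powr_mono) auto
  then show ?thesis by simp
qed simp

text \<open>For sums much longer than \<open>L\<close> the point \<open>w\<close> may lie below the range covered by the bound on
  \<open>local_prob\<close>; then \<open>x\<close> is at most of the order of \<open>n\<close>, and \<open>n powr q * f x\<close> is bounded below.\<close>

lemma local_prob_crude_upper:
  fixes \<gamma> c :: real
  assumes \<gamma>: "0 < \<gamma>" and c: "0 < c"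
  obtains \<delta> C :: real where "0 < \<delta>" "0 < C"
    "\<forall>\<^sub>F L in at_top. \<forall>x\<ge>\<gamma> * L. \<forall>n w. c * x + mu * (L - real n) \<le> w \<longrightarrow>
       local_prob {1..n} w \<le> C * f x * (if real n \<le> (1 + \<delta>) * L then L else real n powr q)"
proof -
  \<comment> \<open>For \<open>n \<le> (1 + \<delta>) * L\<close> the shift
    \<open>mu * (n - L)\<close> then uses up at most half of \<open>c * x\<close>. The summand 1
    allows \<open>mu = 0\<close>.\<close>
  define \<delta> where "\<delta> = c * \<gamma> / (2 * (mu + 1))"
  have \<delta>: "0 < \<delta>" "mu * \<delta> \<le> c * \<gamma> / 2"
  proof -
    show "0 < \<delta>" using c \<gamma> mu_nonneg by (simp add: \<delta>_def)
    then have "mu * \<delta> \<le> (mu + 1) * \<delta>" by (intro mult_right_mono) auto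
    also have "\<dots> = c * \<gamma> / 2" using mu_nonneg by (simp add: \<delta>_def field_simps)
    finally show "mu * \<delta> \<le> c * \<gamma> / 2" .
  qed
  \<comment> \<open>For larger \<open>n\<close>, \<open>c * x \<le> w + mu * n\<close> gives
    \<open>c * x \<le> (1 + mu) * w\<close> or \<open>c * x \<le> (1 + mu) * n\<close>, according to
    which of \<open>w\<close> and \<open>n\<close> is larger. In either case the larger one is at
    least \<open>d * x\<close>.\<close>
  define d where "d = c / (2 * (1 + mu))"
  have d: "0 < d" "d * (1 + mu) = c / 2" using c mu_nonneg by (auto simp: d_def field_simps)
  have d2: "d \<le> c / 2" using d mu_nonneg mult_left_mono[of 1 "1 + mu" d] by linarith
  \<comment> \<open>The cap 1 makes \<open>n \<le> w\<close> sufficient for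
    \<open>local_prob_upper\<close>; the second term covers
    \<open>n \<le> (1 + \<delta>) * L\<close>, where \<open>c / 2 * x \<le> w\<close>.\<close>
  define \<gamma>' where "\<gamma>' = min 1 (c * \<gamma> / (2 * (1 + \<delta>)))"
  have \<gamma>': "0 < \<gamma>'" "\<gamma>' \<le> 1" "\<gamma>' * (1 + \<delta>) \<le> c * \<gamma> / 2"
  proof -
    show "0 < \<gamma>'" "\<gamma>' \<le> 1" using c \<gamma> \<delta> by (auto simp: \<gamma>'_def)
    have "\<gamma>' \<le> c * \<gamma> / (2 * (1 + \<delta>))" by (simp add: \<gamma>'_def)
    then show "\<gamma>' * (1 + \<delta>) \<le> c * \<gamma> / 2" using \<delta> by (simp add: field_simps)
  qed
  obtain C :: real where C: "0 < C" and up: "\<forall>\<^sub>F x in at_top. \<forall>J. finite J \<longrightarrow> J \<subseteq> {1..} \<longrightarrow> \<gamma>' * card J \<le> x \<longrightarrow>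
    local_prob J x \<le> C * card J * f x"
    by (rule local_prob_upper[OF \<gamma>'(1)])
  obtain x0 where x0: "\<And>x n. x0 \<le> x \<Longrightarrow> \<gamma>' * real n \<le> x \<Longrightarrow> local_prob {1..n} x \<le> C * n * f x"
  proof -
    obtain x0 where x0: "\<forall>x\<ge>x0. \<forall>J. finite J \<longrightarrow> J \<subseteq> {1..} \<longrightarrow> \<gamma>' * card J \<le> x \<longrightarrow> local_prob J x \<le> C * card J * f x"
      using up unfolding eventually_at_top_linorder by blast
    have "local_prob {1..n} x \<le> C * card {1..n} * f x" if "x0 \<le> x" "\<gamma>' * real n \<le> x" for x n
      by (rule x0[rule_format]) (use that in auto)
    then have "local_prob {1..n} x \<le> C * n * f x" if "x0 \<le> x" "\<gamma>' * real n \<le> x" for x n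
      using that by simp
    then show ?thesis using that by blast
  qed
  obtain K where K: "0 < K" "\<forall>\<^sub>F x in at_top. \<forall>u\<ge>d * x. f u \<le> K * f x"
    using dominated_variation[OF ad lr d(1)] by blast
  obtain x1 where x1: "\<And>x u. x1 \<le> x \<Longrightarrow> d * x \<le> u \<Longrightarrow> f u \<le> K * f x"
    using K(2) unfolding eventually_at_top_linorder by blast
  obtain x2 where x2: "\<And>x. x2 \<le> x \<Longrightarrow> c0 * x powr - q \<le> f x"
    using power_bound unfolding eventually_at_top_linorder by blast
  define C' where "C' = C * K * (1 + \<delta>) + 1 / (c0 * d powr q)"
  have C': "C * K * (1 + \<delta>) \<le> C'" "C * K \<le> C'" "1 / (c0 * d powr q) \<le> C'" "0 < C'"
  proof -
    have p: "0 < C * K" "0 < 1 / (c0 * d powr q)" using C K c0_pos d by auto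
    then have "C * K * 1 \<le> C * K * (1 + \<delta>)" using \<delta> by (intro mult_left_mono) auto
    with p show "C * K * (1 + \<delta>) \<le> C'" "C * K \<le> C'" "1 / (c0 * d powr q) \<le> C'" "0 < C'"
      unfolding C'_def by linarith+
  qed
  have "\<forall>\<^sub>F L in at_top. \<forall>x\<ge>\<gamma> * L. \<forall>n w. c * x + mu * (L - real n) \<le> w \<longrightarrow>
       local_prob {1..n} w \<le> C' * f x * (if real n \<le> (1 + \<delta>) * L then L else real n powr q)"
    using eventually_ge_at_top[of "max 1 (max (max x1 x2) (x0 / d)) / \<gamma>"] eventually_gt_at_top[of 0]
  proof eventually_elim
    case (elim L)
    show ?case
    proof (intro allI impI)
      fix x n w assume x: "\<gamma> * L \<le> x" and w: "c * x + mu * (L - real n) \<le> w"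
      have "max 1 (max (max x1 x2) (x0 / d)) \<le> \<gamma> * L" using elim \<gamma> by (simp add: field_simps)
      then have big: "1 \<le> x" "x1 \<le> x" "x2 \<le> x" "x0 / d \<le> x" using x by auto
      have dx: "x0 \<le> d * x" using big(4) d by (simp add: field_simps)
      have fx: "0 \<le> f x" by (rule F_Delta_nonneg)
      have via: "local_prob {1..n} w \<le> C * K * n * f x" if "d * x \<le> w" "\<gamma>' * n \<le> w"
      proof -
        have "local_prob {1..n} w \<le> C * n * f w" using that dx by (intro x0) auto
        also have "\<dots> \<le> C * n * (K * f x)" using that big C by (intro mult_left_mono x1) auto
        finally show ?thesis by (simp add: mult_ac)
      qed
      show "local_prob {1..n} w \<le> C' * f x * (if real n \<le> (1 + \<delta>) * L then L else real n powr q)"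
      proof (cases "real n \<le> (1 + \<delta>) * L")
        case True
        have "mu * (real n - L) \<le> mu * (\<delta> * L)" using True mu_nonneg
          by (intro mult_left_mono) (auto simp: algebra_simps)
        also have "\<dots> \<le> c * \<gamma> / 2 * L" using \<delta>(2) elim by (simp flip: mult.assoc)
        also have "\<dots> \<le> c / 2 * x" using mult_left_mono[OF x, of "c / 2"] c by simp
        finally have wx: "c / 2 * x \<le> w" using w by (simp add: algebra_simps)
        have "d * x \<le> c / 2 * x" using d2 big by (intro mult_right_mono) auto
        moreover have "\<gamma>' * n \<le> c / 2 * x"
        proof -
          have "\<gamma>' * n \<le> \<gamma>' * ((1 + \<delta>) * L)" using True \<gamma>' by (intro mult_left_mono) auto
          also have "\<dots> \<le> c * \<gamma> / 2 * L"
            using mult_right_mono[OF \<gamma>'(3), of L] elim(2) by (simp only: mult.assoc less_imp_le)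
          also have "\<dots> \<le> c / 2 * x" using mult_left_mono[OF x, of "c / 2"] c by simp
          finally show ?thesis .
        qed
        ultimately have "local_prob {1..n} w \<le> C * K * n * f x" using wx by (intro via) auto
        also have "\<dots> \<le> C * K * ((1 + \<delta>) * L) * f x"
          using True C K fx by (intro mult_right_mono mult_left_mono) auto
        also have "\<dots> = C * K * (1 + \<delta>) * (f x * L)" by simp
        also have "\<dots> \<le> C' * (f x * L)" using C'(1) fx elim by (intro mult_right_mono) auto
        finally show ?thesis using True by simp
      next
        case False
        have "0 \<le> mu * L" using mu_nonneg elim by simp
        then have wn: "c * x \<le> w + mu * n" using w by (simp add: algebra_simps)
        have "local_prob {1..n} w \<le> C' * f x * real n powr q"
        proof (cases "real n \<le> w")
          case True
          have "w + mu * n \<le> w + mu * w" using True mu_nonneg by (intro add_left_mono mult_left_mono) auto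
          then have "c * x \<le> (1 + mu) * w" using wn by (simp add: algebra_simps)
          moreover have "d * (1 + mu) * x \<le> c * x" unfolding d(2) using c big by (intro mult_right_mono) auto
          ultimately have "(d * x) * (1 + mu) \<le> w * (1 + mu)" by (simp only: mult_ac)
          then have "d * x \<le> w" by (rule mult_right_le_imp_le) (use mu_nonneg in simp)
          moreover have "\<gamma>' * real n \<le> 1 * real n" using \<gamma>' by (intro mult_right_mono) auto
          ultimately have "local_prob {1..n} w \<le> C * K * n * f x" using True by (intro via) auto
          also have "\<dots> \<le> C' * n powr q * f x"
            using C'(2,4) C K(1) fx le_powr_q[of n] by (intro mult_right_mono mult_mono) auto
          finally show ?thesis by (simp add: mult_ac)
        next
          case False
          then have "c * x \<le> real n + mu * n" using wn by linarith
          then have "c * x \<le> (1 + mu) * n" by (simp add: algebra_simps)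
          moreover have "d * (1 + mu) * x \<le> c * x" unfolding d(2) using c big by (intro mult_right_mono) auto
          ultimately have "(d * x) * (1 + mu) \<le> n * (1 + mu)" by (simp only: mult_ac)
          then have dn: "d * x \<le> n" by (rule mult_right_le_imp_le) (use mu_nonneg in simp)
          have "(d * x) powr q \<le> real n powr q" using dn d big q_pos by (intro powr_mono2) auto
          then have "x powr q \<le> real n powr q / d powr q"
            using d big by (simp add: powr_mult field_simps)
          moreover have "c0 \<le> f x * x powr q"
            using x2[OF big(3)] big by (simp add: powr_minus_divide field_simps)
          ultimately have "c0 \<le> f x * (real n powr q / d powr q)"
            using fx by (meson mult_left_mono order_trans)
          then have "1 \<le> 1 / (c0 * d powr q) * (f x * real n powr q)"
            using c0_pos d by (simp add: field_simps)
          also have "\<dots> \<le> C' * (f x * real n powr q)" using C'(3) fx by (intro mult_right_mono) auto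
          finally show ?thesis using local_prob_le_1[of "{1..n}" w] by (simp add: mult_ac)
        qed
        then show ?thesis using False by simp
      qed
    qed
  qed
  then show ?thesis using that[OF \<delta>(1) C'(4)] by blast
qed

text \<open>Replaces a length \<open>n\<close> and an argument \<open>w\<close> by nearby
  \<open>L\<close> and \<open>x\<close>. A neighbourhood of \<open>w\<close> of relative size
  \<open>eps / 4\<close> stays, after a shift by \<open>eps / 8 * x\<close>, inside that of
  \<open>x\<close> of size \<open>eps\<close>. The slope \<open>\<gamma> / 4\<close> comes from
  \<open>n \<le> 2 * L\<close> and \<open>x / 2 \<le> w\<close>.\<close>

lemma local_prob_shifted:
  fixes \<gamma> eps :: real
  assumes \<gamma>: "0 < \<gamma>" and eps: "0 < eps" "eps < 1"
  shows local_prob_shifted_upper: "\<forall>\<^sub>F L in at_top. \<forall>x\<ge>\<gamma> * L. \<forall>n w s. \<bar>real n - L\<bar> \<le> eps / 8 * L \<longrightarrow>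
       \<bar>w - x\<bar> \<le> eps / 8 * x \<longrightarrow> (\<forall>z. \<bar>z - x\<bar> \<le> eps * x \<longrightarrow> f z \<le> s) \<longrightarrow>
       local_prob {1..n} w \<le> (1 + eps / 2) * L * s"
    and local_prob_shifted_lower: "\<forall>\<^sub>F L in at_top. \<forall>x\<ge>\<gamma> * L. \<forall>n w s. \<bar>real n - L\<bar> \<le> eps / 8 * L \<longrightarrow>
       \<bar>w - x\<bar> \<le> eps / 8 * x \<longrightarrow> 0 \<le> s \<longrightarrow> (\<forall>z. \<bar>z - x\<bar> \<le> eps * x \<longrightarrow> s \<le> f z) \<longrightarrow>
       (1 - eps / 2) * L * s - eps * L * f x \<le> local_prob {1..n} w"
proof -
  have geom: "\<gamma> / 4 * n \<le> w" "1/2 * x \<le> w" "0 \<le> x"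
    "\<And>z eps'. eps' \<le> eps / 4 \<Longrightarrow> \<bar>z - w\<bar> \<le> eps' * w \<Longrightarrow> \<bar>z - x\<bar> \<le> eps * x"
    "1/2 * L \<le> n" "real n \<le> (1 + eps / 8) * L" "(1 - eps / 8) * L \<le> real n"
    if L: "0 < L" and x: "\<gamma> * L \<le> x" and n: "\<bar>real n - L\<bar> \<le> eps / 8 * L" and w: "\<bar>w - x\<bar> \<le> eps / 8 * x"
    for L x w :: real and n :: nat
  proof -
    have "0 < \<gamma> * L" using \<gamma> L by simp
    then show x0: "0 \<le> x" using x by linarith
    have ex: "eps * x \<le> 1 * x" using x0 eps by (intro mult_right_mono) auto
    have eL: "eps * L \<le> 1 * L" using L eps by (intro mult_right_mono) auto
    have wl: "x - eps / 8 * x \<le> w" "w \<le> x + eps / 8 * x" using w by linarith+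
    have nl: "L - eps / 8 * L \<le> n" "n \<le> L + eps / 8 * L" using n by linarith+
    show w2: "1/2 * x \<le> w" using wl ex x0 by linarith
    show "1/2 * L \<le> n" using nl eL L by linarith
    show "real n \<le> (1 + eps / 8) * L" "(1 - eps / 8) * L \<le> real n" using nl by (simp_all add: algebra_simps)
    have "real n \<le> 2 * L" using nl eL L by linarith
    then have "\<gamma> / 4 * n \<le> \<gamma> / 4 * (2 * L)" using \<gamma> by (intro mult_left_mono) auto
    then show "\<gamma> / 4 * n \<le> w" using x w2 by linarith
    fix z eps' assume e': "eps' \<le> eps / 4" and z: "\<bar>z - w\<bar> \<le> eps' * w"
    have "w \<le> 2 * x" using wl ex x0 by linarith
    then have "eps / 4 * w \<le> eps / 4 * (2 * x)" using eps by (intro mult_left_mono) auto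
    moreover have "eps' * w \<le> eps / 4 * w" using e' w2 x0 by (intro mult_right_mono) auto
    ultimately have "\<bar>z - w\<bar> \<le> eps / 2 * x" using z by simp
    moreover have "\<bar>z - x\<bar> \<le> \<bar>z - w\<bar> + \<bar>w - x\<bar>" by linarith
    moreover have "0 \<le> eps * x" using eps x0 by simp
    ultimately show "\<bar>z - x\<bar> \<le> eps * x" using w by simp
  qed
  have cn: "finite {1..n}" "{1..n} \<subseteq> {1..}" "card {1..n} = n" for n :: nat by auto
  show "\<forall>\<^sub>F L in at_top. \<forall>x\<ge>\<gamma> * L. \<forall>n w s. \<bar>real n - L\<bar> \<le> eps / 8 * L \<longrightarrow>
       \<bar>w - x\<bar> \<le> eps / 8 * x \<longrightarrow> (\<forall>z. \<bar>z - x\<bar> \<le> eps * x \<longrightarrow> f z \<le> s) \<longrightarrow>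
       local_prob {1..n} w \<le> (1 + eps / 2) * L * s"
  proof -
    obtain n0 where n0: "\<And>J x s. finite J \<Longrightarrow> J \<subseteq> {1..} \<Longrightarrow> n0 \<le> card J \<Longrightarrow> \<gamma> / 4 * card J \<le> x \<Longrightarrow>
      (\<And>z. \<bar>z - x\<bar> \<le> eps / 4 * x \<Longrightarrow> f z \<le> s) \<Longrightarrow> local_prob J x \<le> card J * (s + eps / 4 * f x)"
      using local_prob_asymp_upper[of "\<gamma> / 4" "eps / 4"] \<gamma> eps by (metis divide_pos_pos zero_less_numeral)
    show ?thesis
      using eventually_ge_at_top[of "2 * real n0"] eventually_gt_at_top[of 0]
    proof eventually_elim
      case (elim L)
      show ?case
      proof (intro allI impI)
        fix x n w s assume x: "\<gamma> * L \<le> x" and n: "\<bar>real n - L\<bar> \<le> eps / 8 * L" and w: "\<bar>w - x\<bar> \<le> eps / 8 * x"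
          and s: "\<forall>z. \<bar>z - x\<bar> \<le> eps * x \<longrightarrow> f z \<le> s"
        note g = geom[OF elim(2) x n w]
        have fw: "f w \<le> s"
        proof (rule s[rule_format])
          have "eps / 8 * x \<le> eps * x" using eps g(3) by simp
          then show "\<bar>w - x\<bar> \<le> eps * x" using w by linarith
        qed
        then have s0: "0 \<le> s" using F_Delta_nonneg[of F T w] by linarith
        have "n0 \<le> n" using g(5) elim(1) by linarith
        then have "local_prob {1..n} w \<le> real n * (s + eps / 4 * f w)"
          using n0[of "{1..n}" w s, unfolded cn(3), OF cn(1,2) _ g(1)] g(4)[of "eps / 4"] s by blast
        also have "\<dots> \<le> ((1 + eps / 8) * L) * (s + eps / 4 * s)"
          using g(6) fw s0 eps elim F_Delta_nonneg[of F T w] by (intro mult_mono add_mono mult_left_mono) auto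
        also have "\<dots> = ((1 + eps / 8) * (1 + eps / 4)) * (L * s)" by (simp add: algebra_simps)
        also have "\<dots> \<le> (1 + eps / 2) * (L * s)"
        proof (rule mult_right_mono)
          have "eps * eps \<le> 1 * eps" using eps by (intro mult_right_mono) auto
          moreover have "(1 + eps / 8) * (1 + eps / 4) = 1 + 3 / 8 * eps + eps * eps / 32"
            by (simp add: field_simps)
          ultimately show "(1 + eps / 8) * (1 + eps / 4) \<le> 1 + eps / 2" using eps by linarith
        qed (use elim s0 in auto)
        finally show "local_prob {1..n} w \<le> (1 + eps / 2) * L * s" by (simp add: mult.assoc)
      qed
    qed
  qed
  show "\<forall>\<^sub>F L in at_top. \<forall>x\<ge>\<gamma> * L. \<forall>n w s. \<bar>real n - L\<bar> \<le> eps / 8 * L \<longrightarrow>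
       \<bar>w - x\<bar> \<le> eps / 8 * x \<longrightarrow> 0 \<le> s \<longrightarrow> (\<forall>z. \<bar>z - x\<bar> \<le> eps * x \<longrightarrow> s \<le> f z) \<longrightarrow>
       (1 - eps / 2) * L * s - eps * L * f x \<le> local_prob {1..n} w"
  proof -
    obtain K where K: "0 < K" "\<forall>\<^sub>F x in at_top. \<forall>u\<ge>1/2 * x. f u \<le> K * f x"
      using dominated_variation[OF ad lr, of "1/2"] by auto
    obtain x1 where x1: "\<And>x u. x1 \<le> x \<Longrightarrow> 1/2 * x \<le> u \<Longrightarrow> f u \<le> K * f x"
      using K(2) unfolding eventually_at_top_linorder by blast
    \<comment> \<open>The error of the lower bound is \<open>eps' * f w\<close> and has to be
      expressed by \<open>f x\<close>: dominated variation costs \<open>K\<close>, and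
      \<open>n \<le> 2 * L\<close> costs the factor 2. On the upper side \<open>f w \<le> s\<close>
      takes this role.\<close>
    define eps' where "eps' = min (eps / 4) (eps / (2 * K))"
    have eps': "0 < eps'" "eps' < 1" "eps' \<le> eps / 4" "2 * (eps' * K) \<le> eps"
    proof -
      have "eps' \<le> eps / (2 * K)" by (simp add: eps'_def)
      then show "2 * (eps' * K) \<le> eps" using K by (simp add: field_simps)
    qed (use eps K in \<open>auto simp: eps'_def min_less_iff_disj\<close>)
    obtain n0 where n0: "\<And>J x s. finite J \<Longrightarrow> J \<subseteq> {1..} \<Longrightarrow> n0 \<le> card J \<Longrightarrow> \<gamma> / 4 * card J \<le> x \<Longrightarrow>
      0 \<le> s \<Longrightarrow> (\<And>z. \<bar>z - x\<bar> \<le> eps' * x \<Longrightarrow> s \<le> f z) \<Longrightarrow> card J * (s - eps' * f x) \<le> local_prob J x"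
      using local_prob_asymp_lower[of "\<gamma> / 4" eps'] \<gamma> eps' by (metis divide_pos_pos zero_less_numeral)
    show ?thesis
      using eventually_ge_at_top[of "2 * real n0"] eventually_ge_at_top[of "x1 / \<gamma>"] eventually_gt_at_top[of 0]
    proof eventually_elim
      case (elim L)
      show ?case
      proof (intro allI impI)
        fix x n w s assume x: "\<gamma> * L \<le> x" and n: "\<bar>real n - L\<bar> \<le> eps / 8 * L" and w: "\<bar>w - x\<bar> \<le> eps / 8 * x"
          and s0: "0 \<le> s" and s: "\<forall>z. \<bar>z - x\<bar> \<le> eps * x \<longrightarrow> s \<le> f z"
        note g = geom[OF elim(3) x n w]
        have "x1 \<le> \<gamma> * L" using elim(2) \<gamma> by (simp add: field_simps)
        then have fw: "f w \<le> K * f x" using x g(2) by (intro x1) auto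
        have "n0 \<le> n" using g(5) elim(1) by linarith
        then have low: "real n * (s - eps' * f w) \<le> local_prob {1..n} w"
          using n0[of "{1..n}" w s, unfolded cn(3), OF cn(1,2) _ g(1) s0] g(4)[OF eps'(3)] s by blast
        have "(1 - eps / 8) * L * s \<le> real n * s" using g(7) s0 by (rule mult_right_mono)
        moreover have "(1 - eps / 2) * (L * s) \<le> (1 - eps / 8) * (L * s)"
          using elim s0 eps by (intro mult_right_mono) auto
        moreover have "real n * (eps' * f w) \<le> (2 * L) * (eps' * (K * f x))"
        proof (intro mult_mono mult_left_mono)
          have "eps * L \<le> 1 * L" using elim eps by (intro mult_right_mono) auto
          then show "real n \<le> 2 * L" using g(6) elim(3) unfolding distrib_right by linarith
        qed (use fw eps' elim in \<open>auto simp: F_Delta_nonneg\<close>)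
        moreover have "2 * (eps' * K) * (L * f x) \<le> eps * (L * f x)"
          using eps'(4) elim by (intro mult_right_mono) (auto simp: F_Delta_nonneg)
        ultimately show "(1 - eps / 2) * L * s - eps * L * f x \<le> local_prob {1..n} w"
          using low by (simp add: algebra_simps)
      qed
    qed
  qed
qed

end

section \<open>The surplus process\<close>

lemma generated_sigma_sets:
  assumes "i \<in> I" "A \<in> sets B"
  shows "Z i -` A \<inter> space M \<in> generated_sigma M B I Z"
  unfolding generated_sigma_def using assms by (intro sigma_sets.Basic) blast

lemma measurable_restrict_generated_sigma:
  assumes "\<And>i. i \<in> I \<Longrightarrow> Z i \<in> measurable M B"
  shows "(\<lambda>\<omega>. restrict (\<lambda>i. Z i \<omega>) I) \<in>
    measurable (sigma (space M) (generated_sigma M B I Z)) (PiM I (\<lambda>_. B))"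
proof (rule measurable_restrict)
  fix i assume i: "i \<in> I"
  show "Z i \<in> measurable (sigma (space M) (generated_sigma M B I Z)) B"
  proof (rule measurableI)
    have "generated_sigma M B I Z \<subseteq> Pow (space M)"
      unfolding generated_sigma_def by (intro subsetI PowI sigma_sets_into_sp[rotated]) auto
    then have "sets (sigma (space M) (generated_sigma M B I Z)) = sigma_sets (space M) (generated_sigma M B I Z)"
      by (simp add: sets_measure_of)
    then show "Z i -` A \<inter> space (sigma (space M) (generated_sigma M B I Z)) \<in> sets (sigma (space M) (generated_sigma M B I Z))"
      if "A \<in> sets B" for A
      using generated_sigma_sets[OF i that, of Z M] by (auto simp: space_measure_of_conv)
  qed (use assms[OF i, THEN measurable_space] in \<open>auto simp: space_measure_of_conv\<close>)
qed

lemma Int_stable_generated_sigma: "Int_stable (generated_sigma M B I Z)"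
proof -
  have "{Z i -` A \<inter> space M | i A. i \<in> I \<and> A \<in> sets B} \<subseteq> Pow (space M)" by auto
  then interpret sigma_algebra "space M" "generated_sigma M B I Z"
    unfolding generated_sigma_def by (rule sigma_algebra_sigma_sets)
  show ?thesis by (auto simp: Int_stable_def)
qed

locale risk_model = local_claims +
  fixes N :: "real \<Rightarrow> 'a \<Rightarrow> nat" and Y :: "real \<Rightarrow> 'a \<Rightarrow> real" and lam b :: "real \<Rightarrow> real"
    and nu p :: real
  assumes cp: "counting_process M N"
    and N_int: "\<And>t. 0 \<le> t \<Longrightarrow> integrable M (\<lambda>\<omega>. real (N t \<omega>))"
    and lam_eq: "\<And>t. 0 \<le> t \<Longrightarrow> lam t = (\<integral>\<omega>. real (N t \<omega>) \<partial>M)"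
    and lam_top: "filterlim lam at_top at_top"
    and nnp: "nonneg_nondecreasing_process M Y"
    and Y_int: "\<And>t. 0 \<le> t \<Longrightarrow> integrable M (Y t)"
    and b_eq: "\<And>t. 0 \<le> t \<Longrightarrow> b t = (\<integral>\<omega>. Y t \<omega> \<partial>M)"
    and b_top: "filterlim b at_top at_top"
    and ind3: "indep_sets
           (\<lambda>i. [generated_sigma M borel {0..} Y,
                  generated_sigma M (count_space UNIV) {0..} N,
                  generated_sigma M borel {1..} X] ! i) {..<3}"
    and nu_pos: "0 < nu"
    and limsup_nu: "Limsup at_top (\<lambda>t. ereal (b t / lam t)) = ereal nu"
    and Y_lim: "tendsto_in_prob M (\<lambda>t \<omega>. Y t \<omega> / b t) 1"
    and q_less_p: "q < p"
    and tail_int: "\<And>\<delta>. 0 < \<delta> \<Longrightarrow> (\<forall>\<^sub>F t in at_top. integrable M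
           (\<lambda>\<omega>. real (N t \<omega>) powr p * indicator {\<omega>'. real (N t \<omega>') > (1 + \<delta>) * lam t} \<omega>))"
    and tail_O: "\<And>\<delta>. 0 < \<delta> \<Longrightarrow>
           (\<lambda>t. \<integral>\<omega>. real (N t \<omega>) powr p * indicator {\<omega>'. real (N t \<omega>') > (1 + \<delta>) * lam t} \<omega> \<partial>M)
             \<in> O[at_top](lam)"
begin

lemma N_measurable [measurable]: "0 \<le> t \<Longrightarrow> N t \<in> measurable M (count_space UNIV)"
  using cp by (simp add: counting_process_def)

lemma Y_measurable [measurable]: "0 \<le> t \<Longrightarrow> Y t \<in> borel_measurable M"
  using nnp by (simp add: nonneg_nondecreasing_process_def)

lemma Y_nonneg: "0 \<le> t \<Longrightarrow> AE \<omega> in M. 0 \<le> Y t \<omega>"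
  using nnp by (auto simp: nonneg_nondecreasing_process_def elim!: eventually_mono)

abbreviation "claims \<equiv> (\<lambda>\<omega>. restrict (\<lambda>i. X i \<omega>) {1..})"

abbreviation "RX \<equiv> PiM {1..} (\<lambda>_. borel) :: (nat \<Rightarrow> real) measure"

abbreviation "RNY \<equiv> count_space UNIV \<Otimes>\<^sub>M borel :: (nat \<times> real) measure"

lemma sum_claims: "(\<Sum>i=1..n. h (claims \<omega> i)) = (\<Sum>i=1..n. h (X i \<omega>))"
  by (rule sum.cong) auto

lemma claims_measurable [measurable]: "claims \<in> M \<rightarrow>\<^sub>M RX"
  by (intro measurable_restrict) auto

lemma NY_measurable [measurable]: "0 \<le> t \<Longrightarrow> (\<lambda>\<omega>. (N t \<omega>, Y t \<omega>)) \<in> M \<rightarrow>\<^sub>M RNY"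
  by measurable

text \<open>Regrouping the three independent sigma-algebras makes the whole claim sequence
  independent of the pair \<open>(N t, Y t)\<close>, so both components can be conditioned on at
  once.\<close>

lemma claims_indep_NY:
  assumes t: "0 \<le> t" and A: "A \<in> sets RX" and B: "B \<in> sets RNY"
  shows "prob ((\<lambda>\<omega>. (claims \<omega>, (N t \<omega>, Y t \<omega>))) -` (A \<times> B) \<inter> space M) =
    prob (claims -` A \<inter> space M) * prob ((\<lambda>\<omega>. (N t \<omega>, Y t \<omega>)) -` B \<inter> space M)"
proof -
  define G where "G i = [generated_sigma M borel {0..} Y,
      generated_sigma M (count_space UNIV) {0..} N, generated_sigma M borel {1..} X] ! i" for i
  \<comment> \<open>Indexed by booleans to match \<open>indep_set\<close>: \<open>True\<close>
    selects the claims, \<open>False\<close> premium and claim number.\<close>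
  define Ix where "Ix j = (if j then {2} else {0, 1::nat})" for j
  have G: "G 0 = generated_sigma M borel {0..} Y" "G 1 = generated_sigma M (count_space UNIV) {0..} N"
      "G 2 = generated_sigma M borel {1..} X"
    by (simp_all add: G_def)
  have "indep_sets (\<lambda>j. sigma_sets (space M) (\<Union>i\<in>Ix j. G i)) UNIV"
  proof (rule indep_sets_collect_sigma)
    have "(\<Union>j. Ix j) = {..<3}" by (auto simp: Ix_def UNIV_bool)
    then show "indep_sets G (\<Union>j. Ix j)" using ind3 by (simp only: G_def[abs_def])
    show "Int_stable (G i)" if "i \<in> Ix j" for i j
      using that by (auto simp: Ix_def G Int_stable_generated_sigma split: if_splits simp flip: One_nat_def)
    show "disjoint_family_on Ix UNIV" by (auto simp: disjoint_family_on_def Ix_def)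
  qed
  then have "indep_set (sigma_sets (space M) (G 2)) (sigma_sets (space M) (G 0 \<union> G 1))"
    unfolding indep_set_def by (rule indep_sets_mono_sets) (auto simp: Ix_def split: bool.splits)
  moreover have sub: "G i \<subseteq> Pow (space M)" if "i \<in> {0, 1, 2}" for i
    using that unfolding G_def generated_sigma_def
    by (auto simp: less_Suc_eq numeral_2_eq_2 dest!: sigma_sets_into_sp[rotated])
  moreover have "claims -` A \<inter> space M \<in> sigma_sets (space M) (G 2)"
  proof -
    have "claims \<in> measurable (sigma (space M) (generated_sigma M borel {1..} X)) RX"
      by (rule measurable_restrict_generated_sigma) auto
    from measurable_sets[OF this A] show ?thesis
      using sub[of 2] by (simp add: G sets_measure_of space_measure_of_conv)
  qed
  moreover have "(\<lambda>\<omega>. (N t \<omega>, Y t \<omega>)) -` B \<inter> space M \<in> sigma_sets (space M) (G 0 \<union> G 1)"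
  proof -
    let ?S = "sigma (space M) (G 0 \<union> G 1)"
    have S: "sets ?S = sigma_sets (space M) (G 0 \<union> G 1)" "space ?S = space M"
      using sub[of 0] sub[of 1] by (auto simp: sets_measure_of space_measure_of_conv)
    have "N t \<in> measurable ?S (count_space UNIV)"
    proof (rule measurableI)
      fix C :: "nat set" assume "C \<in> sets (count_space UNIV)"
      then have "N t -` C \<inter> space M \<in> G 1" unfolding G using t by (intro generated_sigma_sets) auto
      then show "N t -` C \<inter> space ?S \<in> sets ?S" unfolding S by (intro sigma_sets.Basic) auto
    qed simp
    moreover have "Y t \<in> measurable ?S borel"
    proof (rule measurableI)
      fix C :: "real set" assume "C \<in> sets borel"
      then have "Y t -` C \<inter> space M \<in> G 0" unfolding G using t by (intro generated_sigma_sets) auto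
      then show "Y t -` C \<inter> space ?S \<in> sets ?S" unfolding S by (intro sigma_sets.Basic) auto
    qed simp
    ultimately have "(\<lambda>\<omega>. (N t \<omega>, Y t \<omega>)) \<in> measurable ?S RNY" by measurable
    from measurable_sets[OF this B] show ?thesis unfolding S .
  qed
  ultimately have "prob ((claims -` A \<inter> space M) \<inter> ((\<lambda>\<omega>. (N t \<omega>, Y t \<omega>)) -` B \<inter> space M)) =
    prob (claims -` A \<inter> space M) * prob ((\<lambda>\<omega>. (N t \<omega>, Y t \<omega>)) -` B \<inter> space M)"
    by (intro indep_setD)
  also have "(claims -` A \<inter> space M) \<inter> ((\<lambda>\<omega>. (N t \<omega>, Y t \<omega>)) -` B \<inter> space M) =
      (\<lambda>\<omega>. (claims \<omega>, (N t \<omega>, Y t \<omega>))) -` (A \<times> B) \<inter> space M" by auto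
  finally show ?thesis .
qed

section \<open>Mean and distribution of the surplus\<close>

lemma random_sum_measurable:
  fixes h :: "real \<Rightarrow> 'b::{second_countable_topology, topological_comm_monoid_add}"
  assumes [measurable]: "h \<in> borel_measurable borel"
  shows "(\<lambda>z. \<Sum>i=1..fst (snd z). h (fst z i)) \<in> borel_measurable (RX \<Otimes>\<^sub>M RNY)"
proof (rule measurable_compose_countable[where f="\<lambda>n z. \<Sum>i=1..n. h (fst z i)"])
  show "(\<lambda>z. \<Sum>i=1..n. h (fst z i)) \<in> borel_measurable (RX \<Otimes>\<^sub>M RNY)" for n
  proof (rule borel_measurable_sum)
    fix i assume i: "i \<in> {1..n}"
    have "(\<lambda>u. u i) \<in> borel_measurable RX" using i by (intro measurable_component_singleton) auto
    then show "(\<lambda>z. h (fst z i)) \<in> borel_measurable (RX \<Otimes>\<^sub>M RNY)" by measurable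
  qed
qed measurable

text \<open>Wald's identity. Computing with nonnegative extended integrals yields integrability and
  the value together.\<close>

lemma random_sum_expectation:
  assumes t: "0 \<le> t"
  shows "integrable M (\<lambda>\<omega>. \<Sum>i=1..N t \<omega>. X i \<omega>)" "(\<integral>\<omega>. (\<Sum>i=1..N t \<omega>. X i \<omega>) \<partial>M) = mu * lam t"
proof -
  let ?S = "\<lambda>\<omega>. \<Sum>i=1..N t \<omega>. X i \<omega>"
  have mS[measurable]: "?S \<in> borel_measurable M"
    using measurable_compose[OF measurable_Pair[OF claims_measurable NY_measurable[OF t]]
        random_sum_measurable[of "\<lambda>x. x", OF measurable_ident_sets[OF refl]]]
    unfolding fst_conv snd_conv
    by (simp only: sum_claims[where h="\<lambda>x. x"] measurable_ident)
  have AE_all: "AE \<omega> in M. \<forall>i\<in>{1..}. 0 \<le> X i \<omega>"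
    by (subst AE_ball_countable) (use X_nonneg in auto)
  then have nn: "AE \<omega> in M. 0 \<le> ?S \<omega>"
    by eventually_elim (auto intro!: sum_nonneg)
  have EX: "(\<integral>\<^sup>+\<omega>. ennreal (X i \<omega>) \<partial>M) = ennreal mu" if "1 \<le> i" for i
  proof -
    have "integrable M (X i)"
      using integrable_F integrable_distr[of "X i" M borel "\<lambda>x. x"] that
      by (simp only: distr_X X_measurable)
    moreover have "(\<integral>\<omega>. X i \<omega> \<partial>M) = mu"
      unfolding mu_eq distr_X[OF that, symmetric] using that by (simp add: integral_distr)
    ultimately show ?thesis using nn_integral_eq_integral[OF _ X_nonneg[OF that]] by simp
  qed
  have "(\<integral>\<^sup>+\<omega>. ennreal (?S \<omega>) \<partial>M) = (\<integral>\<^sup>+\<omega>. (\<Sum>i=1..N t \<omega>. ennreal (claims \<omega> i)) \<partial>M)"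
    unfolding sum_claims using AE_all by (intro nn_integral_cong_AE, eventually_elim) (subst sum_ennreal, auto)
  also have "\<dots> = (\<integral>\<^sup>+\<omega>. \<integral>\<^sup>+\<omega>'. (\<Sum>i=1..N t \<omega>. ennreal (claims \<omega>' i)) \<partial>M \<partial>M)"
  proof -
    let ?g = "\<lambda>z. \<Sum>i=1..fst (snd z). ennreal (fst z i)"
    have gm: "?g \<in> borel_measurable (RX \<Otimes>\<^sub>M RNY)" by (rule random_sum_measurable) simp
    have "(\<integral>\<^sup>+\<omega>. ?g (claims \<omega>, (N t \<omega>, Y t \<omega>)) \<partial>M) =
        (\<integral>\<^sup>+\<omega>. \<integral>\<^sup>+\<omega>'. ?g (claims \<omega>', (N t \<omega>, Y t \<omega>)) \<partial>M \<partial>M)"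
      by (rule indep_rv_nn_integral[OF claims_measurable NY_measurable[OF t] claims_indep_NY[OF t] gm])
    then show ?thesis by (simp only: fst_conv snd_conv)
  qed
  also have "\<dots> = (\<integral>\<^sup>+\<omega>. ennreal (mu * real (N t \<omega>)) \<partial>M)"
  proof (rule nn_integral_cong)
    fix \<omega>
    have "(\<integral>\<^sup>+\<omega>'. (\<Sum>i=1..N t \<omega>. ennreal (claims \<omega>' i)) \<partial>M) = (\<Sum>i=1..N t \<omega>. \<integral>\<^sup>+\<omega>'. ennreal (X i \<omega>') \<partial>M)"
      unfolding sum_claims by (intro nn_integral_sum) auto
    also have "\<dots> = of_nat (N t \<omega>) * ennreal mu" by (simp add: EX)
    also have "\<dots> = ennreal (mu * real (N t \<omega>))"
      using mu_nonneg by (simp add: ennreal_mult mult.commute flip: ennreal_of_nat_eq_real_of_nat)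
    finally show "(\<integral>\<^sup>+\<omega>'. (\<Sum>i=1..N t \<omega>. ennreal (claims \<omega>' i)) \<partial>M) = ennreal (mu * real (N t \<omega>))" .
  qed
  also have "\<dots> = ennreal (mu * lam t)"
    unfolding lam_eq[OF t] using N_int[OF t] mu_nonneg by (subst nn_integral_eq_integral) auto
  finally have fin: "(\<integral>\<^sup>+\<omega>. ennreal (?S \<omega>) \<partial>M) = ennreal (mu * lam t)" .
  show int: "integrable M ?S" by (rule integrableI_nn_integral_finite[OF mS nn fin])
  have "0 \<le> mu * lam t" unfolding lam_eq[OF t] using mu_nonneg by simp
  then show "(\<integral>\<omega>. ?S \<omega> \<partial>M) = mu * lam t"
    using fin nn mS by (simp add: integral_eq_nn_integral)
qed

text \<open>The surplus has mean \<open>mu * lam t - b t\<close>. Recentering the sum of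
  \<open>N t\<close> claims by \<open>mu * N t\<close> moves the remaining terms into the argument
  of \<open>local_prob\<close>.\<close>

lemma surplus_prob_eq:
  assumes t: "0 \<le> t"
  shows "integrable M (\<lambda>\<omega>. local_prob {1..N t \<omega>} (x + mu * (lam t - N t \<omega>) + Y t \<omega> - b t))"
    and "centered_surplus_prob M (claim_surplus N Y X) T t x =
      (\<integral>\<omega>. local_prob {1..N t \<omega>} (x + mu * (lam t - N t \<omega>) + Y t \<omega> - b t) \<partial>M)"
proof -
  let ?c = "mu * lam t - b t + x"
  define P where "P u w \<longleftrightarrow> (\<Sum>i=1..fst w. u i) - snd w - ?c \<in> Delta T" for u :: "nat \<Rightarrow> real" and w :: "nat \<times> real"
  have [measurable]: "(\<lambda>z. \<Sum>i=1..fst (snd z). fst z i) \<in> borel_measurable (RX \<Otimes>\<^sub>M RNY)"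
    using random_sum_measurable[of "\<lambda>x. x"] by simp
  have Pm: "Measurable.pred (RX \<Otimes>\<^sub>M RNY) (\<lambda>z. P (fst z) (snd z))"
    unfolding P_def by measurable
  have eq: "prob {\<omega>\<in>space M. P (claims \<omega>) (N t \<omega>, Y t \<omega>)} =
      (\<integral>\<omega>. prob {\<omega>'\<in>space M. P (claims \<omega>') (N t \<omega>, Y t \<omega>)} \<partial>M)"
    by (rule indep_rv_prob_eq[OF claims_measurable NY_measurable[OF t] claims_indep_NY[OF t] Pm])
  have int: "integrable M (\<lambda>\<omega>. prob {\<omega>'\<in>space M. P (claims \<omega>') (N t \<omega>, Y t \<omega>)})"
    by (rule indep_rv_prob_eq_integrable[OF claims_measurable NY_measurable[OF t] claims_indep_NY[OF t] Pm])
  have inner: "prob {\<omega>'\<in>space M. P (claims \<omega>') (N t \<omega>, Y t \<omega>)} =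
     local_prob {1..N t \<omega>} (x + mu * (lam t - N t \<omega>) + Y t \<omega> - b t)" for \<omega>
    unfolding P_def local_prob_def fst_conv snd_conv sum_claims[where h="\<lambda>x. x"]
    by (intro arg_cong[where f=prob]) (simp add: algebra_simps)
  show "integrable M (\<lambda>\<omega>. local_prob {1..N t \<omega>} (x + mu * (lam t - N t \<omega>) + Y t \<omega> - b t))"
    using int unfolding inner .
  have ES: "(\<integral>\<omega>. claim_surplus N Y X t \<omega> \<partial>M) = mu * lam t - b t"
    unfolding claim_surplus_def using random_sum_expectation[OF t] Y_int[OF t] b_eq[OF t] by simp
  have cs: "centered_surplus_prob M (claim_surplus N Y X) T t x = prob {\<omega>\<in>space M. P (claims \<omega>) (N t \<omega>, Y t \<omega>)}"
    unfolding centered_surplus_prob_def mem_translate_Delta_iff ES P_def claim_surplus_def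
      fst_conv snd_conv sum_claims[where h="\<lambda>x. x"]
    by (intro arg_cong[where f=prob]) (simp add: algebra_simps)
  show "centered_surplus_prob M (claim_surplus N Y X) T t x =
      (\<integral>\<omega>. local_prob {1..N t \<omega>} (x + mu * (lam t - N t \<omega>) + Y t \<omega> - b t) \<partial>M)"
    unfolding cs eq inner ..
qed

section \<open>Concentration of claim number and premium\<close>

text \<open>On the tail event \<open>N t powr (q - p)\<close> is at most
  \<open>((1 + \<delta>) * lam t) powr (q - p)\<close>, which tends to 0; this factor improves on
  the order \<open>lam t\<close> of the \<open>p\<close>-th moment.\<close>

lemma tail_powr_q:
  fixes \<delta> eps :: real
  assumes \<delta>: "0 < \<delta>" and eps: "0 < eps"
  shows "\<forall>\<^sub>F t in at_top.
    integrable M (\<lambda>\<omega>. real (N t \<omega>) powr q * indicator {\<omega>'. real (N t \<omega>') > (1 + \<delta>) * lam t} \<omega>) \<and>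
    (\<integral>\<omega>. real (N t \<omega>) powr q * indicator {\<omega>'. real (N t \<omega>') > (1 + \<delta>) * lam t} \<omega> \<partial>M) \<le> eps * lam t"
proof -
  let ?I = "\<lambda>s t \<omega>. real (N t \<omega>) powr s * indicator {\<omega>'. real (N t \<omega>') > (1 + \<delta>) * lam t} \<omega>"
  obtain C where C: "0 < C" "\<forall>\<^sub>F t in at_top. norm (\<integral>\<omega>. ?I p t \<omega> \<partial>M) \<le> C * norm (lam t)"
    using landau_o.bigE[OF tail_O[OF \<delta>]] by blast
  have "filterlim (\<lambda>t. (1 + \<delta>) * lam t) at_top at_top"
    using \<delta> by (intro filterlim_tendsto_pos_mult_at_top[OF tendsto_const _ lam_top]) auto
  then have "((\<lambda>t. C * ((1 + \<delta>) * lam t) powr (q - p)) \<longlongrightarrow> C * 0) at_top"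
    using q_less_p by (intro tendsto_mult tendsto_const tendsto_neg_powr) auto
  then have "\<forall>\<^sub>F t in at_top. C * ((1 + \<delta>) * lam t) powr (q - p) < eps"
    using eps by (intro order_tendstoD(2)[where y=0]) auto
  then show ?thesis
    using C(2) tail_int[OF \<delta>] eventually_ge_at_top[of 0] lam_top[unfolded filterlim_at_top_dense, rule_format, of 0]
  proof eventually_elim
    case (elim t)
    let ?a = "((1 + \<delta>) * lam t) powr (q - p)"
    have a: "0 < (1 + \<delta>) * lam t" using elim \<delta> by simp
    have le: "?I q t \<omega> \<le> ?a * ?I p t \<omega>" for \<omega>
    proof (cases "real (N t \<omega>) > (1 + \<delta>) * lam t")
      case True
      have "real (N t \<omega>) powr q = real (N t \<omega>) powr (q - p) * real (N t \<omega>) powr p"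
        by (simp flip: powr_add)
      also have "\<dots> \<le> ?a * real (N t \<omega>) powr p"
        using True a q_less_p by (intro mult_right_mono powr_mono2') auto
      finally show ?thesis using True by simp
    qed simp
    have int: "integrable M (?I q t)"
    proof (rule Bochner_Integration.integrable_bound)
      show "integrable M (\<lambda>\<omega>. ?a * ?I p t \<omega>)" using elim(3) by simp
      show "?I q t \<in> borel_measurable M"
        using N_measurable[OF elim(4)] by measurable
      show "AE \<omega> in M. norm (?I q t \<omega>) \<le> norm (?a * ?I p t \<omega>)"
        using le by (intro always_eventually allI) (simp add: abs_mult)
    qed
    have "(\<integral>\<omega>. ?I q t \<omega> \<partial>M) \<le> (\<integral>\<omega>. ?a * ?I p t \<omega> \<partial>M)"
      using elim(3) by (intro integral_mono int le) simp
    also have "\<dots> = ?a * (\<integral>\<omega>. ?I p t \<omega> \<partial>M)" by simp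
    also have "\<dots> \<le> ?a * (C * lam t)" using elim(2,5) by (intro mult_left_mono) auto
    also have "\<dots> = (C * ?a) * lam t" by simp
    also have "\<dots> \<le> eps * lam t" using elim(1,5) by (intro mult_right_mono) auto
    finally show ?case using int by simp
  qed
qed

text \<open>Since the mean of \<open>N t / lam t\<close> is 1, the absolute deviation is twice the positive part,
  which the tail condition controls.\<close>

lemma N_concentration:
  fixes \<delta> eps :: real
  assumes \<delta>: "0 < \<delta>" and eps: "0 < eps"
  shows "\<forall>\<^sub>F t in at_top. prob {\<omega>\<in>space M. \<delta> * lam t < \<bar>real (N t \<omega>) - lam t\<bar>} \<le> eps"
proof -
  \<comment> \<open>Four contributions \<open>\<eta> * lam t\<close> are collected below, and
    Markov's inequality divides by \<open>\<delta> * lam t\<close>.\<close>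
  define \<eta> where "\<eta> = eps * \<delta> / 4"
  have \<eta>: "0 < \<eta>" using \<delta> eps by (simp add: \<eta>_def)
  show ?thesis
    using tail_powr_q[OF \<eta> \<eta>] eventually_ge_at_top[of 0] lam_top[unfolded filterlim_at_top_dense, rule_format, of 0]
  proof eventually_elim
    case (elim t)
    let ?I = "\<lambda>\<omega>. real (N t \<omega>) powr q * indicator {\<omega>'. real (N t \<omega>') > (1 + \<eta>) * lam t} \<omega>"
    have [measurable]: "N t \<in> measurable M (count_space UNIV)" using N_measurable elim(2) .
    let ?A = "{\<omega>\<in>space M. \<delta> * lam t < \<bar>real (N t \<omega>) - lam t\<bar>}"
    have A: "?A \<in> events" by measurable
    note Nint = N_int[OF elim(2)]
    have "prob ?A * (\<delta> * lam t) = (\<integral>\<omega>. indicator ?A \<omega> * (\<delta> * lam t) \<partial>M)" using A by simp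
    also have "\<dots> \<le> (\<integral>\<omega>. 2 * (\<eta> * lam t) + 2 * ?I \<omega> - (real (N t \<omega>) - lam t) \<partial>M)"
    proof (rule integral_mono)
      show "integrable M (\<lambda>\<omega>. indicator ?A \<omega> * (\<delta> * lam t))"
        using A by (intro integrable_mult_left integrable_real_indicator) (auto simp: emeasure_eq_measure)
      show "integrable M (\<lambda>\<omega>. 2 * (\<eta> * lam t) + 2 * ?I \<omega> - (real (N t \<omega>) - lam t))"
        using elim(1) Nint by auto
      show "indicator ?A \<omega> * (\<delta> * lam t) \<le> 2 * (\<eta> * lam t) + 2 * ?I \<omega> - (real (N t \<omega>) - lam t)" for \<omega>
      proof -
        have I: "real (N t \<omega>) - lam t \<le> \<eta> * lam t + ?I \<omega>"
        proof (cases "real (N t \<omega>) > (1 + \<eta>) * lam t")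
          case True
          have "0 < (1 + \<eta>) * lam t" using elim(3) \<eta> by simp
          then show ?thesis using True le_powr_q[of "N t \<omega>"] elim(3) \<eta> by (simp add: add_increasing)
        qed (use elim(3) in \<open>simp add: algebra_simps\<close>)
        have pos: "0 \<le> \<eta> * lam t + ?I \<omega>" using \<eta> elim(3) by (intro add_nonneg_nonneg mult_nonneg_nonneg) auto
        have "indicator ?A \<omega> * (\<delta> * lam t) \<le> \<bar>real (N t \<omega>) - lam t\<bar>"
          by (auto simp: indicator_def)
        also have "\<dots> \<le> 2 * (\<eta> * lam t) + 2 * ?I \<omega> - (real (N t \<omega>) - lam t)"
          using I pos by linarith
        finally show ?thesis .
      qed
    qed
    also have "\<dots> = 2 * (\<eta> * lam t) + 2 * (\<integral>\<omega>. ?I \<omega> \<partial>M)"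
      using elim(1) Nint lam_eq[OF elim(2)] by (simp add: prob_space)
    also have "\<dots> \<le> 4 * (\<eta> * lam t)" using elim(1) by simp
    also have "\<dots> = eps * (\<delta> * lam t)" by (simp add: \<eta>_def)
    finally show ?case using \<delta> elim(3) by simp
  qed
qed

lemma Y_concentration:
  fixes \<delta> eps :: real
  assumes \<delta>: "0 < \<delta>" and eps: "0 < eps"
  shows "\<forall>\<^sub>F t in at_top. prob {\<omega>\<in>space M. \<delta> * b t < \<bar>Y t \<omega> - b t\<bar>} \<le> eps"
proof -
  have "\<forall>\<^sub>F t in at_top. prob {\<omega>\<in>space M. \<bar>Y t \<omega> / b t - 1\<bar> > \<delta>} < eps"
    using Y_lim \<delta> eps unfolding tendsto_in_prob_def by (intro order_tendstoD(2)[where y=0]) auto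
  then show ?thesis using b_top[unfolded filterlim_at_top_dense, rule_format, of 0]
  proof eventually_elim
    case (elim t)
    have "\<delta> < \<bar>y / b t - 1\<bar> \<longleftrightarrow> \<delta> * b t < \<bar>y - b t\<bar>" for y
    proof -
      have "\<bar>y / b t - 1\<bar> = \<bar>y - b t\<bar> / b t"
      proof -
        have "y / b t - 1 = (y - b t) / b t" using elim(2) by (simp add: field_simps)
        then show ?thesis using elim(2) by (simp add: abs_divide)
      qed
      then show ?thesis using elim(2) by (simp add: pos_less_divide_eq)
    qed
    then show ?case using elim(1) by simp
  qed
qed

section \<open>Uniform bounds for the surplus\<close>

text \<open>Conditional bounds are integrated over \<open>N t\<close> and \<open>Y t\<close>. On
  \<open>G\<close> both are near their means and \<open>local_prob_shifted\<close> applies.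
  Elsewhere \<open>local_prob_crude_upper\<close> retains the factor \<open>f x\<close>, and its
  weight, \<open>lam t * prob (space M - G)\<close> plus the tail moment, is a small multiple of
  \<open>lam t\<close>.\<close>

lemma surplus_bounds:
  fixes \<gamma> eps :: real
  assumes \<gamma>: "nu < \<gamma>" and eps: "0 < eps" "eps < 1"
  shows "\<forall>\<^sub>F t in at_top. \<forall>x\<ge>\<gamma> * lam t. \<forall>s.
    ((\<forall>z. \<bar>z - x\<bar> \<le> eps * x \<longrightarrow> f z \<le> s) \<longrightarrow>
      centered_surplus_prob M (claim_surplus N Y X) T t x \<le> (1 + eps) * lam t * s) \<and>
    (0 \<le> s \<longrightarrow> (\<forall>z. \<bar>z - x\<bar> \<le> eps * x \<longrightarrow> s \<le> f z) \<longrightarrow>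
      lam t * ((1 - eps) * s - eps * f x) \<le> centered_surplus_prob M (claim_surplus N Y X) T t x)"
proof -
  have g0: "0 < \<gamma>" using \<gamma> nu_pos by simp
  \<comment> \<open>With the midpoint \<open>\<nu>' = (1 - c) * \<gamma>\<close> one gets
    \<open>b t \<le> (1 - c) * x\<close> eventually, so for \<open>Y t \<ge> 0\<close> the shifted
    argument is at least \<open>c * x + mu * (lam t - N t)\<close>.\<close>
  define c where "c = (\<gamma> - nu) / (2 * \<gamma>)"
  have c: "0 < c" using \<gamma> g0 by (simp add: c_def)
  define \<nu>' where "\<nu>' = (\<gamma> + nu) / 2"
  have \<nu>': "nu < \<nu>'" "\<nu>' < \<gamma>" using \<gamma> by (auto simp: \<nu>'_def)
  have c_eq: "\<nu>' = (1 - c) * \<gamma>" using g0 by (simp add: c_def \<nu>'_def field_simps)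
  \<comment> \<open>On \<open>G\<close> the fluctuations of claim number and premium add up to at
    most \<open>\<delta> * (mu + \<gamma>) * lam t\<close>, which has to stay below
    \<open>eps / 8 * x\<close>.\<close>
  define \<delta> where "\<delta> = min (eps / 8) (eps / 8 * (\<gamma> / (mu + \<gamma>)))"
  have \<delta>: "0 < \<delta>" "\<delta> \<le> eps / 8" "\<delta> * (mu + \<gamma>) \<le> eps / 8 * \<gamma>"
  proof -
    have "0 < mu + \<gamma>" using mu_nonneg g0 by simp
    then show "0 < \<delta>" using eps g0 by (simp add: \<delta>_def)
    show "\<delta> \<le> eps / 8" unfolding \<delta>_def by (rule min.cobounded1)
    have "\<delta> \<le> eps / 8 * (\<gamma> / (mu + \<gamma>))" unfolding \<delta>_def by (rule min.cobounded2)
    then have "\<delta> * (mu + \<gamma>) \<le> eps / 8 * (\<gamma> / (mu + \<gamma>)) * (mu + \<gamma>)"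
      using \<open>0 < mu + \<gamma>\<close> by (intro mult_right_mono) auto
    also have "\<dots> = eps / 8 * (\<gamma> / (mu + \<gamma>) * (mu + \<gamma>))" by (rule mult.assoc)
    also have "\<gamma> / (mu + \<gamma>) * (mu + \<gamma>) = \<gamma>" using \<open>0 < mu + \<gamma>\<close> by simp
    finally show "\<delta> * (mu + \<gamma>) \<le> eps / 8 * \<gamma>" .
  qed
  obtain \<delta>' C where \<delta>': "0 < \<delta>'" and C: "0 < C" and crude: "\<forall>\<^sub>F L in at_top. \<forall>x\<ge>\<gamma> * L. \<forall>n w. c * x + mu * (L - real n) \<le> w \<longrightarrow>
       local_prob {1..n} w \<le> C * f x * (if real n \<le> (1 + \<delta>') * L then L else real n powr q)"
    by (rule local_prob_crude_upper[OF g0 c])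
  \<comment> \<open>In the upper bound, \<open>2 * \<eta>\<close> for the complement of
    \<open>G\<close> and \<open>\<eta>\<close> for the tail give
    \<open>3 * (C * \<eta>) \<le> eps / 2\<close>; the lower bound uses
    \<open>2 * \<eta> \<le> eps / 2\<close>.\<close>
  define \<eta> where "\<eta> = min (eps / 8) (eps / (6 * C))"
  have \<eta>: "0 < \<eta>" "\<eta> \<le> eps / 8" "6 * (C * \<eta>) \<le> eps"
  proof -
    show "0 < \<eta>" using eps C by (simp add: \<eta>_def)
    show "\<eta> \<le> eps / 8" unfolding \<eta>_def by (rule min.cobounded1)
    have "\<eta> \<le> eps / (6 * C)" unfolding \<eta>_def by (rule min.cobounded2)
    then show "6 * (C * \<eta>) \<le> eps" using C by (simp add: field_simps)
  qed
  have "\<forall>\<^sub>F t in at_top. ereal (b t / lam t) < ereal \<nu>'"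
    by (rule Limsup_lessD) (use limsup_nu \<nu>' in simp)
  then show ?thesis
    using eventually_compose_filterlim[OF crude lam_top]
      eventually_compose_filterlim[OF local_prob_shifted_upper[OF g0 eps] lam_top]
      eventually_compose_filterlim[OF local_prob_shifted_lower[OF g0 eps] lam_top]
      N_concentration[OF \<delta>(1) \<eta>(1)] Y_concentration[OF \<delta>(1) \<eta>(1)] tail_powr_q[OF \<delta>' \<eta>(1)]
      eventually_ge_at_top[of 0] lam_top[unfolded filterlim_at_top_dense, rule_format, of 0]
      b_top[unfolded filterlim_at_top_dense, rule_format, of 0]
  proof eventually_elim
    case (elim t)
    note crude = elim(2) and up = elim(3) and low = elim(4) and tail = elim(7)
    have t: "0 \<le> t" and lam: "0 < lam t" and b: "0 < b t" using elim by auto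
    have [measurable]: "N t \<in> measurable M (count_space UNIV)" "Y t \<in> borel_measurable M"
      using N_measurable[OF t] Y_measurable[OF t] by auto
    have b_le: "b t \<le> \<nu>' * lam t" using elim(1) lam by (simp add: field_simps)
    define G where "G = {\<omega>\<in>space M. \<bar>real (N t \<omega>) - lam t\<bar> \<le> \<delta> * lam t \<and> \<bar>Y t \<omega> - b t\<bar> \<le> \<delta> * b t}"
    have G[measurable]: "G \<in> events" unfolding G_def by measurable
    have PG: "prob (space M - G) \<le> 2 * \<eta>"
    proof -
      have "prob (space M - G) \<le> prob ({\<omega>\<in>space M. \<delta> * lam t < \<bar>real (N t \<omega>) - lam t\<bar>} \<union> {\<omega>\<in>space M. \<delta> * b t < \<bar>Y t \<omega> - b t\<bar>})"
        by (intro finite_measure_mono) (auto simp: G_def)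
      also have "\<dots> \<le> prob {\<omega>\<in>space M. \<delta> * lam t < \<bar>real (N t \<omega>) - lam t\<bar>} + prob {\<omega>\<in>space M. \<delta> * b t < \<bar>Y t \<omega> - b t\<bar>}"
        by (intro measure_Un_le) measurable
      also have "\<dots> \<le> 2 * \<eta>" using elim(5,6) by linarith
      finally show ?thesis .
    qed
    then have PG': "1 - 2 * \<eta> \<le> prob G" using prob_compl[OF G] by linarith
    have intG: "integrable M (\<lambda>\<omega>. K * indicator G \<omega>)" "integrable M (\<lambda>\<omega>. K * indicator (space M - G) \<omega>)" for K :: real
      by (intro integrable_mult_right integrable_real_indicator; auto simp: emeasure_eq_measure)+
    have EG: "(\<integral>\<omega>. K * indicator G \<omega> \<partial>M) = K * prob G"
      "(\<integral>\<omega>. K * indicator (space M - G) \<omega> \<partial>M) = K * prob (space M - G)" for K :: real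
      by simp_all
    let ?I = "\<lambda>\<omega>. real (N t \<omega>) powr q * indicator {\<omega>'. real (N t \<omega>') > (1 + \<delta>') * lam t} \<omega>"
    show ?case
    proof (intro allI impI)
      fix x s assume x: "\<gamma> * lam t \<le> x"
      let ?w = "\<lambda>\<omega>. x + mu * (lam t - N t \<omega>) + Y t \<omega> - b t"
      let ?Q = "centered_surplus_prob M (claim_surplus N Y X) T t x"
      let ?g = "\<lambda>\<omega>. local_prob {1..N t \<omega>} (?w \<omega>)"
      note Q = surplus_prob_eq[OF t, of x]
      have x0: "0 < x" using x g0 lam by (meson less_le_trans mult_pos_pos)
      have fx: "0 \<le> f x" by (rule F_Delta_nonneg)
      have near: "\<bar>real (N t \<omega>) - lam t\<bar> \<le> eps / 8 * lam t" "\<bar>?w \<omega> - x\<bar> \<le> eps / 8 * x" if "\<omega> \<in> G" for \<omega>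
      proof -
        have h: "\<bar>real (N t \<omega>) - lam t\<bar> \<le> \<delta> * lam t" "\<bar>Y t \<omega> - b t\<bar> \<le> \<delta> * b t" using that by (auto simp: G_def)
        have "\<delta> * lam t \<le> eps / 8 * lam t" using \<delta>(2) lam by (intro mult_right_mono) auto
        with h(1) show "\<bar>real (N t \<omega>) - lam t\<bar> \<le> eps / 8 * lam t" by linarith
        have "?w \<omega> - x = - (mu * (real (N t \<omega>) - lam t)) + (Y t \<omega> - b t)" by (simp add: algebra_simps)
        then have "\<bar>?w \<omega> - x\<bar> \<le> \<bar>mu * (real (N t \<omega>) - lam t)\<bar> + \<bar>Y t \<omega> - b t\<bar>"
          by (metis abs_minus_cancel abs_triangle_ineq)
        also have "\<bar>mu * (real (N t \<omega>) - lam t)\<bar> \<le> mu * (\<delta> * lam t)"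
          using h(1) mu_nonneg by (simp add: abs_mult mult_left_mono)
        also have "\<bar>Y t \<omega> - b t\<bar> \<le> \<delta> * (\<gamma> * lam t)"
        proof -
          have "b t \<le> \<gamma> * lam t" using b_le \<nu>'(2) lam by (meson less_imp_le mult_right_mono order_trans)
          then have "\<delta> * b t \<le> \<delta> * (\<gamma> * lam t)" using \<delta>(1) by (intro mult_left_mono) auto
          with h(2) show ?thesis by linarith
        qed
        also have "mu * (\<delta> * lam t) + \<delta> * (\<gamma> * lam t) = \<delta> * (mu + \<gamma>) * lam t" by (simp add: algebra_simps)
        also have "\<dots> \<le> eps / 8 * \<gamma> * lam t" using \<delta>(3) lam by (intro mult_right_mono) auto
        also have "\<dots> \<le> eps / 8 * x" using mult_left_mono[OF x, of "eps / 8"] eps by (simp add: mult.assoc)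
        finally show "\<bar>?w \<omega> - x\<bar> \<le> eps / 8 * x" by simp
      qed
      \<comment> \<open>The second form charges the term \<open>lam t\<close> only outside
        \<open>G\<close>, an event of small probability.\<close>
      have far: "?g \<omega> \<le> C * f x * (lam t + ?I \<omega>)" "?g \<omega> \<le> C * f x * (lam t * indicator (space M - G) \<omega> + ?I \<omega>) \<or> \<omega> \<in> G"
        if "\<omega> \<in> space M" "0 \<le> Y t \<omega>" for \<omega>
      proof -
        have "b t \<le> (1 - c) * x"
        proof -
          have "0 \<le> 1 - c" using c_eq \<nu>' g0 nu_pos by (smt (verit) mult_less_0_iff)
          then have "(1 - c) * (\<gamma> * lam t) \<le> (1 - c) * x" using x by (intro mult_left_mono) auto
          then show ?thesis using b_le c_eq by (simp add: mult.assoc)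
        qed
        then have "c * x + mu * (lam t - real (N t \<omega>)) \<le> ?w \<omega>" using that(2) by (simp add: algebra_simps)
        then have "?g \<omega> \<le> C * f x * (if real (N t \<omega>) \<le> (1 + \<delta>') * lam t then lam t else real (N t \<omega>) powr q)"
          using crude x by blast
        also have "\<dots> \<le> C * f x * (lam t + ?I \<omega>)"
          using C fx lam by (intro mult_left_mono) auto
        finally show "?g \<omega> \<le> C * f x * (lam t + ?I \<omega>)" .
        then show "?g \<omega> \<le> C * f x * (lam t * indicator (space M - G) \<omega> + ?I \<omega>) \<or> \<omega> \<in> G"
          using that(1) by (cases "\<omega> \<in> G") auto
      qed
      show "((\<forall>z. \<bar>z - x\<bar> \<le> eps * x \<longrightarrow> f z \<le> s) \<longrightarrow> ?Q \<le> (1 + eps) * lam t * s) \<and>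
        (0 \<le> s \<longrightarrow> (\<forall>z. \<bar>z - x\<bar> \<le> eps * x \<longrightarrow> s \<le> f z) \<longrightarrow> lam t * ((1 - eps) * s - eps * f x) \<le> ?Q)"
      proof (intro conjI impI)
        assume s: "\<forall>z. \<bar>z - x\<bar> \<le> eps * x \<longrightarrow> f z \<le> s"
        have fs: "f x \<le> s" using s[rule_format, of x] eps x0 by simp
        let ?h = "\<lambda>\<omega>. (1 + eps / 2) * lam t * s * indicator G \<omega> +
            (C * f x * lam t * indicator (space M - G) \<omega> + C * f x * ?I \<omega>)"
        have "?Q \<le> (\<integral>\<omega>. ?h \<omega> \<partial>M)"
          unfolding Q(2)
        proof (rule integral_mono_AE)
          show "integrable M ?g" by (rule Q(1))
          show "integrable M ?h" using tail intG by (intro Bochner_Integration.integrable_add integrable_mult_right) auto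
          show "AE \<omega> in M. ?g \<omega> \<le> ?h \<omega>"
            using Y_nonneg[OF t] AE_space
          proof eventually_elim
            case (elim \<omega>)
            have I: "0 \<le> C * f x * ?I \<omega>" using C fx by simp
            show ?case
            proof (cases "\<omega> \<in> G")
              case True
              then have "?g \<omega> \<le> (1 + eps / 2) * lam t * s" using up x near[OF True] s by blast
              then show ?thesis using True I by simp
            next
              case False
              then show ?thesis using far(2)[OF elim(2,1)] by (simp add: algebra_simps)
            qed
          qed
        qed
        also have "\<dots> = (1 + eps / 2) * lam t * s * prob G + (C * f x * lam t * prob (space M - G) + C * f x * (\<integral>\<omega>. ?I \<omega> \<partial>M))"
          using tail intG EG by simp
        also have "\<dots> \<le> (1 + eps / 2) * lam t * s * 1 + (C * f x * lam t * (2 * \<eta>) + C * f x * (\<eta> * lam t))"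
          using PG tail C fx lam fs eps by (intro add_mono mult_left_mono) auto
        also have "\<dots> = (1 + eps / 2) * (lam t * s) + 3 * (C * \<eta>) * (lam t * f x)" by (simp add: algebra_simps)
        also have "\<dots> \<le> (1 + eps / 2) * (lam t * s) + eps / 2 * (lam t * s)"
          using \<eta>(3) lam fs fx eps by (intro add_left_mono mult_mono) auto
        also have "\<dots> = (1 + eps) * lam t * s" by (simp add: algebra_simps)
        finally show "?Q \<le> (1 + eps) * lam t * s" .
      next
        assume s0: "0 \<le> s" and s: "\<forall>z. \<bar>z - x\<bar> \<le> eps * x \<longrightarrow> s \<le> f z"
        have "lam t * ((1 - eps) * s - eps * f x) \<le> (1 - eps / 2) * lam t * s * (1 - 2 * \<eta>) - eps * lam t * f x"
        proof -
          have "(1 - eps) * (lam t * s) \<le> ((1 - eps / 2) * (1 - 2 * \<eta>)) * (lam t * s)"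
          proof (rule mult_right_mono)
            have "(1 - eps / 2) * (1 - eps / 2) \<le> (1 - eps / 2) * (1 - 2 * \<eta>)"
              using \<eta>(2) eps by (intro mult_left_mono) auto
            moreover have "(1 - eps / 2) * (1 - eps / 2) = 1 - eps + eps / 2 * (eps / 2)" by (simp add: field_simps)
            moreover have "0 \<le> eps / 2 * (eps / 2)" by simp
            ultimately show "1 - eps \<le> (1 - eps / 2) * (1 - 2 * \<eta>)" by linarith
          qed (use lam s0 in auto)
          moreover have "lam t * ((1 - eps) * s - eps * f x) = (1 - eps) * (lam t * s) - eps * lam t * f x"
            by (simp add: algebra_simps)
          moreover have "(1 - eps / 2) * lam t * s * (1 - 2 * \<eta>) = ((1 - eps / 2) * (1 - 2 * \<eta>)) * (lam t * s)"
            by (simp only: mult_ac)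
          ultimately show ?thesis by linarith
        qed
        also have "\<dots> \<le> (1 - eps / 2) * lam t * s * prob G - eps * lam t * f x * prob G"
          using PG' lam s0 eps fx by (intro diff_mono mult_left_mono mult_left_le) auto
        also have "\<dots> = ((1 - eps / 2) * lam t * s - eps * lam t * f x) * prob G" by (simp add: algebra_simps)
        also have "\<dots> = (\<integral>\<omega>. ((1 - eps / 2) * lam t * s - eps * lam t * f x) * indicator G \<omega> \<partial>M)"
          by (simp only: EG)
        also have "\<dots> \<le> ?Q"
          unfolding Q(2)
        proof (rule integral_mono)
          show "((1 - eps / 2) * lam t * s - eps * lam t * f x) * indicator G \<omega> \<le> ?g \<omega>" for \<omega>
          proof (cases "\<omega> \<in> G")
            case True
            then have "(1 - eps / 2) * lam t * s - eps * lam t * f x \<le> ?g \<omega>"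
              using low x near[OF True] s s0 by blast
            then show ?thesis using True by simp
          qed (simp add: local_prob_nonneg)
        qed (use Q(1) intG in auto)
        finally show "lam t * ((1 - eps) * s - eps * f x) \<le> ?Q" .
      qed
    qed
  qed
qed

abbreviation "Q \<equiv> centered_surplus_prob M (claim_surplus N Y X) T"

text \<open>The theorem compares with \<open>f (x + mu)\<close>, whereas the estimates are centered
  at \<open>x\<close>; uniformly on the region, \<open>mu\<close> is a vanishing fraction of
  \<open>x\<close>.\<close>

lemma eventually_shift_mu:
  assumes g0: "0 < \<gamma>" and P: "\<forall>\<^sub>F y in at_top. P y" and e: "0 < eps"
  shows "\<forall>\<^sub>F t in at_top. \<forall>x\<ge>\<gamma> * lam t. P (x + mu) \<and> 0 < x \<and> mu \<le> eps * x"
proof -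
  obtain y0 where y0: "\<And>y. y0 \<le> y \<Longrightarrow> P y" using P unfolding eventually_at_top_linorder by blast
  have "filterlim (\<lambda>t. \<gamma> * lam t) at_top at_top"
    using g0 by (intro filterlim_tendsto_pos_mult_at_top[OF tendsto_const _ lam_top])
  then have "\<forall>\<^sub>F t in at_top. max (max 1 y0) (mu / eps) \<le> \<gamma> * lam t"
    unfolding filterlim_at_top by blast
  then show ?thesis
  proof eventually_elim
    case (elim t)
    show ?case
    proof (intro allI impI)
      fix x assume "\<gamma> * lam t \<le> x"
      then have x: "1 \<le> x" "y0 \<le> x" "mu / eps \<le> x" using elim by auto
      then show "P (x + mu) \<and> 0 < x \<and> mu \<le> eps * x"
        using y0[of "x + mu"] mu_nonneg e by (simp add: field_simps)
    qed
  qed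
qed

text \<open>Recentering at \<open>x + mu\<close> spends half of the tolerance \<open>eps1\<close> on
  the shift. The surplus probability is the denominator here, so its positivity belongs to the
  estimate; it follows from the lower bound itself.\<close>

lemma surplus_lesssim_lower:
  assumes \<gamma>: "nu < \<gamma>"
  shows "uniformly_lesssim (\<lambda>t. {\<gamma> * lam t..})
    (\<lambda>t x. l_const f ^ 3 * ereal (lam t * f (x + mu))) (\<lambda>t x. ereal (Q t x))"
proof -
  have g0: "0 < \<gamma>" using \<gamma> nu_pos by simp
  have ep: "eventually_positive f" using ad by (simp add: almost_decreasing_def)
  obtain l where l: "l_const f = ereal l" "0 < l" "l \<le> 1"
    using l_const_pos_L_const_finite(1)[OF ad lr] l_const_le_1[OF ep] by (cases "l_const f") auto
  obtain K where K: "0 < K" "\<forall>\<^sub>F x in at_top. \<forall>u\<ge>1/2 * x. f u \<le> K * f x"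
    using dominated_variation[OF ad lr, of "1/2"] by auto
  have "uniformly_lesssim (\<lambda>t. {\<gamma> * lam t..}) (\<lambda>t x. ereal (l ^ 3 * (lam t * f (x + mu)))) (\<lambda>t x. ereal (Q t x))"
  proof (rule uniformly_lesssimI)
    fix \<eta> :: real assume \<eta>: "0 < \<eta>" "\<eta> < 1/4"
    have "ereal ((1 - \<eta> / 4) * l) < l_const f" using l \<eta> by simp
    then obtain eps1 where eps1: "0 < eps1" "\<forall>\<^sub>F x in at_top. \<forall>z. \<bar>z - x\<bar> \<le> eps1 * x \<longrightarrow> (1 - \<eta> / 4) * l * f x \<le> f z"
      by (rule less_l_constD[OF ep])
    \<comment> \<open>The last term handles the error \<open>eps * f x\<close>, which is at most
      \<open>eps * K * f (x + mu)\<close> and thus a small multiple of the main term.\<close>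
    define eps where "eps = min (min (eps1 / 2) (\<eta> / 4)) (\<eta> / 4 * l / K)"
    have eps: "0 < eps" "eps < 1" "eps \<le> eps1 / 2" "eps \<le> \<eta> / 4" "eps * K \<le> \<eta> / 4 * l"
    proof -
      show "0 < eps" using eps1 \<eta> l K by (simp add: eps_def)
      show "eps \<le> eps1 / 2" "eps \<le> \<eta> / 4" unfolding eps_def by linarith+
      then show "eps < 1" using \<eta> by linarith
      have "eps \<le> \<eta> / 4 * l / K" unfolding eps_def by (rule min.cobounded2)
      then show "eps * K \<le> \<eta> / 4 * l" using K(1) by (simp add: pos_le_divide_eq)
    qed
    \<comment> \<open>The cap 1 ensures \<open>mu \<le> x\<close>, so that \<open>x\<close> lies
      above half of \<open>x + mu\<close> and dominated variation applies.\<close>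
    have e1: "0 < min 1 (eps1 / 2)" using eps1 by simp
    show "\<forall>\<^sub>F t in at_top. \<forall>x\<in>{\<gamma> * lam t..}. 0 < Q t x \<and> l ^ 3 * (lam t * f (x + mu)) \<le> (1 + \<eta>) * Q t x"
      using surplus_bounds[OF \<gamma> eps(1,2)]
        eventually_shift_mu[OF g0 eventually_conj[OF f_pos eventually_conj[OF eps1(2) K(2)]] e1]
        lam_top[unfolded filterlim_at_top_dense, rule_format, of 0]
    proof eventually_elim
      case (elim t)
      show ?case
      proof
        fix x assume "x \<in> {\<gamma> * lam t..}"
        then have x: "\<gamma> * lam t \<le> x" by simp
        note sh = elim(2)[rule_format, OF x]
        have x0: "0 < x" and fp: "0 < f (x + mu)"
          and near: "\<And>z. \<bar>z - (x + mu)\<bar> \<le> eps1 * (x + mu) \<Longrightarrow> (1 - \<eta> / 4) * l * f (x + mu) \<le> f z"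
          and dom: "\<And>u. 1/2 * (x + mu) \<le> u \<Longrightarrow> f u \<le> K * f (x + mu)"
          using sh by auto
        have "min 1 (eps1 / 2) * x \<le> 1 * x" "min 1 (eps1 / 2) * x \<le> eps1 / 2 * x"
          using x0 by (intro mult_right_mono; simp)+
        then have mu: "mu \<le> x" "mu \<le> eps1 / 2 * x" using sh by linarith+
        let ?s = "(1 - \<eta> / 4) * l * f (x + mu)"
        have low0: "lam t * ((1 - eps) * ?s - eps * f x) \<le> Q t x"
        proof -
          have "?s \<le> f z" if "\<bar>z - x\<bar> \<le> eps * x" for z
          proof (rule near)
            have "eps * x \<le> eps1 / 2 * x" using eps(3) x0 by (intro mult_right_mono) auto
            then have "\<bar>z - x\<bar> + mu \<le> eps1 * x" using that mu(2) by simp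
            also have "\<dots> \<le> eps1 * (x + mu)" using eps1 mu_nonneg by (intro mult_left_mono) auto
            finally show "\<bar>z - (x + mu)\<bar> \<le> eps1 * (x + mu)"
              using abs_triangle_ineq4[of "z - x" mu] abs_of_nonneg[OF mu_nonneg] by (simp add: diff_diff_eq)
          qed
          moreover have "0 \<le> ?s" using \<eta> l fp by simp
          ultimately show ?thesis using elim(1) x by blast
        qed
        have fxK: "eps * f x \<le> \<eta> / 4 * l * f (x + mu)"
        proof -
          have "eps * f x \<le> eps * (K * f (x + mu))" using eps(1) mu by (intro mult_left_mono dom) auto
          also have "\<dots> \<le> \<eta> / 4 * l * f (x + mu)" using mult_right_mono[OF eps(5), of "f (x + mu)"] fp by (simp add: mult.assoc)
          finally show ?thesis .
        qed
        define R where "R = l * f (x + mu)"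
        have sR: "?s = (1 - \<eta> / 4) * R" by (simp add: R_def mult.assoc)
        have "(1 - \<eta> / 4) * ?s \<le> (1 - eps) * ?s" using eps(4) \<eta> l fp by (intro mult_right_mono) auto
        then have "(1 - \<eta> / 4) * ((1 - \<eta> / 4) * R) - \<eta> / 4 * R \<le> (1 - eps) * ?s - eps * f x"
          using fxK unfolding sR by (simp only: R_def mult.assoc)
        then have "lam t * ((1 - \<eta> / 4) * ((1 - \<eta> / 4) * R) - \<eta> / 4 * R) \<le> lam t * ((1 - eps) * ?s - eps * f x)"
          using elim(3) by (intro mult_left_mono) auto
        with low0 have "lam t * ((1 - \<eta> / 4) * ((1 - \<eta> / 4) * R) - \<eta> / 4 * R) \<le> Q t x" by (rule order_trans[rotated])
        moreover have "lam t * ((1 - \<eta> / 4) * ((1 - \<eta> / 4) * R) - \<eta> / 4 * R) =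
            ((1 - \<eta> / 4) * (1 - \<eta> / 4) - \<eta> / 4) * (lam t * R)" by algebra
        ultimately have low: "((1 - \<eta> / 4) * (1 - \<eta> / 4) - \<eta> / 4) * (lam t * R) \<le> Q t x" by (simp only:)
        have R: "0 < lam t * R" using elim(3) l fp by (simp add: R_def)
        \<comment> \<open>The linear losses total \<open>3 / 4 * \<eta>\<close>, which leaves a gain
          of \<open>\<eta> / 4\<close>; it exceeds the quadratic term because
          \<open>\<eta> < 1/4\<close>.\<close>
        have "1 \<le> (1 + \<eta>) * (1 - 3 / 4 * \<eta>)"
        proof -
          have "\<eta> * \<eta> \<le> 1/4 * \<eta>" using \<eta> by (intro mult_right_mono) auto
          moreover have "(1 + \<eta>) * (1 - 3 / 4 * \<eta>) = 1 + \<eta> / 4 - 3 / 4 * (\<eta> * \<eta>)" by (simp add: field_simps)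
          ultimately show ?thesis using \<eta> by linarith
        qed
        also have "\<dots> \<le> (1 + \<eta>) * ((1 - \<eta> / 4) * (1 - \<eta> / 4) - \<eta> / 4)"
        proof (rule mult_left_mono)
          have "(1 - \<eta> / 4) * (1 - \<eta> / 4) = 1 - \<eta> / 2 + \<eta> / 4 * (\<eta> / 4)" by (simp add: field_simps)
          moreover have "0 \<le> \<eta> / 4 * (\<eta> / 4)" by simp
          ultimately show "1 - 3 / 4 * \<eta> \<le> (1 - \<eta> / 4) * (1 - \<eta> / 4) - \<eta> / 4" by linarith
        qed (use \<eta> in simp)
        finally have "1 * (lam t * R) \<le> (1 + \<eta>) * ((1 - \<eta> / 4) * (1 - \<eta> / 4) - \<eta> / 4) * (lam t * R)"
          using R by (intro mult_right_mono) auto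
        also have "\<dots> \<le> (1 + \<eta>) * Q t x" using mult_left_mono[OF low, of "1 + \<eta>"] \<eta> by (simp add: mult.assoc)
        finally have main: "lam t * R \<le> (1 + \<eta>) * Q t x" by simp
        have "l ^ 3 \<le> l" using l power_decreasing[of 1 3 l] by simp
        then have "l ^ 3 * (lam t * f (x + mu)) \<le> l * (lam t * f (x + mu))"
          using elim(3) fp by (intro mult_right_mono) auto
        with main have "l ^ 3 * (lam t * f (x + mu)) \<le> (1 + \<eta>) * Q t x"
          by (simp add: R_def mult.left_commute)
        moreover have "0 < (1 + \<eta>) * Q t x" using main R by linarith
        then have "0 < Q t x" using \<eta> by (simp add: zero_less_mult_iff)
        ultimately show "0 < Q t x \<and> l ^ 3 * (lam t * f (x + mu)) \<le> (1 + \<eta>) * Q t x" by simp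
      qed
    qed
  qed
  then show ?thesis by (simp add: l)
qed

lemma surplus_lesssim_upper:
  assumes \<gamma>: "nu < \<gamma>"
  shows "uniformly_lesssim (\<lambda>t. {\<gamma> * lam t..})
    (\<lambda>t x. ereal (Q t x)) (\<lambda>t x. L_const f ^ 3 * ereal (lam t * f (x + mu)))"
proof -
  have g0: "0 < \<gamma>" using \<gamma> nu_pos by simp
  have ep: "eventually_positive f" using ad by (simp add: almost_decreasing_def)
  obtain L where L: "L_const f = ereal L" "1 \<le> L"
    using l_const_pos_L_const_finite(2)[OF ad lr] L_const_ge_1[OF ep] by (cases "L_const f") auto
  have "uniformly_lesssim (\<lambda>t. {\<gamma> * lam t..}) (\<lambda>t x. ereal (Q t x)) (\<lambda>t x. ereal (L ^ 3 * (lam t * f (x + mu))))"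
  proof (rule uniformly_lesssimI)
    fix \<eta> :: real assume \<eta>: "0 < \<eta>" "\<eta> < 1/4"
    have "L_const f < ereal ((1 + \<eta> / 4) * L)" using L \<eta> by simp
    then obtain eps1 where eps1: "0 < eps1" "\<forall>\<^sub>F x in at_top. \<forall>z. \<bar>z - x\<bar> \<le> eps1 * x \<longrightarrow> f z \<le> (1 + \<eta> / 4) * L * f x"
      by (rule L_const_lessD[OF ep])
    define eps where "eps = min (eps1 / 2) (\<eta> / 4)"
    have eps: "0 < eps" "eps < 1" "eps \<le> eps1 / 2" "eps \<le> \<eta> / 4"
    proof -
      show "0 < eps" using eps1 \<eta> by (simp add: eps_def)
      show "eps \<le> eps1 / 2" "eps \<le> \<eta> / 4" unfolding eps_def by linarith+
      then show "eps < 1" using \<eta> by linarith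
    qed
    have e1: "0 < eps1 / 2" using eps1 by simp
    show "\<forall>\<^sub>F t in at_top. \<forall>x\<in>{\<gamma> * lam t..}. 0 < L ^ 3 * (lam t * f (x + mu)) \<and> Q t x \<le> (1 + \<eta>) * (L ^ 3 * (lam t * f (x + mu)))"
      using surplus_bounds[OF \<gamma> eps(1,2)] eventually_shift_mu[OF g0 eventually_conj[OF f_pos eps1(2)] e1]
        lam_top[unfolded filterlim_at_top_dense, rule_format, of 0]
    proof eventually_elim
      case (elim t)
      show ?case
      proof
        fix x assume "x \<in> {\<gamma> * lam t..}"
        then have x: "\<gamma> * lam t \<le> x" by simp
        note sh = elim(2)[rule_format, OF x]
        have x0: "0 < x" and fp: "0 < f (x + mu)" and mu: "mu \<le> eps1 / 2 * x"
          and near: "\<And>z. \<bar>z - (x + mu)\<bar> \<le> eps1 * (x + mu) \<Longrightarrow> f z \<le> (1 + \<eta> / 4) * L * f (x + mu)"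
          using sh by auto
        let ?s = "(1 + \<eta> / 4) * L * f (x + mu)"
        have "f z \<le> ?s" if "\<bar>z - x\<bar> \<le> eps * x" for z
        proof (rule near)
          have "eps * x \<le> eps1 / 2 * x" using eps(3) x0 by (intro mult_right_mono) auto
          then have "\<bar>z - x\<bar> + mu \<le> eps1 * x" using that mu by simp
          also have "\<dots> \<le> eps1 * (x + mu)" using eps1 mu_nonneg by (intro mult_left_mono) auto
          finally show "\<bar>z - (x + mu)\<bar> \<le> eps1 * (x + mu)"
            using abs_triangle_ineq4[of "z - x" mu] abs_of_nonneg[OF mu_nonneg] by (simp add: diff_diff_eq)
        qed
        then have "Q t x \<le> (1 + eps) * lam t * ?s" using elim(1) x by blast
        also have "\<dots> = ((1 + eps) * (1 + \<eta> / 4)) * (L * (lam t * f (x + mu)))" by (simp add: mult_ac)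
        also have "\<dots> \<le> (1 + \<eta>) * (L ^ 3 * (lam t * f (x + mu)))"
        proof (rule mult_mono)
          have "(1 + eps) * (1 + \<eta> / 4) \<le> (1 + \<eta> / 4) * (1 + \<eta> / 4)" using eps \<eta> by (intro mult_right_mono) auto
          also have "\<dots> = 1 + \<eta> / 2 + \<eta> * \<eta> / 16" by (simp add: field_simps)
          also have "\<dots> \<le> 1 + \<eta>" using mult_right_mono[of \<eta> "1/4" \<eta>] \<eta> by linarith
          finally show "(1 + eps) * (1 + \<eta> / 4) \<le> 1 + \<eta>" .
          have "L \<le> L ^ 3" using L power_increasing[of 1 3 L] by simp
          then show "L * (lam t * f (x + mu)) \<le> L ^ 3 * (lam t * f (x + mu))"
            using elim(3) fp by (intro mult_right_mono) auto
        qed (use \<eta> L elim(3) fp in auto)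
        finally have "Q t x \<le> (1 + \<eta>) * (L ^ 3 * (lam t * f (x + mu)))" .
        moreover have "0 < L ^ 3 * (lam t * f (x + mu))" using L elim(3) fp by simp
        ultimately show "0 < L ^ 3 * (lam t * f (x + mu)) \<and> Q t x \<le> (1 + \<eta>) * (L ^ 3 * (lam t * f (x + mu)))" by simp
      qed
    qed
  qed
  then show ?thesis by (simp add: L)
qed

end

theorem theorem3p2:
  fixes M :: "'a measure"
    and N :: "real \<Rightarrow> 'a \<Rightarrow> nat"
    and Y :: "real \<Rightarrow> 'a \<Rightarrow> real"
    and X :: "nat \<Rightarrow> 'a \<Rightarrow> real"
    and F :: "real measure"
    and T :: ereal
    and lam b :: "real \<Rightarrow> real"
    and mu nu r p :: real
  assumes "prob_space M"
    and "0 < T"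
    and "counting_process M N"
    and "\<And>t. 0 \<le> t \<Longrightarrow> integrable M (\<lambda>\<omega>. real (N t \<omega>))"
    and "\<And>t. 0 \<le> t \<Longrightarrow> lam t = (\<integral>\<omega>. real (N t \<omega>) \<partial>M)"
    and "filterlim lam at_top at_top"
    and "nonneg_nondecreasing_process M Y"
    and "\<And>t. 0 \<le> t \<Longrightarrow> integrable M (Y t)"
    and "\<And>t. 0 \<le> t \<Longrightarrow> b t = (\<integral>\<omega>. Y t \<omega> \<partial>M)"
    and "filterlim b at_top at_top"
    and "prob_space.indep_vars M (\<lambda>_. borel) X {1..}"
    and "\<And>k. 1 \<le> k \<Longrightarrow> distr M borel (X k) = F"
    and "\<And>k. 1 \<le> k \<Longrightarrow> AE \<omega> in M. 0 \<le> X k \<omega>"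
    and "integrable F (\<lambda>x. x)"
    and "mu = (\<integral>x. x \<partial>F)"
    and "prob_space.indep_sets M
           (\<lambda>i. [generated_sigma M borel {0..} Y,
                  generated_sigma M (count_space UNIV) {0..} N,
                  generated_sigma M borel {1..} X] ! i) {..<3}"
    and "1 < r"
    and "integrable F (\<lambda>x. (x * indicator {0..} x) powr r)"
    and "almost_decreasing (F_Delta F T)"
    and "0 < nu"
    and "Limsup at_top (\<lambda>t. ereal (b t / lam t)) = ereal nu"
    and "tendsto_in_prob M (\<lambda>t \<omega>. Y t \<omega> / b t) 1"
    and "\<bar>lower_Matuszewska_index (F_Delta F T)\<bar> < ereal p"
    and "\<And>\<delta>. 0 < \<delta> \<Longrightarrow> (\<forall>\<^sub>F t in at_top. integrable M
           (\<lambda>\<omega>. real (N t \<omega>) powr p * indicator {\<omega>'. real (N t \<omega>') > (1 + \<delta>) * lam t} \<omega>))"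
    and "\<And>\<delta>. 0 < \<delta> \<Longrightarrow>
           (\<lambda>t. \<integral>\<omega>. real (N t \<omega>) powr p * indicator {\<omega>'. real (N t \<omega>') > (1 + \<delta>) * lam t} \<omega> \<partial>M)
             \<in> O[at_top](lam)"
  shows "(O_regularly_varying (F_Delta F T) \<longrightarrow>
           (\<forall>\<gamma>>nu.
             uniformly_lesssim (\<lambda>t. {\<gamma> * lam t..})
               (\<lambda>t x. l_const (F_Delta F T) ^ 3 * ereal (lam t * F_Delta F T (x + mu)))
               (\<lambda>t x. ereal (centered_surplus_prob M (claim_surplus N Y X) T t x)) \<and>
             uniformly_lesssim (\<lambda>t. {\<gamma> * lam t..})
               (\<lambda>t x. ereal (centered_surplus_prob M (claim_surplus N Y X) T t x))
               (\<lambda>t x. L_const (F_Delta F T) ^ 3 * ereal (lam t * F_Delta F T (x + mu))))) \<and>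
         (intermediate_regularly_varying (F_Delta F T) \<longrightarrow>
           (\<forall>\<gamma>>nu.
             uniformly_sim (\<lambda>t. {\<gamma> * lam t..})
               (\<lambda>t x. ereal (centered_surplus_prob M (claim_surplus N Y X) T t x))
               (\<lambda>t x. ereal (lam t * F_Delta F T (x + mu)))))"
proof -
  let ?lower = "\<lambda>\<gamma>. uniformly_lesssim (\<lambda>t. {\<gamma> * lam t..})
       (\<lambda>t x. l_const (F_Delta F T) ^ 3 * ereal (lam t * F_Delta F T (x + mu)))
       (\<lambda>t x. ereal (centered_surplus_prob M (claim_surplus N Y X) T t x))"
  let ?upper = "\<lambda>\<gamma>. uniformly_lesssim (\<lambda>t. {\<gamma> * lam t..})
       (\<lambda>t x. ereal (centered_surplus_prob M (claim_surplus N Y X) T t x))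
       (\<lambda>t x. L_const (F_Delta F T) ^ 3 * ereal (lam t * F_Delta F T (x + mu)))"
  interpret prob_space M by fact
  have real_F: "real_distribution F"
    using assms(11) assms(12)[of 1] by (auto simp: indep_vars_def intro: real_distribution_distr)
  then interpret F: real_distribution F .
  have F_nonneg: "AE x in F. 0 \<le> x"
    using assms(11) by (subst assms(12)[of 1, symmetric], simp, subst AE_distr_iff)
      (use assms(13)[of 1] in \<open>auto simp: indep_vars_def\<close>)
  have main: "?lower \<gamma>" "?upper \<gamma>"
    if lr: "\<And>y. 1 \<le> y \<Longrightarrow> 0 < lower_ratio (F_Delta F T) y" and \<gamma>: "nu < \<gamma>" for \<gamma>
  proof -
    obtain q c where q: "0 < q" "q < p" "0 < c" "\<forall>\<^sub>F x in at_top. c * x powr (-q) \<le> F_Delta F T x"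
      by (rule lower_Matuszewska_index_power_bound[OF assms(19) lr assms(23)])
    \<comment> \<open>The moment order can be lowered to at most 2 because
      \<open>x powr min r 2 \<le> 1 + x powr r\<close> for \<open>x \<ge> 0\<close>.\<close>
    have "integrable F (\<lambda>x. \<bar>x\<bar> powr min r 2)"
    proof (rule Bochner_Integration.integrable_bound)
      show "integrable F (\<lambda>x. 1 + (x * indicator {0..} x) powr r)" using assms(18) by simp
      show "AE x in F. norm (\<bar>x\<bar> powr min r 2) \<le> norm (1 + (x * indicator {0..} x) powr r)"
        using F_nonneg
      proof eventually_elim
        case (elim x)
        show ?case
        proof (cases "x \<le> 1")
          case True
          then have "x powr min r 2 \<le> 1" using elim assms(17) by (intro powr_le1) auto
          then show ?thesis using elim by (simp add: add_increasing2)
        next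
          case False
          then have "x powr min r 2 \<le> x powr r" by (intro powr_mono) auto
          then show ?thesis using elim by simp
        qed
      qed
    qed measurable
    then interpret risk_model M X F mu "min r 2" T q c N Y lam b nu p
      by unfold_locales (use assms lr q in auto)
    show "?lower \<gamma>"
      by (rule surplus_lesssim_lower[OF \<gamma>])
    show "?upper \<gamma>"
      by (rule surplus_lesssim_upper[OF \<gamma>])
  qed
  have OR: "0 < lower_ratio (F_Delta F T) y" if "O_regularly_varying (F_Delta F T)" "1 \<le> y" for y
    using that by (simp add: O_regularly_varying_def)
  show ?thesis
  proof (intro conjI impI allI)
    fix \<gamma> assume or: "O_regularly_varying (F_Delta F T)" and \<gamma>: "nu < \<gamma>"
    show "?lower \<gamma>"
      by (rule main(1)[OF OR[OF or] \<gamma>])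
    show "?upper \<gamma>"
      by (rule main(2)[OF OR[OF or] \<gamma>])
  next
    fix \<gamma> assume ir: "intermediate_regularly_varying (F_Delta F T)" and \<gamma>: "nu < \<gamma>"
    note lr = intermediate_regularly_varying_lower_ratio_pos[OF ir assms(19)]
    note lL = intermediate_regularly_varying_l_const_L_const[OF ir F_Delta_right_continuous[OF real_F assms(2)]]
    show "uniformly_sim (\<lambda>t. {\<gamma> * lam t..})
         (\<lambda>t x. ereal (centered_surplus_prob M (claim_surplus N Y X) T t x))
         (\<lambda>t x. ereal (lam t * F_Delta F T (x + mu)))"
      using main[OF lr \<gamma>] by (simp add: uniformly_sim_def lL)
  qed
qed

end
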